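(* Let $m\le n\le q$ be positive integers and suppose that \[V_m\otimes V_n\cong V_{\lambda_1}\oplus V_{\lambda_2}\oplus\dots\oplus V_{\lambda_m},\qquad \lambda_1\ge\lambda_2\ge\dots\ge\lambda_m>0 .\] For $i\in[m]$ let $a_i+1=\min\{k\mid\lambda_k=\lambda_i\}$ and $b_i=\max\{k\mid \lambda_k=\lambda_i\}$. Then, for every $i\in[m]$, $\lambda_k=m+n-a_i-b_i=\lambda_i$ for every integer $k\in[a_i+1,b_i]$, and $(g-1)^{m+n-2b_i}\colon D_{m+n-b_i}\to D_{b_i}$ is a bijection. Denote $(g-1)^{m+n-2b_i}|_{D_{m+n-b_i}}$ by $S_{b_i}$. Consider three cases. (1) $a_i+1=b_i$. Then $i=b_i$ and $\lambda_i=m+n-2i+1=m+n-2b_i+1$. Let $y_{b_i}=S_{b_i}^{-1}(x_{b_i})$. The action of $S_{b_i}^{-1}$ is as follows: writing $k=b_i$, $a=m+n-2k$, $b=m-k$, the matrix of $S_{b_i}^{-1}$ with respect to the ordered bases $\mathcal B_{k}$ of $D_k$ and $\mathcal B_{m+n-k}$ of $D_{m+n-k}$ is $\phi(d_k)^{-1}\,(\phi(z_{i',j'}))_{1\le i',j'\le k}$, where $\phi\colon\mathbb Z\to F$ is the natural ring homomorphism, the following are integers with $\phi(d_k)\neq0$: \[d_k=\prod_{t=0}^{k-1}\binom{a+t}{b}\Big/\binom{b+t}{b},\] \[z_{i',j'}=\frac{d_k}{\binom{a+k-1}{b+i'-1}}\sum_{\ell=1}^{j'}(-1)^{\ell+j'}\binom{a+k-1}{\ell-1}\binom{a+j'-\ell-1}{j'-\ell}\prod_{r=1,\,r\ne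 i'}^{k}\frac{\ell-b-r}{i'-r}.\] (2) $a_i+1<b_i$ and $i=a_i+1$. Then $(g-1)^{\lambda_i-1}\colon D_{m+n-a_i-1}\to D_{b_i}$ is the composition $S_{b_i}\circ T$, where $T=(g-1)^{b_i-a_i-1}|_{D_{m+n-a_i-1}}\colon D_{m+n-a_i-1}\to D_{m+n-b_i}$ is an injection, and $S_{b_i}^{-1}(x_{b_i})\in\operatorname{Im}T$. Let $U\colon D_{m+n-b_i}\to D_{m+n-a_i-1}$ be the linear transformation given (writing $a=a_i$, $b=b_i$) by \[U\Big(\sum_{j=m-b+1}^m\alpha_jv_{j,m+n-b+1-j}\Big)=\sum_{k=m-a}^m\Big(\sum_{t=k}^m(-1)^{t-k}\binom{t-k+b-a-2}{b-a-2}\alpha_t\Big)v_{k,m+n-a-k}.\] Then $U|_{\operatorname{Im}T}$ is the inverse of $T$. Let $y_{a_i+1}=U(S_{b_i}^{-1}(x_{b_i}))\in D_{m+n-a_i-1}$. (3) $a_i+1<b_i$ and $a_i+2\le i\le b_i$. Let the element $y_{a_i+1}$ defined in case (2) be expressed as $y_{a_i+1}=\sum_{j=m-a_i}^m\alpha_jv_{j,m+n-a_i-j}$ with $\alpha_j\in F$. Define \[y_i=(-1)^{i-a_i-1}\sum_{j=m-i+1}^{m+a_i-i+1}\alpha_{j+i-a_i-1}\,v_{j,m+n+1-i-j}\in D_{m+n-i}.\] Then $(g-1)^{\lambda_i-1}(y_i)=x_{m+n-i-\lambda_i+1}$ and $FGy_i\cong V_{\lambda_i}$ for every $i\in[m]$,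 and \[V_m\otimes V_n=\bigoplus_{i=1}^mFGy_i\] as an internal direct sum.
   Context: $F$ is a field of characteristic $p>0$, $G$ is a cyclic group of order $q=p^a$ for some positive integer $a$ (this $a$ is unrelated to other uses of the letter), and $g$ is a fixed generator of $G$. For $1\le i\le q$, $V_i$ denotes the indecomposable $FG$-module of $F$-dimension $i$ (unique up to isomorphism; these are all the indecomposables). $[m]=\{1,\dots,m\}$. It is known that $V_m\otimes V_n$ ($m\le n\le q$; tensor product over $F$, diagonal $G$-action) is a direct sum of exactly $m$ nonzero indecomposables. $V_m$ has a basis $u_1,\dots,u_m$ with $gu_1=u_1$ and $gu_i=u_{i-1}+u_i$ for $i>1$; $V_n$ has a basis $w_1,\dots,w_n$ with $gw_1=w_1$ and $gw_i=w_{i-1}+w_i$ for $i>1$. For $1\le i\le m$, $1\le j\le n$ set $v_{i,j}=u_i\otimes g^{n-i}w_j$; these form a basis of $V_m\otimes V_n$, and $(g-1)v_{i,j}=v_{i-1,j}+v_{i,j-1}$, where $v_{k,\ell}=0$ if $k<1$ or $\ell<1$. For $k\in[m+n-1]$, $D_k$ is the $F$-span of $\{v_{i,j}\mid i+j=k+1\}$; thus $(g-1)(D_k)\subseteq D_{k-1}$ (with $D_k=\{0\}$ for $k<1$). For $i\in[m]$, $x_i=\sum_{j=1}^i(-1)^{j-1}v_{j,i+1-j}\in D_i$. $\mathcal B_k$ is the ordered basis of $D_k$ consisting of the $v_{i,j}$ with $i+j=k+1$ in increasing order of $i$. In particular, for $1\le k\le m$, $\mathcal B_k=(v_{1,k},v_{2,k-1},\dots,v_{k,1})$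 and $\mathcal B_{m+n-k}=(v_{m-k+1,n},v_{m-k+2,n-1},\dots,v_{m,n-k+1})$. Matrices act on coordinate column vectors. Binomial coefficients: $\binom{x}{0}=1$ for every integer $x$ (including $x=-1$), and integer binomial coefficients are interpreted in $F$ when used as scalars there. *)

theory Defs
  imports
    "HOL-Algebra.Generated_Groups"
    "HOL-Library.Function_Algebras"
    "Jordan_Normal_Form.Matrix"
begin

section \<open>Modules over a group algebra\<close>

text \<open>
  An \<open>FG\<close>-module is given as a linear representation of \<open>G\<close>: a subspace of an ambient vector space
  over the field \<open>'f\<close> with scalar multiplication \<open>s\<close>, together with an action of \<open>G\<close> on it by
  linear maps. Values of the action outside the subspace or outside \<open>carrier G\<close> are irrelevant.
\<close>

record ('g, 'v) gmod =
  vspace :: "'v set"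
  gact :: "'g \<Rightarrow> 'v \<Rightarrow> 'v"

locale fg_module = G?: group G + VS?: vector_space s
  for G :: "('g, 'h) monoid_scheme" (structure)
    and s :: "'f::field \<Rightarrow> 'v::ab_group_add \<Rightarrow> 'v"
    and M :: "('g, 'v) gmod" +
  assumes vspace_subspace: "subspace (vspace M)"
    and gact_closed: "x \<in> carrier G \<Longrightarrow> z \<in> vspace M \<Longrightarrow> gact M x z \<in> vspace M"
    and gact_add: "x \<in> carrier G \<Longrightarrow> z \<in> vspace M \<Longrightarrow> z' \<in> vspace M \<Longrightarrow>
      gact M x (z + z') = gact M x z + gact M x z'"
    and gact_scale: "x \<in> carrier G \<Longrightarrow> z \<in> vspace M \<Longrightarrow> gact M x (s c z) = s c (gact M x z)"
    and gact_one: "z \<in> vspace M \<Longrightarrow> gact M \<one> z = z"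
    and gact_mult: "x \<in> carrier G \<Longrightarrow> x' \<in> carrier G \<Longrightarrow> z \<in> vspace M \<Longrightarrow>
      gact M (x \<otimes> x') z = gact M x (gact M x' z)"

definition fg_submodule ::
  "('g, 'h) monoid_scheme \<Rightarrow> ('f::field \<Rightarrow> 'v::ab_group_add \<Rightarrow> 'v) \<Rightarrow> 'v set \<Rightarrow> ('g, 'v) gmod \<Rightarrow> bool"
  where "fg_submodule G s A M \<longleftrightarrow>
    module.subspace s A \<and> A \<subseteq> vspace M \<and> (\<forall>x\<in>carrier G. \<forall>z\<in>A. gact M x z \<in> A)"

definition fg_indecomposable ::
  "('g, 'h) monoid_scheme \<Rightarrow> ('f::field \<Rightarrow> 'v::ab_group_add \<Rightarrow> 'v) \<Rightarrow> ('g, 'v) gmod \<Rightarrow> bool"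
  where "fg_indecomposable G s M \<longleftrightarrow>
    fg_module G s M \<and> vspace M \<noteq> {0} \<and>
    (\<forall>A B. fg_submodule G s A M \<and> fg_submodule G s B M \<and> A \<inter> B = {0} \<and>
       vspace M = {z + z' |z z'. z \<in> A \<and> z' \<in> B} \<longrightarrow> A = {0} \<or> B = {0})"

definition fg_iso ::
  "('g, 'h) monoid_scheme \<Rightarrow> ('f::field \<Rightarrow> 'v::ab_group_add \<Rightarrow> 'v) \<Rightarrow> ('g, 'v) gmod
    \<Rightarrow> ('f \<Rightarrow> 'w::ab_group_add \<Rightarrow> 'w) \<Rightarrow> ('g, 'w) gmod \<Rightarrow> bool"
  where "fg_iso G s M t N \<longleftrightarrow>
    (\<exists>f. bij_betw f (vspace M) (vspace N) \<and>
      (\<forall>z\<in>vspace M. \<forall>z'\<in>vspace M. f (z + z') = f z + f z') \<and>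
      (\<forall>c. \<forall>z\<in>vspace M. f (s c z) = t c (f z)) \<and>
      (\<forall>x\<in>carrier G. \<forall>z\<in>vspace M. f (gact M x z) = gact N x (f z)))"

text \<open>The \<open>FG\<close>-submodule \<open>FGy\<close> generated by \<open>y\<close>, for a finite group \<open>G\<close>.\<close>

definition fg_cyclic ::
  "('g, 'h) monoid_scheme \<Rightarrow> ('f::field \<Rightarrow> 'v::ab_group_add \<Rightarrow> 'v) \<Rightarrow> ('g, 'v) gmod \<Rightarrow> 'v \<Rightarrow> 'v set"
  where "fg_cyclic G s M y = {\<Sum>x\<in>carrier G. s (c x) (gact M x y) |c. True}"

text \<open>External direct sum of a finite family: families vanishing outside the index set.\<close>

definition fam_scale :: "('f \<Rightarrow> 'v \<Rightarrow> 'v) \<Rightarrow> 'f \<Rightarrow> ('i \<Rightarrow> 'v) \<Rightarrow> 'i \<Rightarrow> 'v"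
  where "fam_scale s c f = (\<lambda>i. s c (f i))"

definition direct_sum :: "'i set \<Rightarrow> ('i \<Rightarrow> ('g, 'v::ab_group_add) gmod) \<Rightarrow> ('g, 'i \<Rightarrow> 'v) gmod"
  where "direct_sum I M =
    \<lparr>vspace = {f. (\<forall>i\<in>I. f i \<in> vspace (M i)) \<and> (\<forall>i. i \<notin> I \<longrightarrow> f i = 0)},
     gact = (\<lambda>x f i. if i \<in> I then gact (M i) x (f i) else 0)\<rparr>"

definition internal_direct_sum ::
  "('g, 'h) monoid_scheme \<Rightarrow> ('f::field \<Rightarrow> 'v::ab_group_add \<Rightarrow> 'v) \<Rightarrow> 'i set \<Rightarrow> ('i \<Rightarrow> 'v set)
    \<Rightarrow> ('g, 'v) gmod \<Rightarrow> bool"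
  where "internal_direct_sum G s I A M \<longleftrightarrow>
    (\<forall>i\<in>I. fg_submodule G s (A i) M) \<and>
    (\<forall>z\<in>vspace M. \<exists>!f. (\<forall>i\<in>I. f i \<in> A i) \<and> (\<forall>i. i \<notin> I \<longrightarrow> f i = 0) \<and> z = (\<Sum>i\<in>I. f i))"

definition basis_of ::
  "('f::field \<Rightarrow> 'v::ab_group_add \<Rightarrow> 'v) \<Rightarrow> 'i set \<Rightarrow> ('i \<Rightarrow> 'v) \<Rightarrow> 'v set \<Rightarrow> bool"
  where "basis_of s I e A \<longleftrightarrow>
    inj_on e I \<and> \<not> module.dependent s (e ` I) \<and> module.span s (e ` I) = A"

text \<open>\<open>A\<close> is the matrix (acting on coordinate columns) of the linear map \<open>f\<close> with respect to the
  ordered bases \<open>Bs\<close> of the source and \<open>Cs\<close> of the target.\<close>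

definition is_matrix_of ::
  "('f::field \<Rightarrow> 'w::ab_group_add \<Rightarrow> 'w) \<Rightarrow> 'v list \<Rightarrow> 'w list \<Rightarrow> ('v \<Rightarrow> 'w) \<Rightarrow> 'f mat \<Rightarrow> bool"
  where "is_matrix_of t Bs Cs f A \<longleftrightarrow>
    A \<in> carrier_mat (length Cs) (length Bs) \<and>
    (\<forall>j<length Bs. f (Bs ! j) = (\<Sum>i<length Cs. t (A $$ (i, j)) (Cs ! i)))"


section \<open>Tensor products\<close>

definition bilinear_on ::
  "('f \<Rightarrow> 'v::ab_group_add \<Rightarrow> 'v) \<Rightarrow> 'v set \<Rightarrow> ('f \<Rightarrow> 'w::ab_group_add \<Rightarrow> 'w) \<Rightarrow> 'w set
    \<Rightarrow> ('f \<Rightarrow> 'x::ab_group_add \<Rightarrow> 'x) \<Rightarrow> ('v \<Rightarrow> 'w \<Rightarrow> 'x) \<Rightarrow> bool"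
  where "bilinear_on s A t B r \<beta> \<longleftrightarrow>
    (\<forall>x\<in>A. \<forall>x'\<in>A. \<forall>y\<in>B. \<beta> (x + x') y = \<beta> x y + \<beta> x' y) \<and>
    (\<forall>x\<in>A. \<forall>y\<in>B. \<forall>y'\<in>B. \<beta> x (y + y') = \<beta> x y + \<beta> x y') \<and>
    (\<forall>c. \<forall>x\<in>A. \<forall>y\<in>B. \<beta> (s c x) y = r c (\<beta> x y)) \<and>
    (\<forall>c. \<forall>x\<in>A. \<forall>y\<in>B. \<beta> x (t c y) = r c (\<beta> x y))"

text \<open>
  The tensor product of the subspaces \<open>A\<close> and \<open>B\<close> is realised inside the dual of the space of
  bilinear forms on \<open>A \<times> B\<close>: the tensor of \<open>x\<close> and \<open>y\<close> is evaluation at \<open>(x, y)\<close>, and the tensor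
  product is the span of these functionals. The universal property is \<open>tensor_universal\<close> below.
\<close>

type_synonym ('f, 'v, 'w) tensor = "('v \<Rightarrow> 'w \<Rightarrow> 'f) \<Rightarrow> 'f"

definition tensor_scale :: "'f::field \<Rightarrow> ('f, 'v, 'w) tensor \<Rightarrow> ('f, 'v, 'w) tensor"
    (infixr \<open>*\<^sub>T\<close> 75)
  where "c *\<^sub>T z = (\<lambda>\<beta>. c * z \<beta>)"

definition pure_tensor ::
  "('f::field \<Rightarrow> 'v::ab_group_add \<Rightarrow> 'v) \<Rightarrow> 'v set \<Rightarrow> ('f \<Rightarrow> 'w::ab_group_add \<Rightarrow> 'w) \<Rightarrow> 'w set
    \<Rightarrow> 'v \<Rightarrow> 'w \<Rightarrow> ('f, 'v, 'w) tensor"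
  where "pure_tensor s A t B x y = (\<lambda>\<beta>. if bilinear_on s A t B (*) \<beta> then \<beta> x y else 0)"

definition tensor_space ::
  "('f::field \<Rightarrow> 'v::ab_group_add \<Rightarrow> 'v) \<Rightarrow> 'v set \<Rightarrow> ('f \<Rightarrow> 'w::ab_group_add \<Rightarrow> 'w) \<Rightarrow> 'w set
    \<Rightarrow> ('f, 'v, 'w) tensor set"
  where "tensor_space s A t B =
    module.span tensor_scale {pure_tensor s A t B x y |x y. x \<in> A \<and> y \<in> B}"

text \<open>The action below is the diagonal one, see \<open>gact_tensor_pure\<close>.\<close>

definition tensor_mod ::
  "('f::field \<Rightarrow> 'v::ab_group_add \<Rightarrow> 'v) \<Rightarrow> ('g, 'v) gmod \<Rightarrow> ('f \<Rightarrow> 'w::ab_group_add \<Rightarrow> 'w)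
    \<Rightarrow> ('g, 'w) gmod \<Rightarrow> ('g, ('f, 'v, 'w) tensor) gmod"
  where "tensor_mod s M t N =
    \<lparr>vspace = tensor_space s (vspace M) t (vspace N),
     gact = (\<lambda>x z \<beta>. if bilinear_on s (vspace M) t (vspace N) (*) \<beta>
                      then z (\<lambda>v w. \<beta> (gact M x v) (gact N x w)) else 0)\<rparr>"

lemma vector_space_tensor_scale: "vector_space tensor_scale"
  by unfold_locales (auto simp: tensor_scale_def fun_eq_iff algebra_simps)

interpretation TS: vector_space tensor_scale
  by (rule vector_space_tensor_scale)

lemma bilinear_on_gact:
  assumes "fg_module G s M" "fg_module G t N" "x \<in> carrier G"
    and "bilinear_on s (vspace M) t (vspace N) r \<beta>"
  shows "bilinear_on s (vspace M) t (vspace N) r (\<lambda>v w. \<beta> (gact M x v) (gact N x w))"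
proof -
  interpret M: fg_module G s M by fact
  interpret N: fg_module G t N by fact
  show ?thesis
    using assms(3,4) unfolding bilinear_on_def
    by (auto simp: M.gact_add M.gact_scale M.gact_closed N.gact_add N.gact_scale N.gact_closed)
qed

lemma gact_tensor_pure:
  assumes "fg_module G s M" "fg_module G t N" "x \<in> carrier G"
  shows "gact (tensor_mod s M t N) x (pure_tensor s (vspace M) t (vspace N) v w) =
    pure_tensor s (vspace M) t (vspace N) (gact M x v) (gact N x w)"
  using bilinear_on_gact[OF assms] by (auto simp: tensor_mod_def pure_tensor_def fun_eq_iff)

lemma fg_module_tensor_mod:
  assumes "fg_module G s M" "fg_module G t N"
  shows "fg_module G tensor_scale (tensor_mod s M t N)"
proof -
  interpret M: fg_module G s M by fact
  interpret N: fg_module G t N by fact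
  let ?E = "{pure_tensor s (vspace M) t (vspace N) v w |v w. v \<in> vspace M \<and> w \<in> vspace N}"
  let ?T = "tensor_mod s M t N"
  have sp: "vspace ?T = TS.span ?E"
    by (simp add: tensor_mod_def tensor_space_def)
  have add: "gact ?T x (z + z') = gact ?T x z + gact ?T x z'" for x z z'
    by (auto simp: tensor_mod_def fun_eq_iff)
  have scale: "gact ?T x (c *\<^sub>T z) = c *\<^sub>T gact ?T x z" for x c z
    by (auto simp: tensor_mod_def tensor_scale_def fun_eq_iff)
  have zero: "gact ?T x 0 = 0" for x
    by (auto simp: tensor_mod_def fun_eq_iff)
  note pure = gact_tensor_pure[OF assms]
  have closed: "gact ?T x z \<in> TS.span ?E" if x: "x \<in> carrier G" and z: "z \<in> TS.span ?E" for x z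
    using z
  proof (induction rule: TS.span_induct_alt)
    case base
    show ?case using TS.span_zero by (simp only: zero)
  next
    case (step c e z)
    then obtain v w where e: "e = pure_tensor s (vspace M) t (vspace N) v w"
      "v \<in> vspace M" "w \<in> vspace N" by auto
    have "gact ?T x e \<in> TS.span ?E"
      unfolding e(1) pure[OF x]
      using M.gact_closed[OF x e(2)] N.gact_closed[OF x e(3)] by (intro TS.span_base) blast
    then show ?case
      using step.IH unfolding add scale by (intro TS.span_add TS.span_scale)
  qed
  have one: "gact ?T \<one>\<^bsub>G\<^esub> z = z" if "z \<in> TS.span ?E" for z
    using that
  proof (induction rule: TS.span_induct_alt)
    case base
    show ?case by (simp only: zero)
  next
    case (step c e z)
    then have "gact ?T \<one>\<^bsub>G\<^esub> e = e"
      by (auto simp only: pure M.one_closed M.gact_one N.gact_one)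
    then show ?case
      using step.IH by (simp only: add scale)
  qed
  have mult: "gact ?T (x \<otimes>\<^bsub>G\<^esub> x') z = gact ?T x (gact ?T x' z)"
    if x: "x \<in> carrier G" "x' \<in> carrier G" and z: "z \<in> TS.span ?E" for x x' z
    using z
  proof (induction rule: TS.span_induct_alt)
    case base
    show ?case by (simp only: zero)
  next
    case (step c e z)
    then have "gact ?T (x \<otimes>\<^bsub>G\<^esub> x') e = gact ?T x (gact ?T x' e)"
      using x by (auto simp only: pure M.m_closed M.gact_mult N.gact_mult)
    then show ?case
      using step.IH by (simp only: add scale)
  qed
  show ?thesis
    by unfold_locales (auto simp: sp add scale closed one mult)
qed

lemma tensor_universal:
  assumes "vector_space s" "module.subspace s A"
    and "vector_space t" "module.subspace t B"
    and "vector_space r" and \<beta>: "bilinear_on s A t B r \<beta>"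
  shows "\<exists>f. Vector_Spaces.linear tensor_scale r f \<and>
           (\<forall>x\<in>A. \<forall>y\<in>B. f (pure_tensor s A t B x y) = \<beta> x y)"
    and "\<lbrakk>Vector_Spaces.linear tensor_scale r f; Vector_Spaces.linear tensor_scale r f';
          \<forall>x\<in>A. \<forall>y\<in>B. f (pure_tensor s A t B x y) = f' (pure_tensor s A t B x y);
          z \<in> tensor_space s A t B\<rbrakk> \<Longrightarrow> f z = f' z"
proof -
  interpret S: vector_space s by fact
  interpret T: vector_space t by fact
  interpret R: vector_space r by fact
  interpret P: vector_space_pair tensor_scale r ..
  obtain A0 where A0: "A0 \<subseteq> A" "S.independent A0" "S.span A0 = A"
    using S.basis_exists[of A] assms(2)
    by (metis S.span_subspace)
  obtain B0 where B0: "B0 \<subseteq> B" "T.independent B0" "T.span B0 = B"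
    using T.basis_exists[of B] assms(4)
    by (metis T.span_subspace)
  let ?p = "pure_tensor s A t B"
  let ?E = "(\<lambda>(a, b). ?p a b) ` (A0 \<times> B0)"
  define \<gamma> where "\<gamma> = (\<lambda>a b x y. S.representation A0 x a * T.representation B0 y b)"
  have bil: "bilinear_on s A t B (*) (\<gamma> a b)" for a b
    using A0 B0 unfolding bilinear_on_def \<gamma>_def
    by (auto simp: S.representation_add T.representation_add S.representation_scale
        T.representation_scale algebra_simps)
  have p\<gamma>: "?p a b (\<gamma> a' b') = (if a = a' \<and> b = b' then 1 else 0)"
    if "a \<in> A0" "b \<in> B0" for a b a' b'
    using bil[of a' b'] that A0 B0
    by (simp add: pure_tensor_def) (auto simp: \<gamma>_def S.representation_basis T.representation_basis)
  have inj: "inj_on (\<lambda>(a, b). ?p a b) (A0 \<times> B0)"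
  proof (rule inj_onI, clarify)
    fix a b a' b'
    assume *: "a \<in> A0" "b \<in> B0" "a' \<in> A0" "b' \<in> B0" "?p a b = ?p a' b'"
    then have "?p a b (\<gamma> a b) = ?p a' b' (\<gamma> a b)" by simp
    then show "a = a' \<and> b = b'"
      using p\<gamma>[OF *(1,2), of a b] p\<gamma>[OF *(3,4), of a b] by (auto split: if_splits)
  qed
  have sum_app: "sum h K \<gamma>' = (\<Sum>k\<in>K. h k \<gamma>')" for h :: "_ \<Rightarrow> ('a, 'b, 'c) tensor" and K \<gamma>'
    by (induction K rule: infinite_finite_induct) auto
  have indep: "TS.independent ?E"
  proof
    assume "TS.dependent ?E"
    then obtain K c where K: "finite K" "K \<subseteq> ?E" "(\<Sum>e\<in>K. c e *\<^sub>T e) = 0" "\<exists>e\<in>K. c e \<noteq> 0"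
      unfolding TS.dependent_explicit by blast
    then obtain e where e: "e \<in> K" "c e \<noteq> 0" by blast
    then obtain a b where ab: "a \<in> A0" "b \<in> B0" "e = ?p a b" using K(2) by auto
    have "(\<Sum>e\<in>K. c e *\<^sub>T e) (\<gamma> a b) = (\<Sum>e'\<in>K. if e' = e then c e else 0)"
      unfolding sum_app
    proof (rule sum.cong[OF refl])
      fix e' assume "e' \<in> K"
      then obtain a' b' where ab': "a' \<in> A0" "b' \<in> B0" "e' = ?p a' b'" using K(2) by auto
      have "e' = e \<longleftrightarrow> a' = a \<and> b' = b"
        using inj_onD[OF inj, of "(a', b')" "(a, b)"] ab ab' by auto
      then show "(c e' *\<^sub>T e') (\<gamma> a b) = (if e' = e then c e else 0)"
        using p\<gamma>[OF ab'(1,2), of a b] ab'(3) by (auto simp: tensor_scale_def)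
    qed
    then show False using K e by simp
  qed
  have lin: "S.span A0 = A" "T.span B0 = B" using A0 B0 by auto
  have bil_p: "bilinear_on s A t B tensor_scale ?p"
    unfolding bilinear_on_def
    by (intro conjI ballI allI ext)
       (auto simp: pure_tensor_def tensor_scale_def bilinear_on_def[of s A t B "(*)"])
  define f where "f = P.construct ?E (\<lambda>e. case the_inv_into (A0 \<times> B0) (\<lambda>(a, b). ?p a b) e of (a, b) \<Rightarrow> \<beta> a b)"
  have f: "Vector_Spaces.linear tensor_scale r f"
    unfolding f_def by (rule P.linear_construct[OF indep])
  have f_basis: "f (?p a b) = \<beta> a b" if "a \<in> A0" "b \<in> B0" for a b
  proof -
    have "the_inv_into (A0 \<times> B0) (\<lambda>(a, b). ?p a b) (?p a b) = (a, b)"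
      using the_inv_into_f_f[OF inj, of "(a, b)"] that by simp
    moreover have "?p a b \<in> ?E" using that by auto
    ultimately show ?thesis
      unfolding f_def using P.construct_basis[OF indep, of "?p a b"] by simp
  qed
  interpret F: Vector_Spaces.linear tensor_scale r f by (rule f)
  have zero_l: "\<beta> 0 y = 0 \<and> ?p 0 y = 0" if "y \<in> B" for y
  proof -
    have "0 \<in> A" using assms(2) S.subspace_0 by blast
    then have "\<beta> (s 0 0) y = r 0 (\<beta> 0 y)" "?p (s 0 0) y = 0 *\<^sub>T ?p 0 y"
      using \<beta> bil_p that unfolding bilinear_on_def by blast+
    then show ?thesis by simp
  qed
  have zero_r: "\<beta> x 0 = 0 \<and> ?p x 0 = 0" if "x \<in> A" for x
  proof -
    have "0 \<in> B" using assms(4) T.subspace_0 by blast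
    then have "\<beta> x (t 0 0) = r 0 (\<beta> x 0)" "?p x (t 0 0) = 0 *\<^sub>T ?p x 0"
      using \<beta> bil_p that unfolding bilinear_on_def by blast+
    then show ?thesis by simp
  qed
  have f1: "y \<in> B \<and> f (?p a y) = \<beta> a y" if a: "a \<in> A0" and y: "y \<in> T.span B0" for a y
    using y
  proof (induction rule: T.span_induct_alt)
    case base
    have "a \<in> A" "0 \<in> B" using a A0 T.subspace_0[OF assms(4)] by auto
    then show ?case using zero_r[of a] F.zero by metis
  next
    case (step c b y)
    have m: "a \<in> A" "b \<in> B" "y \<in> B" "t c b \<in> B"
      using a A0 B0 step T.subspace_scale[OF assms(4)] by auto
    have "\<beta> a (t c b + y) = r c (\<beta> a b) + \<beta> a y" "?p a (t c b + y) = c *\<^sub>T ?p a b + ?p a y"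
      using \<beta> bil_p m unfolding bilinear_on_def by metis+
    then show ?case
      using step.IH f_basis[OF a step.hyps(1)] T.subspace_add[OF assms(4) m(4,3)]
      by (simp only: F.add F.scale)
  qed
  have f2: "x \<in> A \<and> f (?p x y) = \<beta> x y" if y: "y \<in> B" and x: "x \<in> S.span A0" for x y
    using x
  proof (induction rule: S.span_induct_alt)
    case base
    show ?case using zero_l[OF y] F.zero S.subspace_0[OF assms(2)] by metis
  next
    case (step c a x)
    have m: "a \<in> A" "x \<in> A" "s c a \<in> A"
      using A0 step S.subspace_scale[OF assms(2)] by auto
    have "\<beta> (s c a + x) y = r c (\<beta> a y) + \<beta> x y" "?p (s c a + x) y = c *\<^sub>T ?p a y + ?p x y"
      using \<beta> bil_p m y unfolding bilinear_on_def by metis+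
    then show ?case
      using step.IH f1[of a y] step.hyps(1) y B0(3) S.subspace_add[OF assms(2) m(3,2)]
      by (simp only: F.add F.scale)
  qed
  show "\<exists>f. Vector_Spaces.linear tensor_scale r f \<and> (\<forall>x\<in>A. \<forall>y\<in>B. f (?p x y) = \<beta> x y)"
    using f f2 A0 by blast
next
  assume f: "Vector_Spaces.linear tensor_scale r f" "Vector_Spaces.linear tensor_scale r f'"
    and eq: "\<forall>x\<in>A. \<forall>y\<in>B. f (pure_tensor s A t B x y) = f' (pure_tensor s A t B x y)"
    and z: "z \<in> tensor_space s A t B"
  interpret R: vector_space r by fact
  interpret P: vector_space_pair tensor_scale r ..
  show "f z = f' z"
    by (rule P.linear_eq_on[OF f z[unfolded tensor_space_def]]) (use eq in auto)
qed

lemma vector_space_fam_scale: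
  assumes "vector_space s"
  shows "vector_space (fam_scale s)"
proof -
  interpret vector_space s by fact
  show ?thesis
    by unfold_locales (auto simp: fam_scale_def fun_eq_iff scale_right_distrib scale_left_distrib)
qed

lemma fg_module_direct_sum:
  assumes "group G" "vector_space s" "\<And>i. i \<in> I \<Longrightarrow> fg_module G s (M i)"
  shows "fg_module G (fam_scale s) (direct_sum I M)"
proof -
  interpret G: group G by fact
  interpret S: vector_space s by fact
  interpret F: vector_space "fam_scale s" by (rule vector_space_fam_scale) fact
  have sub: "S.subspace (vspace (M i))" if "i \<in> I" for i
    using fg_module.vspace_subspace[OF assms(3)[OF that]] .
  have "F.subspace (vspace (direct_sum I M))"
    using sub unfolding F.subspace_def S.subspace_def
    by (auto simp: direct_sum_def fam_scale_def)
  then show ?thesis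
    using assms(3)[THEN fg_module.gact_closed] assms(3)[THEN fg_module.gact_add]
      assms(3)[THEN fg_module.gact_scale] assms(3)[THEN fg_module.gact_one]
      assms(3)[THEN fg_module.gact_mult]
    by unfold_locales
      (auto simp: direct_sum_def fam_scale_def fun_eq_iff intro: G.m_closed)
qed


section \<open>The entries of the inverse matrix\<close>

text \<open>Used with \<open>a = m + n - 2 k\<close> and \<open>b = m - k\<close>. The values are integers, but the defining
  formulas involve quotients, so they are stated in \<open>rat\<close>.\<close>

definition d_rat :: "nat \<Rightarrow> nat \<Rightarrow> nat \<Rightarrow> rat"
  where "d_rat a b k = (\<Prod>t<k. of_nat ((a + t) choose b) / of_nat ((b + t) choose b))"

text \<open>The generalised binomial coefficient is needed since its upper argument is \<open>-1\<close> for \<open>a = 0\<close>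
  and \<open>l = j\<close>.\<close>

definition z_rat :: "nat \<Rightarrow> nat \<Rightarrow> nat \<Rightarrow> nat \<Rightarrow> nat \<Rightarrow> rat"
  where "z_rat a b k i j =
    d_rat a b k / of_nat ((a + k - 1) choose (b + i - 1)) *
    (\<Sum>l=1..j. (-1) ^ (l + j) * of_nat ((a + k - 1) choose (l - 1)) *
       ((of_nat a + of_nat j - of_nat l - 1) gchoose (j - l)) *
       (\<Prod>r\<in>{1..k} - {i}. (of_nat l - of_nat b - of_nat r) / (of_nat i - of_nat r)))"

end

theory Submission
  imports
    Defs
    "Jordan_Normal_Form.Determinant"
    "HOL-Algebra.Multiplicative_Group"
    "HOL-Computational_Algebra.Formal_Power_Series"
begin

text \<open>
Write \<open>N\<close> for the operator \<open>g - 1\<close>. A module for the cyclic group is a vector space with the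
nilpotent operator \<open>N\<close>, the module \<open>V i\<close> is a single string \<open>z, N z, ..., N\<^sup>i\<^sup>-\<^sup>1 z\<close>, and decomposing
a module means finding a basis made of strings. On the vectors \<open>v i j\<close> the operator \<open>N\<close> acts by
\<open>v i j \<mapsto> v (i-1) j + v i (j-1)\<close>. Reading \<open>v i j\<close> as the monomial \<open>X\<^sup>m\<^sup>-\<^sup>i Y\<^sup>n\<^sup>-\<^sup>j\<close>, the tensor product is
\<open>F[X,Y]/(X\<^sup>m,Y\<^sup>n)\<close>, the operator \<open>N\<close> is multiplication by \<open>X + Y\<close>, and the layers \<open>D k\<close> are the
homogeneous parts.

The kernel of \<open>N\<close> meets each layer \<open>D i\<close> with \<open>i \<le> m\<close> in the line spanned by \<open>x i\<close>, and meets the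
higher layers trivially (\<open>kernel_layer_small\<close>, \<open>kernel_layer_large\<close>). Hence a string basis may be
taken homogeneous, with one string ending in each \<open>x i\<close>. Multiplication by \<open>X\<close> commutes with \<open>N\<close> and
maps \<open>x (i+1)\<close> to \<open>- x i\<close>, so the string that ends in \<open>x i\<close> is at least as long as the one that ends
in \<open>x (i+1)\<close>. The lengths \<open>lam\<close> are weakly decreasing too, and counting the \<open>x i\<close> in the images of
the powers of \<open>N\<close> shows that the string ending in \<open>x i\<close> has length \<open>lam i\<close> (\<open>high_iff\<close>).

This string therefore starts in layer \<open>m + n - \<sigma> i\<close> with \<open>\<sigma> i = m + n + 1 - i - lam i\<close>. Comparing the
number of strings that pass through a layer with the dimension of the layer shows that \<open>\<sigma>\<close> is a
permutation of \<open>{1..m}\<close> (\<open>\<sigma>_layered\<close>), and monotonicity of \<open>lam\<close> says that \<open>\<sigma>\<close> never drops by more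
than one. Such a permutation is layered: it preserves \<open>{1..i}\<close> at each non-descent \<open>i\<close>, and it reverses the
intervals in between (\<open>layered_permutation\<close>). These intervals are the sets \<open>{a+1..b}\<close> on which \<open>lam\<close> is
constant, which gives \<open>lam = m + n - a - b\<close> there (\<open>layered_block\<close>). That \<open>\<sigma>\<close> preserves \<open>{1..b}\<close> also means
that the strings ending in a layer up to \<open>b\<close> are those that start in a layer from \<open>m + n - b\<close> on, and so the
power of \<open>N\<close> from \<open>D (m+n-b)\<close> to \<open>D b\<close> is bijective (\<open>bij_middle\<close>).

It remains to make the string generators explicit. The first generator of the block \<open>{a+1..b}\<close>
lies in layer \<open>m + n - a - 1\<close> and belongs to the string that ends in \<open>x b\<close>. The way down consists of the power
\<open>R = N\<^sup>b\<^sup>-\<^sup>a\<^sup>-\<^sup>1\<close> into layer \<open>m + n - b\<close> and of the bijection \<open>S\<close>. On coefficients along an antidiagonal, \<open>R\<close>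
is convolution with the coefficients of \<open>(1+t)\<^sup>b\<^sup>-\<^sup>a\<^sup>-\<^sup>1\<close>, and \<open>U\<close> is convolution with those of the inverse
power series (\<open>alternating_inverse\<close>). The matrix of \<open>S\<close> has binomial
coefficients as entries, and Lagrange interpolation inverts it (\<open>binomial_matrix_inverse\<close>). Since
multiplication by \<open>- X\<close> maps \<open>x i\<close> to \<open>x (i-1)\<close>, the other generators of the block arise from the first one
by multiplication with powers of \<open>- X\<close>, which only shifts the indices of the coefficients. Strings with
independent last vectors are independent, and a count of dimensions finishes the proof (\<open>strings_jordan\<close>).
\<close>

section \<open>A matrix of binomial coefficients\<close>

text \<open>
Both sides are polynomials of degree less than \<open>k\<close> in \<open>y\<close> that agree at the \<open>k\<close> nodes.
\<close>

lemma lagrange_interpolation: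
  fixes q :: "'a::field_char_0 poly"
  assumes "degree q < k"
  shows "poly q y = (\<Sum>i<k. poly q (of_nat i) * (\<Prod>r\<in>{..<k} - {i}. (y - of_nat r) / (of_nat i - of_nat r)))"
proof -
  define L where "L i = smult (poly q (of_nat i) / (\<Prod>r\<in>{..<k} - {i}. of_nat i - of_nat r))
      (\<Prod>r\<in>{..<k} - {i}. [:- of_nat r, 1:])" for i
  have poly_L: "poly (L i) z =
      poly q (of_nat i) * (\<Prod>r\<in>{..<k} - {i}. (z - of_nat r) / (of_nat i - of_nat r))" for i z
    by (simp add: L_def poly_prod prod_dividef)
  have deg_L: "degree (L i) < k" if "i < k" for i
  proof -
    have "degree (\<Prod>r\<in>{..<k} - {i}. [:- of_nat r, 1:] :: 'a poly) \<le> (\<Sum>r\<in>{..<k} - {i}. 1)"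
      by (rule order_trans[OF degree_prod_sum_le]) auto
    also have "\<dots> < k" using that by simp
    finally show ?thesis by (simp add: L_def)
  qed
  have "q = (\<Sum>i<k. L i)"
  proof (rule poly_eqI_degree[where A = "of_nat ` {..<k}"])
    fix z :: 'a assume "z \<in> of_nat ` {..<k}"
    then obtain t where t: "t < k" "z = of_nat t" by auto
    have "poly (\<Sum>i<k. L i) z = (\<Sum>i<k. if i = t then poly q z else 0)"
      unfolding poly_sum
    proof (rule sum.cong[OF refl])
      fix i assume "i \<in> {..<k}"
      show "poly (L i) z = (if i = t then poly q z else 0)"
      proof (cases "i = t")
        case True
        then show ?thesis unfolding poly_L t(2) by (simp add: prod.neutral)
      next
        case False
        then have "(\<Prod>r\<in>{..<k} - {i}. (z - of_nat r) / (of_nat i - of_nat r)) = 0"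
          using t by (intro prod_zero) auto
        then show ?thesis using False by (simp add: poly_L)
      qed
    qed
    also have "\<dots> = poly q z" using t by simp
    finally show "poly q z = poly (\<Sum>i<k. L i) z" by simp
  next
    show "degree (\<Sum>i<k. L i) < card (of_nat ` {..<k} :: 'a set)"
      using deg_L assms by (auto simp: card_image inj_on_def intro!: degree_sum_less)
  qed (use assms in \<open>simp add: card_image inj_on_def\<close>)
  then have "poly q y = poly (\<Sum>i<k. L i) y" by simp
  then show ?thesis by (simp add: poly_sum poly_L)
qed


text \<open>
With \<open>a = m + n - 2 k\<close> and \<open>b = m - k\<close> this is the matrix of the power of \<open>N\<close> that maps the layer
\<open>m + n - k\<close> to the layer \<open>k\<close>, see \<open>funpow_upper_line\<close>. Rows and columns are counted from 0.
\<close>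

definition shift_binom :: "nat \<Rightarrow> nat \<Rightarrow> nat \<Rightarrow> nat \<Rightarrow> nat"
  where "shift_binom a b i j = (if i \<le> b + j then a choose (b + j - i) else 0)"

text \<open>
The value at \<open>l - b\<close> of the Lagrange basis polynomial that belongs to the node \<open>i\<close> among \<open>0, ..., k - 1\<close>.
\<close>

definition shifted_lagrange :: "nat \<Rightarrow> nat \<Rightarrow> nat \<Rightarrow> nat \<Rightarrow> rat"
  where "shifted_lagrange b k i l = (\<Prod>r\<in>{..<k} - {i}. (of_nat l - of_nat b - of_nat r) / (of_nat i - of_nat r))"

text \<open>
The matrix that turns \<open>shift_binom\<close> into the unitriangular \<open>binom_toeplitz\<close>. It is a product of
\<open>shifted_lagrange\<close> with two diagonal matrices.
\<close>

definition lagrange_factor :: "nat \<Rightarrow> nat \<Rightarrow> nat \<Rightarrow> nat \<Rightarrow> nat \<Rightarrow> rat"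
  where "lagrange_factor a b k j l = shifted_lagrange b k j l * of_nat ((a + k - 1) choose l) / of_nat ((a + k - 1) choose (b + j))"

text \<open>
Multiplication by \<open>(1 + t)\<^sup>a\<close> on truncated power series.
\<close>

definition binom_toeplitz :: "nat \<Rightarrow> nat \<Rightarrow> nat \<Rightarrow> rat"
  where "binom_toeplitz a i j = (if i \<le> j then of_nat (a choose (j - i)) else 0)"

text \<open>
Multiplication by \<open>(1 + t)\<^sup>-\<^sup>a\<close> on truncated power series. The form of the entries is the one in
\<open>z_rat\<close>, and \<open>binom_toeplitz_inv_eq\<close> identifies them as the coefficients of that series.
\<close>

definition binom_toeplitz_inv :: "nat \<Rightarrow> nat \<Rightarrow> nat \<Rightarrow> rat"
  where "binom_toeplitz_inv a i j = (if i \<le> j then (-1) ^ (i + j) * ((of_nat a + of_nat j - of_nat i - 1) gchoose (j - i)) else 0)"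

text \<open>
For fixed \<open>i < k\<close> this is a polynomial of degree \<open>k - 1\<close> in \<open>t\<close>. Up to a constant factor it is the quotient of
two binomial coefficients, see \<open>interpolant_eq\<close>.
\<close>

definition interpolant :: "nat \<Rightarrow> nat \<Rightarrow> nat \<Rightarrow> nat \<Rightarrow> rat"
  where "interpolant a k i t = (\<Prod>r<i. of_nat t - of_nat r) * (\<Prod>r\<in>{Suc i..<k}. of_nat a + of_nat r - of_nat t)"

lemma prod_diff_fact: "i \<le> t \<Longrightarrow> (\<Prod>r<i. of_nat t - of_nat r :: rat) * fact (t - i) = fact t"
proof (induction i)
  case (Suc i)
  then have "(fact (t - i) :: rat) = of_nat (t - i) * fact (t - Suc i)"
    by (metis Suc_diff_Suc Suc_le_lessD fact_Suc)
  then show ?case using Suc by (simp add: of_nat_diff mult.assoc)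
qed simp

text \<open>
For \<open>i \<le> t \<le> a + i\<close> this is a cancellation of factorials. Outside this range the binomial coefficient
on the left vanishes, and so does one factor of \<open>interpolant\<close>.
\<close>

lemma interpolant_eq:
  assumes "i < k" "t \<le> a + k - 1"
  shows "(if i \<le> t then of_nat (a choose (t - i)) else 0) * fact (a + k - 1) =
    fact a * of_nat ((a + k - 1) choose t) * interpolant a k i t"
proof -
  consider "t < i" | "i \<le> t" "t \<le> a + i" | "a + i < t" by linarith
  then show ?thesis
  proof cases
    case 1
    then have "(\<Prod>r<i. of_nat t - of_nat r :: rat) = 0" by (intro prod_zero) auto
    then show ?thesis using 1 by (simp add: interpolant_def)
  next
    case 2
    have p1: "(\<Prod>r<i. of_nat t - of_nat r :: rat) = fact t / fact (t - i)"
      using prod_diff_fact[OF 2(1)] by (simp add: field_simps)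
    have "(\<Prod>r\<in>{Suc i..<k}. of_nat a + of_nat r - of_nat t :: rat) =
        (\<Prod>r<k - 1 - i. of_nat (a + k - 1 - t) - of_nat r)"
      using 2 assms
      by (intro prod.reindex_bij_witness[of _ "\<lambda>r. k - 1 - r" "\<lambda>r. k - 1 - r"])
         (auto simp: of_nat_diff)
    also have "\<dots> = fact (a + k - 1 - t) / fact (a + i - t)"
      using prod_diff_fact[of "k - 1 - i" "a + k - 1 - t"] 2 assms by (simp add: field_simps)
    finally have p2: "(\<Prod>r\<in>{Suc i..<k}. of_nat a + of_nat r - of_nat t :: rat) =
        fact (a + k - 1 - t) / fact (a + i - t)" .
    have "of_nat (a choose (t - i)) = (fact a / (fact (t - i) * fact (a - (t - i))) :: rat)"
      using 2 by (intro binomial_fact) auto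
    moreover have "of_nat ((a + k - 1) choose t) = (fact (a + k - 1) / (fact t * fact (a + k - 1 - t)) :: rat)"
      using assms by (intro binomial_fact) auto
    moreover have "a - (t - i) = a + i - t" using 2 by simp
    ultimately show ?thesis using 2 by (simp add: interpolant_def p1 p2)
  next
    case 3
    then have "(\<Prod>r\<in>{Suc i..<k}. of_nat a + of_nat r - of_nat t :: rat) = 0"
      using assms by (intro prod_zero bexI[of _ "t - a"]) (auto simp: of_nat_diff)
    then show ?thesis using 3 by (simp add: interpolant_def binomial_eq_0)
  qed
qed

text \<open>
By \<open>interpolant_eq\<close>, row \<open>i\<close> of \<open>shift_binom\<close>, divided by the binomial coefficients in the denominators
of \<open>lagrange_factor\<close>, lists the values of a polynomial of degree \<open>k - 1\<close> at the points \<open>b + j\<close>. The product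
with \<open>shifted_lagrange\<close> is Lagrange interpolation from these points to the points \<open>l\<close>.
\<close>

lemma shift_binom_lagrange_factor:
  assumes ba: "b \<le> a" and "i < k" "l < k"
  shows "(\<Sum>j<k. of_nat (shift_binom a b i j) * lagrange_factor a b k j l) = binom_toeplitz a i l"
proof -
  define q :: "rat poly" where
    "q = (\<Prod>r<i. [:of_nat b - of_nat r, 1:]) * (\<Prod>r\<in>{Suc i..<k}. [:of_nat a + of_nat r - of_nat b, -1:])"
  have q: "poly q (of_nat t - of_nat b) = interpolant a k i t" for t
    by (simp add: q_def interpolant_def poly_prod algebra_simps)
  have q': "poly q (of_nat j) = interpolant a k i (b + j)" for j
    using q[of "b + j"] by simp
  have "degree q \<le> degree (\<Prod>r<i. [:of_nat b - of_nat r, 1:] :: rat poly)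
      + degree (\<Prod>r\<in>{Suc i..<k}. [:of_nat a + of_nat r - of_nat b, -1:] :: rat poly)"
    unfolding q_def by (rule degree_mult_le)
  also have "\<dots> \<le> (\<Sum>r<i. 1) + (\<Sum>r\<in>{Suc i..<k}. 1)"
    by (rule add_mono; rule order_trans[OF degree_prod_sum_le]) auto
  also have "\<dots> < k" using assms by simp
  finally have deg: "degree q < k" .
  have F: "(fact (a + k - 1) :: rat) \<noteq> 0" by simp
  have "of_nat (shift_binom a b i j) * lagrange_factor a b k j l =
      fact a / fact (a + k - 1) * of_nat ((a + k - 1) choose l) * (interpolant a k i (b + j) * shifted_lagrange b k j l)"
    if "j < k" for j
  proof -
    have "b + j \<le> a + k - 1" using ba that by simp
    then have "(of_nat ((a + k - 1) choose (b + j)) :: rat) \<noteq> 0"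
      and "of_nat (shift_binom a b i j) * fact (a + k - 1) =
        fact a * of_nat ((a + k - 1) choose (b + j)) * interpolant a k i (b + j)"
      using interpolant_eq[of i k "b + j" a] assms by (auto simp: shift_binom_def)
    then show ?thesis using F by (simp add: lagrange_factor_def field_simps)
  qed
  then have "(\<Sum>j<k. of_nat (shift_binom a b i j) * lagrange_factor a b k j l) =
      fact a / fact (a + k - 1) * of_nat ((a + k - 1) choose l) * (\<Sum>j<k. interpolant a k i (b + j) * shifted_lagrange b k j l)"
    by (simp add: sum_distrib_left)
  also have "(\<Sum>j<k. interpolant a k i (b + j) * shifted_lagrange b k j l) = interpolant a k i l"
    using lagrange_interpolation[OF deg, of "of_nat l - of_nat b"] by (simp add: q q' shifted_lagrange_def)
  also have "fact a / fact (a + k - 1) * of_nat ((a + k - 1) choose l) * interpolant a k i l = binom_toeplitz a i l"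
    using interpolant_eq[of i k l a] assms F by (simp add: binom_toeplitz_def field_simps)
  finally show ?thesis .
qed


lemma binom_toeplitz_inv_eq: "binom_toeplitz_inv a i j = (if i \<le> j then (- of_nat a) gchoose (j - i) else 0)"
proof (cases "i \<le> j")
  case True
  then have "(-1 :: rat) ^ (i + j) = (-1) ^ (j - i)"
    by (metis (no_types, lifting) add_diff_inverse_nat add.assoc left_minus_one_mult_self mult.commute mult_1 not_le power_add)
  then show ?thesis
    using True gbinomial_minus[of "of_nat a :: rat" "j - i"]
    by (simp add: binom_toeplitz_inv_def of_nat_diff algebra_simps)
qed (simp add: binom_toeplitz_inv_def)

lemma toeplitz_mult:
  fixes f h :: "nat \<Rightarrow> 'a::comm_ring_1"
  assumes "j < k"
  shows "(\<Sum>l<k. (if i \<le> l then f (l - i) else 0) * (if l \<le> j then h (j - l) else 0)) =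
    (if i \<le> j then \<Sum>s=0..j - i. f s * h (j - i - s) else 0)"
proof -
  have "(\<Sum>l<k. (if i \<le> l then f (l - i) else 0) * (if l \<le> j then h (j - l) else 0)) =
      (\<Sum>l\<in>{i..j}. f (l - i) * h (j - l))"
    using assms by (intro sum.mono_neutral_cong_right) auto
  also have "\<dots> = (if i \<le> j then \<Sum>s=0..j - i. f s * h (j - i - s) else 0)"
  proof (cases "i \<le> j")
    case True
    have "(\<Sum>l\<in>{i..j}. f (l - i) * h (j - l)) = (\<Sum>s=0..j - i. f s * h (j - i - s))"
      using True by (intro sum.reindex_bij_witness[of _ "\<lambda>s. s + i" "\<lambda>l. l - i"]) auto
    then show ?thesis using True by simp
  qed simp
  finally show ?thesis .
qed

lemma binom_toeplitz_inverse:
  assumes "j < k"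
  shows "(\<Sum>l<k. binom_toeplitz a i l * binom_toeplitz_inv a l j) = (if i = j then 1 else 0)"
proof -
  have "(\<Sum>l<k. binom_toeplitz a i l * binom_toeplitz_inv a l j) =
      (if i \<le> j then \<Sum>s=0..j - i. (of_nat a gchoose s) * ((- of_nat a) gchoose (j - i - s)) else 0)"
    unfolding binom_toeplitz_def binom_toeplitz_inv_eq binomial_gbinomial by (rule toeplitz_mult[OF assms])
  also have "\<dots> = (if i = j then 1 else 0)"
    unfolding gbinomial_Vandermonde by (auto simp: gbinomial_0_left)
  finally show ?thesis .
qed

text \<open>
Lagrange interpolation of the polynomial \<open>y gchoose j\<close>, whose values at the nodes form Pascal's triangle.
\<close>

lemma shifted_lagrange_pascal:
  assumes "j < k"
  shows "(\<Sum>i<k. shifted_lagrange b k i l * of_nat (i choose j)) = (of_nat l - of_nat b) gchoose j"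
proof -
  define q :: "rat poly" where "q = smult (1 / fact j) (\<Prod>i=0..<j. [:- of_nat i, 1:])"
  have "degree q \<le> degree (\<Prod>i=0..<j. [:- of_nat i, 1:] :: rat poly)"
    unfolding q_def by (rule degree_smult_le)
  also have "\<dots> \<le> (\<Sum>i=0..<j. 1)"
    by (rule order_trans[OF degree_prod_sum_le]) auto
  also have "\<dots> < k" using assms by simp
  finally have deg: "degree q < k" .
  have q: "poly q y = y gchoose j" for y
    by (simp add: q_def poly_prod gbinomial_prod_rev)
  show ?thesis
    using lagrange_interpolation[OF deg, of "of_nat l - of_nat b"]
    by (simp add: q shifted_lagrange_def binomial_gbinomial mult.commute)
qed

lemma mat_mult_fun:
  "mat k k (\<lambda>(i, j). f i j) * mat k k (\<lambda>(i, j). h i j) =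
    mat k k (\<lambda>(i, j). \<Sum>l<k. f i l * h l j)"
  by (rule eq_matI) (auto simp: scalar_prod_def lessThan_atLeast0)

lemma det_mat_upper:
  fixes f :: "nat \<Rightarrow> nat \<Rightarrow> 'a::comm_ring_1"
  assumes "\<And>i j. j < i \<Longrightarrow> i < k \<Longrightarrow> f i j = 0"
  shows "det (mat k k (\<lambda>(i, j). f i j)) = (\<Prod>i<k. f i i)"
proof -
  have "det (mat k k (\<lambda>(i, j). f i j)) = prod_list (diag_mat (mat k k (\<lambda>(i, j). f i j)))"
    using assms by (intro det_upper_triangular[where n = k]) auto
  then show ?thesis by (simp add: prod_list_diag_prod lessThan_atLeast0)
qed

lemma det_mat_lower:
  fixes f :: "nat \<Rightarrow> nat \<Rightarrow> 'a::comm_ring_1"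
  assumes "\<And>i j. i < j \<Longrightarrow> j < k \<Longrightarrow> f i j = 0"
  shows "det (mat k k (\<lambda>(i, j). f i j)) = (\<Prod>i<k. f i i)"
proof -
  have "det (mat k k (\<lambda>(i, j). f i j)) = prod_list (diag_mat (mat k k (\<lambda>(i, j). f i j)))"
    using assms by (intro det_lower_triangular[where n = k]) auto
  then show ?thesis by (simp add: prod_list_diag_prod lessThan_atLeast0)
qed

text \<open>
Interpolation takes the values of the polynomials \<open>y gchoose j\<close> at \<open>0, ..., k - 1\<close> to their values at
the points translated by \<open>- b\<close>. By the Vandermonde identity the two matrices of values differ by a unitriangular
factor, and the first of them is unitriangular.
\<close>

lemma det_shifted_lagrange: "det (mat k k (\<lambda>(l, i). shifted_lagrange b k i l)) = 1"
proof -
  let ?L = "mat k k (\<lambda>(l, i). shifted_lagrange b k i l)"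
  let ?Q = "mat k k (\<lambda>(i, j). of_nat (i choose j) :: rat)"
  let ?B = "mat k k (\<lambda>(t, j). if t \<le> j then (- of_nat b) gchoose (j - t) else 0 :: rat)"
  have "?L * ?Q = ?Q * ?B"
    unfolding mat_mult_fun
  proof (rule cong_mat[OF refl refl], clarsimp simp: shifted_lagrange_pascal)
    fix l j assume "l < k" "j < k"
    have "(\<Sum>t<k. of_nat (l choose t) * (if t \<le> j then (- of_nat b) gchoose (j - t) else 0 :: rat)) =
        (\<Sum>t=0..j. (of_nat l gchoose t) * ((- of_nat b) gchoose (j - t)))"
      using \<open>j < k\<close> by (intro sum.mono_neutral_cong_right) (auto simp: binomial_gbinomial)
    also have "\<dots> = (of_nat l - of_nat b) gchoose j"
      unfolding gbinomial_Vandermonde by simp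
    finally show "(of_nat l - of_nat b) gchoose j =
        (\<Sum>t<k. of_nat (l choose t) * (if t \<le> j then (- of_nat b) gchoose (j - t) else 0 :: rat))" ..
  qed
  moreover have "det ?Q = 1" by (subst det_mat_lower) auto
  moreover have "det ?B = 1" by (subst det_mat_upper) auto
  moreover have "det (?L * ?Q) = det ?L * det ?Q" "det (?Q * ?B) = det ?Q * det ?B"
    by (rule det_mult[where n = k]; simp)+
  ultimately show ?thesis by simp
qed

lemma d_rat_eq:
  assumes "b \<le> a"
  shows "d_rat a b k = (\<Prod>i<k. of_nat ((a + k - 1) choose (b + i)) / of_nat ((a + k - 1) choose i))"
proof -
  have 1: "(of_nat ((a + k - 1) choose (b + i)) / of_nat ((a + k - 1) choose i) :: rat) =
      (fact i / fact (b + i)) * (fact (a + (k - Suc i)) / fact (a + (k - Suc i) - b))"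
    if "i < k" for i
  proof -
    have "a + k - 1 - i = a + (k - Suc i)" "a + k - 1 - (b + i) = a + (k - Suc i) - b"
      using that by auto
    moreover have "b + i \<le> a + k - 1" "i \<le> a + k - 1" using that assms by auto
    ultimately show ?thesis by (simp add: binomial_fact)
  qed
  have 2: "(of_nat ((a + t) choose b) / of_nat ((b + t) choose b) :: rat) =
      (fact t / fact (b + t)) * (fact (a + t) / fact (a + t - b))" for t
    using assms by (simp add: binomial_fact mult.commute)
  have "(\<Prod>i<k. fact (a + (k - Suc i)) / fact (a + (k - Suc i) - b) :: rat) =
      (\<Prod>t<k. fact (a + t) / fact (a + t - b))"
    by (rule prod.nat_diff_reindex)
  moreover have "(\<Prod>i<k. of_nat ((a + k - 1) choose (b + i)) / of_nat ((a + k - 1) choose i) :: rat) =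
      (\<Prod>i<k. fact i / fact (b + i)) * (\<Prod>i<k. fact (a + (k - Suc i)) / fact (a + (k - Suc i) - b))"
    unfolding prod.distrib[symmetric] by (rule prod.cong[OF refl]) (use 1 in auto)
  ultimately show ?thesis
    unfolding d_rat_def 2 prod.distrib by simp
qed

text \<open>
All factors in \<open>shift_binom_lagrange_factor\<close> other than \<open>shift_binom\<close> and the diagonal ones have determinant 1.
\<close>

lemma det_shift_binom:
  assumes "b \<le> a"
  shows "det (mat k k (\<lambda>(i, j). of_nat (shift_binom a b i j))) = d_rat a b k"
proof -
  let ?M = "mat k k (\<lambda>(i, j). of_nat (shift_binom a b i j)) :: rat mat"
  let ?R = "mat k k (\<lambda>(j, l). lagrange_factor a b k j l)"
  let ?A = "mat k k (\<lambda>(i, j). binom_toeplitz a i j)"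
  let ?L = "mat k k (\<lambda>(l, i). shifted_lagrange b k i l)"
  let ?C = "\<lambda>i. of_nat ((a + k - 1) choose i) :: rat"
  let ?D1 = "mat k k (\<lambda>(i, j). if i = j then 1 / ?C (b + i) else 0)"
  let ?D2 = "mat k k (\<lambda>(i, j). if i = j then ?C i else 0)"
  have "?M * ?R = ?A"
    unfolding mat_mult_fun by (rule cong_mat) (auto simp: shift_binom_lagrange_factor[OF assms])
  moreover have "det ?A = 1" by (subst det_mat_upper) (auto simp: binom_toeplitz_def)
  moreover have "det (?M * ?R) = det ?M * det ?R" by (rule det_mult[where n = k]; simp)
  moreover have "det ?R = (\<Prod>i<k. ?C i / ?C (b + i))"
  proof -
    have "?R = ?D1 * transpose_mat ?L * ?D2"
      by (rule eq_matI)
         (auto simp: scalar_prod_def lagrange_factor_def if_distrib[of "\<lambda>x. x * _"] if_distrib[of "\<lambda>x. _ * x"]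
            sum.delta sum.delta' cong: if_cong)
    moreover have "det (?D1 * transpose_mat ?L * ?D2) = det (?D1 * transpose_mat ?L) * det ?D2"
      by (rule det_mult[where n = k]) (auto intro!: mult_carrier_mat)
    moreover have "det (?D1 * transpose_mat ?L) = det ?D1 * det (transpose_mat ?L)"
      by (rule det_mult[where n = k]; simp)
    moreover have "det (transpose_mat ?L) = 1"
      using det_shifted_lagrange[of k b] by (subst det_transpose[where n = k]) auto
    moreover have "det ?D1 = (\<Prod>i<k. 1 / ?C (b + i))" by (subst det_mat_upper) auto
    moreover have "det ?D2 = (\<Prod>i<k. ?C i)" by (subst det_mat_upper) auto
    ultimately show ?thesis by (simp add: prod_dividef)
  qed
  moreover have "(\<Prod>i<k. ?C i / ?C (b + i)) * d_rat a b k = 1"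
    unfolding d_rat_eq[OF assms] prod.distrib[symmetric]
  proof (rule prod.neutral, rule ballI)
    fix i assume "i \<in> {..<k}"
    then have "b + i \<le> a + k - 1" "i \<le> a + k - 1" using assms by auto
    then show "?C i / ?C (b + i) * (?C (b + i) / ?C i) = 1" by simp
  qed
  ultimately have 1: "det ?M * (\<Prod>i<k. ?C i / ?C (b + i)) = 1"
    and 2: "(\<Prod>i<k. ?C i / ?C (b + i)) * d_rat a b k = 1" by simp_all
  have "det ?M = det ?M * ((\<Prod>i<k. ?C i / ?C (b + i)) * d_rat a b k)" unfolding 2 by simp
  also have "\<dots> = d_rat a b k" unfolding mult.assoc[symmetric] 1 by simp
  finally show ?thesis .
qed

lemma z_rat_eq:
  assumes "i < k" "j < k"
  shows "z_rat a b k (Suc i) (Suc j) = d_rat a b k * (\<Sum>l<k. lagrange_factor a b k i l * binom_toeplitz_inv a l j)"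
proof -
  have P: "(\<Prod>r\<in>{1..k} - {Suc i}. (of_nat (Suc l) - of_nat b - of_nat r) / (of_nat (Suc i) - of_nat r)) = shifted_lagrange b k i l" for l
    unfolding shifted_lagrange_def
    by (rule prod.reindex_bij_witness[of _ Suc "\<lambda>r. r - 1"]) (auto simp: of_nat_diff algebra_simps)
  have "(\<Sum>l=1..Suc j. (-1) ^ (l + Suc j) * of_nat ((a + k - 1) choose (l - 1)) *
       ((of_nat a + of_nat (Suc j) - of_nat l - 1) gchoose (Suc j - l)) *
       (\<Prod>r\<in>{1..k} - {Suc i}. (of_nat l - of_nat b - of_nat r) / (of_nat (Suc i) - of_nat r)) :: rat) =
     (\<Sum>l\<in>{..j}. of_nat ((a + k - 1) choose l) * binom_toeplitz_inv a l j * shifted_lagrange b k i l)"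
    unfolding P[symmetric]
  proof (rule sum.reindex_bij_witness[of _ Suc "\<lambda>l. l - 1"])
    fix l assume "l \<in> {1..Suc j}"
    then obtain t where t: "l = Suc t" "t \<le> j" by (cases l) auto
    have "of_nat a + of_nat (Suc j) - of_nat l - 1 = (of_nat a + of_nat j - of_nat t - 1 :: rat)"
      using t by simp
    then show "of_nat ((a + k - 1) choose (l - 1)) * binom_toeplitz_inv a (l - 1) j *
       (\<Prod>r\<in>{1..k} - {Suc i}. (of_nat (Suc (l - 1)) - of_nat b - of_nat r) / (of_nat (Suc i) - of_nat r)) =
      (-1) ^ (l + Suc j) * of_nat ((a + k - 1) choose (l - 1)) *
       ((of_nat a + of_nat (Suc j) - of_nat l - 1) gchoose (Suc j - l)) *
       (\<Prod>r\<in>{1..k} - {Suc i}. (of_nat l - of_nat b - of_nat r) / (of_nat (Suc i) - of_nat r) :: rat)"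
      using t by (simp add: binom_toeplitz_inv_def add_diff_eq)
  qed auto
  also have "\<dots> = (\<Sum>l<k. of_nat ((a + k - 1) choose l) * binom_toeplitz_inv a l j * shifted_lagrange b k i l)"
    using assms by (intro sum.mono_neutral_left) (auto simp: binom_toeplitz_inv_def)
  finally show ?thesis
    by (simp add: z_rat_def lagrange_factor_def sum_distrib_left sum_divide_distrib mult_ac)
qed

text \<open>
Over the rationals the inverse of \<open>shift_binom\<close> is \<open>lagrange_factor\<close> times \<open>binom_toeplitz_inv\<close>, which is
the matrix of \<open>z_rat / d_rat\<close>. The entries \<open>z_rat\<close> are integers because \<open>d_rat\<close> is the determinant of the integer
matrix \<open>shift_binom\<close>, so that they form its adjugate. The determinant formula is part of the statement because
over a field of positive characteristic the invertibility of the matrix is what makes \<open>d\<close> nonzero.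
\<close>

theorem binomial_matrix_inverse:
  assumes "b \<le> a"
  obtains d :: int and z :: "nat \<Rightarrow> nat \<Rightarrow> int"
  where "of_int d = d_rat a b k"
    and "\<And>i j. i \<in> {1..k} \<Longrightarrow> j \<in> {1..k} \<Longrightarrow> of_int (z i j) = z_rat a b k i j"
    and "d = det (mat k k (\<lambda>(i, j). int (shift_binom a b i j)))"
    and "\<And>i j. i < k \<Longrightarrow> j < k \<Longrightarrow>
      (\<Sum>l<k. int (shift_binom a b i l) * z (Suc l) (Suc j)) = (if i = j then d else 0)"
proof -
  define Mi where "Mi = mat k k (\<lambda>(i, j). int (shift_binom a b i j))"
  define d where "d = det Mi"
  define z where "z i j = adj_mat Mi $$ (i - 1, j - 1)" for i j
  let ?h = "map_mat rat_of_int"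
  have Mi: "Mi \<in> carrier_mat k k" by (simp add: Mi_def)
  note adj = adj_mat[OF Mi]
  have hM: "?h Mi = mat k k (\<lambda>(i, j). of_nat (shift_binom a b i j))"
    by (rule eq_matI) (auto simp: Mi_def)
  have d: "of_int d = d_rat a b k"
    unfolding d_def of_int_hom.hom_det[symmetric] hM by (rule det_shift_binom[OF assms])
  define Z where "Z = mat k k (\<lambda>(i, j). \<Sum>l<k. lagrange_factor a b k i l * binom_toeplitz_inv a l j)"
  have Zc: "Z \<in> carrier_mat k k" by (simp add: Z_def)
  have MZ: "?h Mi * Z = 1\<^sub>m k"
  proof -
    have R: "?h Mi * mat k k (\<lambda>(j, l). lagrange_factor a b k j l) = mat k k (\<lambda>(i, j). binom_toeplitz a i j)"
      unfolding hM mat_mult_fun by (rule cong_mat) (auto simp: shift_binom_lagrange_factor[OF assms])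
    have Z: "Z = mat k k (\<lambda>(j, l). lagrange_factor a b k j l) * mat k k (\<lambda>(i, j). binom_toeplitz_inv a i j)"
      unfolding Z_def mat_mult_fun ..
    have "?h Mi * Z = mat k k (\<lambda>(i, j). binom_toeplitz a i j) * mat k k (\<lambda>(i, j). binom_toeplitz_inv a i j)"
      unfolding Z R[symmetric] using Mi by (intro assoc_mult_mat[symmetric]) auto
    also have "\<dots> = 1\<^sub>m k"
      unfolding mat_mult_fun one_mat_def by (rule cong_mat) (auto simp: binom_toeplitz_inverse)
    finally show ?thesis .
  qed
  have "?h (adj_mat Mi) * ?h Mi = ?h (d \<cdot>\<^sub>m 1\<^sub>m k)"
    using adj Mi by (simp add: of_int_hom.mat_hom_mult[symmetric] d_def)
  also have "\<dots> = of_int d \<cdot>\<^sub>m 1\<^sub>m k" by (rule eq_matI) auto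
  finally have "?h (adj_mat Mi) * ?h Mi = of_int d \<cdot>\<^sub>m 1\<^sub>m k" .
  then have "?h (adj_mat Mi) * ?h Mi * Z = of_int d \<cdot>\<^sub>m Z"
    using Zc by (simp add: mult_smult_assoc_mat[of _ k k])
  moreover have "?h (adj_mat Mi) * ?h Mi * Z = ?h (adj_mat Mi) * (?h Mi * Z)"
    using adj Mi Zc by (intro assoc_mult_mat) auto
  ultimately have Z: "?h (adj_mat Mi) = of_int d \<cdot>\<^sub>m Z"
    using adj by (simp add: MZ)
  have "of_int (z i j) = z_rat a b k i j" if ij: "i \<in> {1..k}" "j \<in> {1..k}" for i j
  proof -
    have "of_int (z i j) = ?h (adj_mat Mi) $$ (i - 1, j - 1)"
      using ij adj by (auto simp: z_def)
    also have "\<dots> = z_rat a b k (Suc (i - 1)) (Suc (j - 1))"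
      unfolding Z using ij by (subst z_rat_eq) (auto simp: Z_def d)
    finally show ?thesis using ij by simp
  qed
  moreover have "(\<Sum>l<k. int (shift_binom a b i l) * z (Suc l) (Suc j)) = (if i = j then d else 0)"
    if ij: "i < k" "j < k" for i j
  proof -
    have "(Mi * adj_mat Mi) $$ (i, j) = (\<Sum>l<k. int (shift_binom a b i l) * z (Suc l) (Suc j))"
      using ij adj(1) by (auto simp: Mi_def z_def scalar_prod_def lessThan_atLeast0)
    then show ?thesis using ij adj by (auto simp: d_def)
  qed
  ultimately show thesis using d that d_def Mi_def by blast
qed

text \<open>
The factors are the coefficients of \<open>(1 + t)\<^sup>-\<^sup>c\<close> and \<open>(1 + t)\<^sup>c\<close>. The Vandermonde identity for generalised
binomial coefficients proves the claim over the rationals, hence over the integers, hence in every ring.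
\<close>

lemma alternating_binomial_convolution:
  assumes "c \<ge> 1"
  shows "(\<Sum>s=0..r. (-1) ^ s * of_nat ((s + c - 1) choose (c - 1)) * of_nat (c choose (r - s))) =
    (if r = 0 then 1 else 0 :: 'a::comm_ring_1)"
proof -
  have 1: "(- of_nat c) gchoose s = ((-1) ^ s * of_nat ((s + c - 1) choose (c - 1)) :: rat)" for s
  proof -
    have "(s + c - 1) choose (c - 1) = (s + c - 1) choose s"
      using assms binomial_symmetric[of s "s + c - 1"] by simp
    then show ?thesis
      using assms gbinomial_minus[of "of_nat c :: rat" s]
      by (simp add: binomial_gbinomial of_nat_diff add.commute)
  qed
  let ?S = "\<Sum>s=0..r. (-1) ^ s * int ((s + c - 1) choose (c - 1)) * int (c choose (r - s))"
  have "rat_of_int ?S = (\<Sum>s=0..r. ((- of_nat c) gchoose s) * (of_nat c gchoose (r - s)))"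
    by (simp add: 1 binomial_gbinomial)
  also have "\<dots> = (if r = 0 then 1 else 0)"
    unfolding gbinomial_Vandermonde by (simp add: gbinomial_0_left)
  also have "\<dots> = rat_of_int (if r = 0 then 1 else 0)" by simp
  finally have "?S = (if r = 0 then 1 else 0)" by (simp only: of_int_eq_iff)
  then have "of_int ?S = (of_int (if r = 0 then 1 else 0) :: 'a)" by (rule arg_cong)
  then have "of_int ?S = (if r = 0 then 1 else 0 :: 'a)" by simp
  then show ?thesis by simp
qed

text \<open>
Convolution with the coefficients of \<open>(1 + t)\<^sup>c\<close> is undone by convolution with those of \<open>(1 + t)\<^sup>-\<^sup>c\<close>.
Both run upwards, so for a sequence that vanishes above \<open>m\<close> all sums are finite and only the entries from \<open>i\<close>
on enter.
\<close>

lemma convolution_inverse: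
  fixes h :: "nat \<Rightarrow> 'a::comm_ring_1"
  assumes c: "1 \<le> c" and h: "\<And>u. m < u \<Longrightarrow> h u = 0" and i: "i \<le> m"
  shows "(\<Sum>t=i..m. (-1) ^ (t - i) * of_nat ((t - i + c - 1) choose (c - 1)) *
    (\<Sum>s\<le>c. of_nat (c choose s) * h (t + s))) = h i"
proof -
  let ?W = "\<lambda>r. (-1) ^ r * of_nat ((r + c - 1) choose (c - 1)) :: 'a"
  have inner: "(\<Sum>s\<le>c. of_nat (c choose s) * h (t + s)) =
      (\<Sum>u=i..m. if t \<le> u then of_nat (c choose (u - t)) * h u else 0)"
    if t: "t \<in> {i..m}" for t
  proof -
    have "(\<Sum>s\<le>c. of_nat (c choose s) * h (t + s)) = (\<Sum>s\<le>c + m. of_nat (c choose s) * h (t + s))"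
      by (intro sum.mono_neutral_left) (auto simp: binomial_eq_0)
    also have "\<dots> = (\<Sum>s\<le>m - t. of_nat (c choose s) * h (t + s))"
    proof (rule sum.mono_neutral_right)
      show "\<forall>s\<in>{..c + m} - {..m - t}. of_nat (c choose s) * h (t + s) = 0"
      proof
        fix s assume "s \<in> {..c + m} - {..m - t}"
        then have "m < t + s" using t by auto
        then show "of_nat (c choose s) * h (t + s) = 0" by (simp add: h)
      qed
    qed (use t in auto)
    also have "\<dots> = (\<Sum>u\<in>{t..m}. of_nat (c choose (u - t)) * h u)"
      by (rule sum.reindex_bij_witness[of _ "\<lambda>u. u - t" "\<lambda>s. t + s"]) (use t in auto)
    also have "\<dots> = (\<Sum>u=i..m. if t \<le> u then of_nat (c choose (u - t)) * h u else 0)"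
      using t by (intro sum.mono_neutral_cong_left) auto
    finally show ?thesis .
  qed
  have outer: "(\<Sum>t=i..m. ?W (t - i) * (if t \<le> u then of_nat (c choose (u - t)) * h u else 0)) =
      (if u = i then h i else 0)" if u: "u \<in> {i..m}" for u
  proof -
    have "(\<Sum>t=i..m. ?W (t - i) * (if t \<le> u then of_nat (c choose (u - t)) * h u else 0)) =
        (\<Sum>t\<in>{i..u}. ?W (t - i) * of_nat (c choose (u - t)) * h u)"
      using u by (intro sum.mono_neutral_cong_right) (auto simp: mult.assoc)
    also have "\<dots> = (\<Sum>s=0..u - i. ?W s * of_nat (c choose (u - i - s)) * h u)"
      by (rule sum.reindex_bij_witness[of _ "\<lambda>s. s + i" "\<lambda>t. t - i"]) (use u in auto)
    also have "\<dots> = (if u - i = 0 then 1 else 0) * h u"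
      unfolding sum_distrib_right[symmetric] by (subst alternating_binomial_convolution[OF c]) simp
    also have "\<dots> = (if u = i then h i else 0)" using u by auto
    finally show ?thesis .
  qed
  have "(\<Sum>t=i..m. ?W (t - i) * (\<Sum>s\<le>c. of_nat (c choose s) * h (t + s))) =
      (\<Sum>t=i..m. \<Sum>u=i..m. ?W (t - i) * (if t \<le> u then of_nat (c choose (u - t)) * h u else 0))"
    unfolding sum_distrib_left[symmetric] by (intro sum.cong refl) (simp only: inner)
  also have "\<dots> = (\<Sum>u=i..m. \<Sum>t=i..m. ?W (t - i) * (if t \<le> u then of_nat (c choose (u - t)) * h u else 0))"
    by (rule sum.swap)
  also have "\<dots> = (\<Sum>u=i..m. if u = i then h i else 0)" by (intro sum.cong refl) (rule outer)
  also have "\<dots> = h i" using i by simp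
  finally show ?thesis .
qed

section \<open>Families of vectors and strings of an operator\<close>

text \<open>
A copy of \<open>vector_space\<close> without global interpretations, to which notions can be added without interfering
with those that exist for real vector spaces.
\<close>

locale linear_space = vector_space scale
  for scale :: "'f::field \<Rightarrow> 'b::ab_group_add \<Rightarrow> 'b" (infixr \<open>*s\<close> 75)
begin

text \<open>
Independence of an indexed family. Strings of an operator are naturally indexed by pairs, and for families
injectivity need not be treated separately.
\<close>

definition fam_indep :: "'i set \<Rightarrow> ('i \<Rightarrow> 'b) \<Rightarrow> bool"
  where "fam_indep I e \<longleftrightarrow> (\<forall>c. (\<Sum>i\<in>I. c i *s e i) = 0 \<longrightarrow> (\<forall>i\<in>I. c i = 0))"

lemma fam_indepD: "fam_indep I e \<Longrightarrow> (\<Sum>i\<in>I. c i *s e i) = 0 \<Longrightarrow> i \<in> I \<Longrightarrow> c i = 0"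
  by (auto simp: fam_indep_def)

lemma fam_indep_cong: "(\<And>i. i \<in> I \<Longrightarrow> e i = e' i) \<Longrightarrow> fam_indep I e \<longleftrightarrow> fam_indep I e'"
  by (simp add: fam_indep_def cong: sum.cong)

lemma fam_indep_iff:
  assumes "finite I"
  shows "fam_indep I e \<longleftrightarrow> inj_on e I \<and> independent (e ` I)"
proof
  assume L: "fam_indep I e"
  have inj: "inj_on e I"
  proof (rule inj_onI, rule ccontr)
    fix i j assume ij: "i \<in> I" "j \<in> I" "e i = e j" "i \<noteq> j"
    let ?c = "\<lambda>x. (if x = i then 1 else 0) - (if x = j then 1 else 0)"
    have "?c x *s e x = (if x = i then e i else 0) - (if x = j then e j else 0)" for x
      by (auto simp: scale_left_diff_distrib)
    then have "(\<Sum>x\<in>I. ?c x *s e x) = e i - e j"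
      using ij assms by (simp add: sum_subtractf)
    then have "(\<Sum>x\<in>I. ?c x *s e x) = 0"
      using ij by simp
    from fam_indepD[OF L this ij(1)] ij(4) show False by simp
  qed
  have "independent (e ` I)"
  proof (rule independent_if_scalars_zero)
    fix f x assume "(\<Sum>x\<in>e ` I. f x *s x) = 0" "x \<in> e ` I"
    moreover have "(\<Sum>x\<in>e ` I. f x *s x) = (\<Sum>i\<in>I. f (e i) *s e i)"
      by (rule sum.reindex[OF inj, unfolded o_def])
    ultimately show "f x = 0" using fam_indepD[OF L, of "\<lambda>i. f (e i)"] by auto
  qed (use assms in simp)
  with inj show "inj_on e I \<and> independent (e ` I)" by simp
next
  assume R: "inj_on e I \<and> independent (e ` I)"
  show "fam_indep I e"
    unfolding fam_indep_def
  proof (intro allI impI ballI, rule ccontr)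
    fix c i assume c: "(\<Sum>i\<in>I. c i *s e i) = 0" "i \<in> I" "c i \<noteq> 0"
    let ?f = "\<lambda>x. c (the_inv_into I e x)"
    have "(\<Sum>x\<in>e ` I. ?f x *s x) = (\<Sum>i\<in>I. c i *s e i)"
      using R by (subst sum.reindex) (auto simp: the_inv_into_f_f intro: sum.cong)
    moreover have "?f (e i) \<noteq> 0" using R c by (simp add: the_inv_into_f_f)
    ultimately have "dependent (e ` I)"
      unfolding dependent_finite[OF finite_imageI[OF assms]]
      using c by (intro exI[of _ ?f]) auto
    with R show False by simp
  qed
qed

lemma fam_indep_subset:
  assumes "finite I" "J \<subseteq> I" "fam_indep I e"
  shows "fam_indep J e"
proof -
  have "finite J" using assms finite_subset by blast
  moreover have "inj_on e J" "independent (e ` J)"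
    using assms fam_indep_iff[OF assms(1), of e] inj_on_subset independent_mono[OF _ image_mono]
    by blast+
  ultimately show ?thesis using fam_indep_iff by blast
qed

lemma fam_indep_reindex:
  assumes "inj_on h K" "fam_indep (h ` K) e"
  shows "fam_indep K (\<lambda>k. e (h k))"
  unfolding fam_indep_def
proof (intro allI impI ballI)
  fix c k assume c: "(\<Sum>i\<in>K. c i *s e (h i)) = 0" "k \<in> K"
  have "(\<Sum>x\<in>h ` K. c (the_inv_into K h x) *s e x) = (\<Sum>i\<in>K. c i *s e (h i))"
    using assms by (subst sum.reindex) (auto simp: the_inv_into_f_f intro: sum.cong)
  from fam_indepD[OF assms(2) trans[OF this c(1)], of "h k"] show "c k = 0"
    using assms c by (simp add: the_inv_into_f_f)
qed

lemma fam_spanI: "(\<And>i. i \<in> I \<Longrightarrow> e i \<in> span S) \<Longrightarrow> (\<Sum>i\<in>I. c i *s e i) \<in> span S"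
  by (intro span_sum span_scale)

lemma fam_spanE:
  assumes "finite I" "x \<in> span (e ` I)"
  obtains c where "x = (\<Sum>i\<in>I. c i *s e i)"
proof -
  from assms(2) have "\<exists>c. x = (\<Sum>i\<in>I. c i *s e i)"
  proof (induction rule: span_induct_alt)
    case base
    show ?case by (intro exI[of _ "\<lambda>_. 0"]) simp
  next
    case (step d z x)
    then obtain c i where c: "x = (\<Sum>i\<in>I. c i *s e i)" "i \<in> I" "z = e i" by auto
    have "(\<Sum>j\<in>I. (if j = i then d else 0) *s e j) = d *s e i"
      using assms(1) c by (simp add: if_distrib[of "\<lambda>x. x *s _"] cong: if_cong)
    then have "d *s z + x = (\<Sum>j\<in>I. ((if j = i then d else 0) + c j) *s e j)"
      using c by (simp add: scale_left_distrib sum.distrib)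
    then show ?case by (intro exI[of _ "\<lambda>j. (if j = i then d else 0) + c j"])
  qed
  with that show thesis by blast
qed

lemma fam_card_le:
  assumes "finite I" "finite J" "fam_indep I e" "\<And>i. i \<in> I \<Longrightarrow> e i \<in> span (f ` J)"
  shows "card I \<le> card J"
proof -
  have "inj_on e I" "independent (e ` I)" using assms fam_indep_iff by auto
  then have "card (e ` I) \<le> card (f ` J)"
    using independent_span_bound[of "f ` J" "e ` I"] assms by auto
  then show ?thesis
    using card_image[OF \<open>inj_on e I\<close>] card_image_le[OF assms(2), of f] by simp
qed

text \<open>
An independent family that is at least as large as a spanning set spans the same space.
\<close>

lemma fam_span_eq:
  assumes "finite I" "finite J" "fam_indep I e" "\<And>i. i \<in> I \<Longrightarrow> e i \<in> span (f ` J)"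
    and "card J \<le> card I"
  shows "span (e ` I) = span (f ` J)"
proof
  show "span (e ` I) \<subseteq> span (f ` J)"
    using assms(4) by (intro span_minimal) auto
  show "span (f ` J) \<subseteq> span (e ` I)"
  proof (rule subsetI, rule ccontr)
    fix x assume x: "x \<in> span (f ` J)" "x \<notin> span (e ` I)"
    have e: "inj_on e I" "independent (e ` I)" using assms fam_indep_iff by auto
    have "x \<notin> e ` I" using x span_superset by blast
    then have "card (insert x (e ` I)) = Suc (card I)"
      using assms card_image[OF e(1)] by simp
    moreover have "card (insert x (e ` I)) \<le> card (f ` J)"
      using independent_span_bound[of "f ` J" "insert x (e ` I)"] assms x
        independent_insertI[OF x(2) e(2)] by auto
    ultimately show False
      using card_image_le[OF assms(2), of f] assms(5) by simp
  qed
qed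

text \<open>
Linearity on an invariant subspace: the action of a module is unconstrained outside its space.
\<close>

definition lin_on :: "'b set \<Rightarrow> ('b \<Rightarrow> 'b) \<Rightarrow> bool"
  where "lin_on W N \<longleftrightarrow> subspace W \<and> (\<forall>x\<in>W. N x \<in> W \<and> (\<forall>c. N (c *s x) = c *s N x)) \<and>
    (\<forall>x\<in>W. \<forall>y\<in>W. N (x + y) = N x + N y)"

lemma lin_on_closed: "lin_on W N \<Longrightarrow> x \<in> W \<Longrightarrow> N x \<in> W"
  by (simp add: lin_on_def)

lemma lin_on_zero: "lin_on W N \<Longrightarrow> N 0 = 0"
  unfolding lin_on_def using subspace_0[of W] by (metis scale_zero_left)

lemma lin_on_sum:
  assumes "lin_on W N" "\<And>i. i \<in> I \<Longrightarrow> e i \<in> W"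
  shows "N (\<Sum>i\<in>I. c i *s e i) = (\<Sum>i\<in>I. c i *s N (e i))"
proof (cases "finite I")
  case True
  then show ?thesis using assms(2)
  proof (induction I)
    case empty
    show ?case using lin_on_zero[OF assms(1)] by simp
  next
    case (insert i I)
    have W: "subspace W" using assms(1) by (simp add: lin_on_def)
    have "(\<Sum>i\<in>I. c i *s e i) \<in> W" "c i *s e i \<in> W"
      using insert by (auto intro!: subspace_sum[OF W] subspace_scale[OF W])
    then show ?case
      using insert assms(1) by (simp add: lin_on_def)
  qed
qed (use lin_on_zero[OF assms(1)] in simp)

lemma lin_on_funpow: "lin_on W N \<Longrightarrow> lin_on W (N ^^ r)"
  by (induction r) (auto simp: lin_on_def)

lemma funpow_ge_zero:
  assumes "lin_on W N" "(N ^^ l) y = 0" "l \<le> j"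
  shows "(N ^^ j) y = 0"
proof -
  have "(N ^^ (j - l)) ((N ^^ l) y) = 0"
    using assms lin_on_zero[OF lin_on_funpow[OF assms(1)]] by simp
  then show ?thesis using assms(3) by (metis funpow_add le_add_diff_inverse2 o_apply)
qed

text \<open>
Applying a power of \<open>N\<close> to a combination of string vectors shifts the coefficients, and those pushed
beyond the end of the string disappear.
\<close>

lemma string_shift:
  assumes "lin_on W N" "(N ^^ l) y = 0"
  shows "(\<Sum>j<l. c j *s (N ^^ (s + j)) y) = (\<Sum>j<l. (if s \<le> j then c (j - s) else 0) *s (N ^^ j) y)"
proof -
  have "(\<Sum>j<l. c j *s (N ^^ (s + j)) y) = (\<Sum>j\<in>{..<l - s}. c j *s (N ^^ (s + j)) y)"
    using funpow_ge_zero[OF assms] by (intro sum.mono_neutral_right) auto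
  also have "\<dots> = (\<Sum>j\<in>{s..<l}. c (j - s) *s (N ^^ j) y)"
    by (rule sum.reindex_bij_witness[of _ "\<lambda>j. j - s" "\<lambda>j. j + s"]) (auto simp: add.commute)
  also have "\<dots> = (\<Sum>j<l. (if s \<le> j then c (j - s) else 0) *s (N ^^ j) y)"
    by (intro sum.mono_neutral_cong_left) auto
  finally show ?thesis .
qed

abbreviation strings :: "'i set \<Rightarrow> ('i \<Rightarrow> nat) \<Rightarrow> ('i \<times> nat) set"
  where "strings I l \<equiv> SIGMA i:I. {..<l i}"

text \<open>
In a nontrivial relation take a term that is farthest from the end of its string, at distance \<open>r\<close>.
Then \<open>N\<^sup>r\<close> kills the terms closer to the end of their strings and leaves a nontrivial relation between the last vectors.
\<close>

lemma strings_indep: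
  assumes N: "lin_on W N" and I: "finite I"
    and y: "\<And>i. i \<in> I \<Longrightarrow> y i \<in> W" "\<And>i. i \<in> I \<Longrightarrow> 0 < l i"
    and zero: "\<And>i. i \<in> I \<Longrightarrow> (N ^^ l i) (y i) = 0"
    and ind: "fam_indep I (\<lambda>i. (N ^^ (l i - 1)) (y i))"
  shows "fam_indep (strings I l) (\<lambda>(i, j). (N ^^ j) (y i))"
  unfolding fam_indep_def
proof (intro allI impI, rule ccontr)
  fix c assume c0: "(\<Sum>x\<in>strings I l. c x *s (case x of (i, j) \<Rightarrow> (N ^^ j) (y i))) = 0"
    and "\<not> (\<forall>x\<in>strings I l. c x = 0)"
  let ?S = "{x \<in> strings I l. c x \<noteq> 0}"
  \<comment> \<open>the distance of a vector from the end of its string\<close>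
  let ?d = "\<lambda>(i, j). l i - 1 - j"
  have fin: "finite ?S" using I by auto
  have ne: "?S \<noteq> {}" using \<open>\<not> _\<close> by auto
  define r where "r = Max (?d ` ?S)"
  have "r \<in> ?d ` ?S" unfolding r_def using fin ne by (intro Max_in) auto
  then obtain i0 j0 where i0: "i0 \<in> I" "j0 < l i0" "c (i0, j0) \<noteq> 0" "r = l i0 - 1 - j0" by auto
  have max: "l i - 1 - j \<le> r" if "i \<in> I" "j < l i" "c (i, j) \<noteq> 0" for i j
    unfolding r_def using fin that by (intro Max_ge) force+
  have "0 = (N ^^ r) (\<Sum>x\<in>strings I l. c x *s (case x of (i, j) \<Rightarrow> (N ^^ j) (y i)))"
    unfolding c0 using lin_on_zero[OF lin_on_funpow[OF N]] by simp
  also have "\<dots> = (\<Sum>x\<in>strings I l. c x *s (N ^^ r) (case x of (i, j) \<Rightarrow> (N ^^ j) (y i)))"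
    by (rule lin_on_sum[OF lin_on_funpow[OF N]])
       (use y lin_on_closed[OF lin_on_funpow[OF N]] in auto)
  also have "\<dots> = (\<Sum>x\<in>strings I l. case x of (i, j) \<Rightarrow> c (i, j) *s (N ^^ (r + j)) (y i))"
    by (rule sum.cong) (auto simp: funpow_add)
  also have "\<dots> = (\<Sum>i\<in>I. \<Sum>j<l i. c (i, j) *s (N ^^ (r + j)) (y i))"
    using I by (subst sum.Sigma) auto
  also have "\<dots> = (\<Sum>i\<in>I. (if r \<le> l i - 1 then c (i, l i - 1 - r) else 0) *s (N ^^ (l i - 1)) (y i))"
  proof (rule sum.cong[OF refl])
    fix i assume i: "i \<in> I"
    have "(\<Sum>j<l i. c (i, j) *s (N ^^ (r + j)) (y i)) =
        (\<Sum>j<l i. (if r \<le> j then c (i, j - r) else 0) *s (N ^^ j) (y i))"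
      by (rule string_shift[OF N zero[OF i]])
    also have "\<dots> = (\<Sum>j\<in>{l i - 1}. (if r \<le> j then c (i, j - r) else 0) *s (N ^^ j) (y i))"
    proof (rule sum.mono_neutral_right)
      show "\<forall>j\<in>{..<l i} - {l i - 1}. (if r \<le> j then c (i, j - r) else 0) *s (N ^^ j) (y i) = 0"
      proof
        fix j assume j: "j \<in> {..<l i} - {l i - 1}"
        then show "(if r \<le> j then c (i, j - r) else 0) *s (N ^^ j) (y i) = 0"
        proof (cases "r \<le> j \<and> c (i, j - r) \<noteq> 0")
          case True
          then have "l i - 1 - (j - r) \<le> r" using j by (intro max[OF i]) auto
          then show ?thesis using True j by auto
        qed auto
      qed
    qed (use y(2)[OF i] in auto)
    finally show "(\<Sum>j<l i. c (i, j) *s (N ^^ (r + j)) (y i)) =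
      (if r \<le> l i - 1 then c (i, l i - 1 - r) else 0) *s (N ^^ (l i - 1)) (y i)" by simp
  qed
  finally have "(if r \<le> l i0 - 1 then c (i0, l i0 - 1 - r) else 0) = 0"
    using fam_indepD[OF ind _ i0(1), of "\<lambda>i. if r \<le> l i - 1 then c (i, l i - 1 - r) else 0"] by simp
  moreover have "l i0 - 1 - r = j0" "r \<le> l i0 - 1" using i0 by auto
  ultimately show False using i0(3) by simp
qed

definition jordan_basis :: "'b set \<Rightarrow> ('b \<Rightarrow> 'b) \<Rightarrow> 'i set \<Rightarrow> ('i \<Rightarrow> nat) \<Rightarrow> ('i \<Rightarrow> 'b) \<Rightarrow> bool"
  where "jordan_basis W N I l y \<longleftrightarrow>
    (\<forall>i\<in>I. y i \<in> W \<and> 0 < l i \<and> (N ^^ l i) (y i) = 0) \<and>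
    fam_indep (strings I l) (\<lambda>(i, j). (N ^^ j) (y i)) \<and>
    span ((\<lambda>(i, j). (N ^^ j) (y i)) ` strings I l) = W"

text \<open>
In a basis of strings, a vector killed by \<open>N\<close> only involves last vectors of strings, and a vector in the image of
\<open>N\<^sup>r\<close> only involves vectors with at least \<open>r\<close> predecessors in their string.
\<close>

lemma jordan_basis_socle:
  assumes N: "lin_on W N" and I: "finite I" and J: "jordan_basis W N I l y"
    and z: "w \<in> W" "z = (N ^^ r) w" "N z = 0"
  shows "z \<in> span ((\<lambda>i. (N ^^ (l i - 1)) (y i)) ` {i \<in> I. r < l i})"
proof -
  have y: "y i \<in> W" "0 < l i" "(N ^^ l i) (y i) = 0" if "i \<in> I" for i
    using J that by (auto simp: jordan_basis_def)
  have "w \<in> span ((\<lambda>(i, j). (N ^^ j) (y i)) ` strings I l)"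
    using J z by (simp add: jordan_basis_def)
  then obtain c where c: "w = (\<Sum>x\<in>strings I l. c x *s (case x of (i, j) \<Rightarrow> (N ^^ j) (y i)))"
    using I by (elim fam_spanE[rotated]) auto
  have pow: "(N ^^ s) w = (\<Sum>i\<in>I. \<Sum>j<l i. (if s \<le> j then c (i, j - s) else 0) *s (N ^^ j) (y i))" for s
  proof -
    have "(N ^^ s) w = (\<Sum>x\<in>strings I l. c x *s (N ^^ s) (case x of (i, j) \<Rightarrow> (N ^^ j) (y i)))"
      unfolding c by (rule lin_on_sum[OF lin_on_funpow[OF N]])
        (use y lin_on_closed[OF lin_on_funpow[OF N]] in auto)
    also have "\<dots> = (\<Sum>x\<in>strings I l. case x of (i, j) \<Rightarrow> c (i, j) *s (N ^^ (s + j)) (y i))"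
      by (rule sum.cong) (auto simp: funpow_add)
    also have "\<dots> = (\<Sum>i\<in>I. \<Sum>j<l i. c (i, j) *s (N ^^ (s + j)) (y i))"
      using I by (subst sum.Sigma) auto
    also have "\<dots> = (\<Sum>i\<in>I. \<Sum>j<l i. (if s \<le> j then c (i, j - s) else 0) *s (N ^^ j) (y i))"
      by (rule sum.cong[OF refl], rule string_shift[OF N]) (use y in auto)
    finally show ?thesis .
  qed
  have "0 = (N ^^ Suc r) w" using z by simp
  also have "\<dots> = (\<Sum>x\<in>strings I l. (case x of (i, j) \<Rightarrow> if Suc r \<le> j then c (i, j - Suc r) else 0) *s
      (case x of (i, j) \<Rightarrow> (N ^^ j) (y i)))"
    unfolding pow using I by (subst sum.Sigma) (auto intro!: sum.cong)
  finally have c0: "(case x of (i, j) \<Rightarrow> if Suc r \<le> j then c (i, j - Suc r) else 0) = 0"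
    if "x \<in> strings I l" for x
    using J that fam_indepD[of "strings I l" "\<lambda>(i, j). (N ^^ j) (y i)"
        "\<lambda>x. case x of (i, j) \<Rightarrow> if Suc r \<le> j then c (i, j - Suc r) else 0"]
    by (simp add: jordan_basis_def)
  have "(if r \<le> j then c (i, j - r) else 0) *s (N ^^ j) (y i) \<in>
      span ((\<lambda>i. (N ^^ (l i - 1)) (y i)) ` {i \<in> I. r < l i})"
    if ij: "i \<in> I" "j < l i" for i j
  proof (cases "r \<le> j \<and> c (i, j - r) \<noteq> 0")
    case True
    then have "\<not> Suc j < l i"
      using c0[of "(i, Suc j)"] ij by auto
    then have "j = l i - 1" "r < l i" using True ij by auto
    then show ?thesis using ij by (intro span_scale span_base) auto
  qed (auto simp: span_zero)
  then show ?thesis unfolding z(2) pow by (intro span_sum) auto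
qed

text \<open>
Choose \<open>z\<close> with a string of maximal length \<open>l\<close> and a linear form \<open>\<phi>\<close> with value 1 on its last vector. The
vectors on which \<open>\<phi>\<close> and its first \<open>l - 1\<close> compositions with \<open>N\<close> vanish form an invariant complement of the string,
since the pairing of the string vectors with these \<open>l\<close> forms is triangular.
\<close>

lemma nilpotent_cyclic_summand:
  assumes N: "lin_on W N" and q: "\<And>x. x \<in> W \<Longrightarrow> (N ^^ q) x = 0" and W: "W \<noteq> {0}"
  obtains z l B where "z \<in> W" "0 < l" "(N ^^ l) z = 0" "fam_indep {..<l} (\<lambda>j. (N ^^ j) z)"
    "subspace B" "B \<subseteq> W" "\<And>x. x \<in> B \<Longrightarrow> N x \<in> B"
    "span ((\<lambda>j. (N ^^ j) z) ` {..<l}) \<inter> B = {0}"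
    "W = {a + b |a b. a \<in> span ((\<lambda>j. (N ^^ j) z) ` {..<l}) \<and> b \<in> B}"
proof -
  have sub: "subspace W" using N by (simp add: lin_on_def)
  define l where "l = (LEAST l. \<forall>x\<in>W. (N ^^ l) x = 0)"
  have l0: "\<forall>x\<in>W. (N ^^ l) x = 0" unfolding l_def by (rule LeastI[of _ q]) (use q in auto)
  have l1: "l > 0"
  proof (rule ccontr)
    assume "\<not> l > 0"
    then have "\<forall>x\<in>W. x = 0" using l0 by simp
    then show False using W subspace_0[OF sub] by auto
  qed
  have "\<not> (\<forall>x\<in>W. (N ^^ (l - 1)) x = 0)"
    unfolding l_def by (rule not_less_Least) (use l1 in \<open>simp add: l_def\<close>)
  then obtain z where z: "z \<in> W" "(N ^^ (l - 1)) z \<noteq> 0" by blast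
  let ?t = "(N ^^ (l - 1)) z"
  note NW = lin_on_closed[OF lin_on_funpow[OF N]]
  have t: "independent {?t}" using z by simp
  define \<phi> where "\<phi> x = representation (extend_basis {?t}) x ?t" for x
  note ext = extend_basis_superset[OF t] independent_extend_basis[OF t] span_extend_basis[OF t]
  have \<phi>: "\<phi> (x + y) = \<phi> x + \<phi> y" "\<phi> (c *s x) = c * \<phi> x" "\<phi> ?t = 1" "\<phi> 0 = 0" for x y c
    using ext by (auto simp: \<phi>_def representation_add representation_scale representation_basis
        representation_zero)
  have \<phi>_sum: "\<phi> (\<Sum>i\<in>I. c i *s e i) = (\<Sum>i\<in>I. c i * \<phi> (e i))" if "finite I" for I c and e :: "nat \<Rightarrow> 'b"
    using that by (induction I) (auto simp: \<phi>)
  define A where "A = span ((\<lambda>j. (N ^^ j) z) ` {..<l})"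
  define B where "B = {x \<in> W. \<forall>j<l. \<phi> ((N ^^ j) x) = 0}"
  have AW: "A \<subseteq> W" unfolding A_def using NW[OF z(1)] by (intro span_minimal sub) auto
  have zz: "(N ^^ j) z = 0" if "l \<le> j" for j
    using funpow_ge_zero[OF N _ that] l0 z by blast
  have lin: "(N ^^ j) (x + y) = (N ^^ j) x + (N ^^ j) y" "(N ^^ j) (c *s x) = c *s (N ^^ j) x"
    if "x \<in> W" "y \<in> W" for j x y c
    using lin_on_funpow[OF N, of j] that by (auto simp: lin_on_def)
  have Bsub: "subspace B"
    using sub lin lin_on_zero[OF lin_on_funpow[OF N]]
    by (auto simp: subspace_def B_def \<phi>)
  have BN: "N x \<in> B" if "x \<in> B" for x
  proof -
    have "\<phi> ((N ^^ j) (N x)) = 0" if "j < l" for j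
    proof (cases "Suc j < l")
      case True
      then have "\<phi> ((N ^^ Suc j) x) = 0" using \<open>x \<in> B\<close> by (simp add: B_def del: funpow.simps)
      then show ?thesis by (simp add: funpow_swap1)
    next
      case False
      then have "(N ^^ Suc j) x = 0"
        using funpow_ge_zero[OF N, of l x "Suc j"] l0 \<open>x \<in> B\<close> by (auto simp: B_def)
      then show ?thesis by (simp add: funpow_swap1 \<phi>)
    qed
    then show ?thesis using lin_on_closed[OF N] \<open>x \<in> B\<close> by (auto simp: B_def)
  qed
  have AB: "x = 0" if xc: "x = (\<Sum>j<l. c j *s (N ^^ j) z)" and xB: "x \<in> B" for x c
  proof -
    have "c j = 0" if "j < l" for j
      using that
    proof (induction j rule: less_induct)
      case (less j)
      have "0 = \<phi> ((N ^^ (l - 1 - j)) x)" using less xB by (simp add: B_def)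
      also have "(N ^^ (l - 1 - j)) x = (\<Sum>i<l. c i *s (N ^^ (l - 1 - j)) ((N ^^ i) z))"
        unfolding xc by (rule lin_on_sum[OF lin_on_funpow[OF N]]) (use NW z in auto)
      also have "\<phi> \<dots> = (\<Sum>i<l. c i * \<phi> ((N ^^ (l - 1 - j + i)) z))"
        by (subst \<phi>_sum) (auto simp: funpow_add)
      also have "\<dots> = (\<Sum>i<l. if i = j then c j else 0)"
      proof (rule sum.cong[OF refl])
        fix i assume "i \<in> {..<l}"
        consider "i < j" | "i = j" | "i > j" by linarith
        then show "c i * \<phi> ((N ^^ (l - 1 - j + i)) z) = (if i = j then c j else 0)"
          using less zz[of "l - 1 - j + i"] \<phi>(3,4) by cases auto
      qed
      also have "\<dots> = c j" using less by simp
      finally show ?case by simp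
    qed
    then show "x = 0" using xc by simp
  qed
  have ind: "fam_indep {..<l} (\<lambda>j. (N ^^ j) z)"
  proof -
    have "fam_indep (strings {0::nat} (\<lambda>_. l)) (\<lambda>(i, j). (N ^^ j) ((\<lambda>_. z) i))"
    proof (rule strings_indep[OF N])
      show "fam_indep {0::nat} (\<lambda>i. (N ^^ (l - 1)) z)" using z by (simp add: fam_indep_def)
    qed (use z l0 l1 in auto)
    then have "fam_indep (Pair 0 ` {..<l}) (\<lambda>(i::nat, j). (N ^^ j) z)"
      by (rule back_subst[of "\<lambda>S. fam_indep S _"]) auto
    from fam_indep_reindex[OF _ this] show ?thesis by (simp add: inj_on_def)
  qed
  \<comment> \<open>Subtract multiples of \<open>z, N z, ...\<close> in turn, making the forms vanish from the last one on.\<close>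
  have "\<exists>a\<in>A. \<forall>j<l. l - s \<le> j \<longrightarrow> \<phi> ((N ^^ j) (x - a)) = 0" if x: "x \<in> W" "s \<le> l" for x s
    using that(2)
  proof (induction s)
    case 0
    show ?case by (intro bexI[of _ 0]) (auto simp: A_def span_zero)
  next
    case (Suc s)
    then obtain a where a: "a \<in> A" "\<forall>j<l. l - s \<le> j \<longrightarrow> \<phi> ((N ^^ j) (x - a)) = 0" by auto
    define d where "d = \<phi> ((N ^^ (l - Suc s)) (x - a))"
    have zA: "(N ^^ s) z \<in> A" unfolding A_def using Suc by (intro span_base) auto
    have aW: "x - a \<in> W" using a AW x by (intro subspace_diff[OF sub]) auto
    show ?case
    proof (intro bexI[of _ "a + d *s (N ^^ s) z"] allI impI)
      fix j assume j: "j < l" "l - Suc s \<le> j"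
      have "x - (a + d *s (N ^^ s) z) = (x - a) + (- d) *s (N ^^ s) z" by (simp add: scale_minus_left)
      also have "(N ^^ j) \<dots> = (N ^^ j) (x - a) + (- d) *s (N ^^ (j + s)) z"
        unfolding lin(1)[OF aW subspace_scale[OF sub NW[OF z(1)]]] lin(2)[OF NW[OF z(1)] z(1)]
        by (simp add: funpow_add)
      finally have e': "(N ^^ j) (x - (a + d *s (N ^^ s) z)) =
          (N ^^ j) (x - a) + (- d) *s (N ^^ (j + s)) z" .
      have e: "\<phi> ((N ^^ j) (x - (a + d *s (N ^^ s) z))) =
          \<phi> ((N ^^ j) (x - a)) - d * \<phi> ((N ^^ (j + s)) z)"
        unfolding e'
        unfolding \<phi>(1,2) by simp
      show "\<phi> ((N ^^ j) (x - (a + d *s (N ^^ s) z))) = 0"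
      proof (cases "j = l - Suc s")
        case True
        then have "j + s = l - 1" using Suc by simp
        then show ?thesis unfolding e using True \<phi>(3) by (simp add: d_def)
      next
        case False
        then have "l \<le> j + s" "l - s \<le> j" using j Suc by auto
        then show ?thesis unfolding e using a j zz \<phi>(4) by simp
      qed
    qed (use a zA in \<open>auto simp: A_def intro: span_add span_scale\<close>)
  qed
  from this[of _ l] have dec: "\<exists>a\<in>A. \<forall>j<l. \<phi> ((N ^^ j) (x - a)) = 0" if "x \<in> W" for x
    using that by auto
  have cap: "A \<inter> B = {0}"
  proof -
    have "x = 0" if x: "x \<in> A" "x \<in> B" for x
    proof -
      obtain c where "x = (\<Sum>j<l. c j *s (N ^^ j) z)"
        using x(1) unfolding A_def by (elim fam_spanE[rotated]) auto
      then show ?thesis using AB x by blast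
    qed
    moreover have "0 \<in> A" by (simp add: A_def span_zero)
    moreover have "0 \<in> B" by (rule subspace_0[OF Bsub])
    ultimately show ?thesis by blast
  qed
  have cup: "W = {a + b |a b. a \<in> A \<and> b \<in> B}"
  proof (intro equalityI subsetI)
    fix x assume x: "x \<in> W"
    then obtain a where a: "a \<in> A" "\<forall>j<l. \<phi> ((N ^^ j) (x - a)) = 0" using dec by blast
    then have "x - a \<in> B" using AW x subspace_diff[OF sub] by (auto simp: B_def)
    then show "x \<in> {a + b |a b. a \<in> A \<and> b \<in> B}" using a by (intro CollectI exI[of _ a] exI[of _ "x - a"]) auto
  next
    fix x assume "x \<in> {a + b |a b. a \<in> A \<and> b \<in> B}"
    then show "x \<in> W" using AW subspace_add[OF sub] by (auto simp: B_def)
  qed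
  have BW: "B \<subseteq> W" by (auto simp: B_def)
  have lz: "(N ^^ l) z = 0" using l0 z(1) by blast
  show thesis
    by (rule that[of z l B, OF z(1) l1 lz ind Bsub BW BN cap[unfolded A_def] cup[unfolded A_def]])
qed

text \<open>
Pascal's rule in the form used to expand the powers of a sum of two commuting operators.
\<close>

lemma pascal_sum:
  "(\<Sum>s\<le>Suc r. of_nat (Suc r choose s) *s F s) =
    (\<Sum>s\<le>r. of_nat (r choose s) *s F s) + (\<Sum>s\<le>r. of_nat (r choose s) *s F (Suc s))"
proof -
  have "(\<Sum>s\<le>Suc r. of_nat (Suc r choose s) *s F s) =
      (F 0 + (\<Sum>s\<le>r. of_nat (r choose Suc s) *s F (Suc s))) + (\<Sum>s\<le>r. of_nat (r choose s) *s F (Suc s))"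
    by (simp only: sum.atMost_Suc_shift binomial_Suc_Suc of_nat_add scale_left_distrib sum.distrib
        binomial_n_0 of_nat_1 scale_one add_ac)
  also have "F 0 + (\<Sum>s\<le>r. of_nat (r choose Suc s) *s F (Suc s)) = (\<Sum>s\<le>Suc r. of_nat (r choose s) *s F s)"
    unfolding sum.atMost_Suc_shift[of _ r] by simp
  also have "\<dots> = (\<Sum>s\<le>r. of_nat (r choose s) *s F s)" by (simp add: binomial_eq_0)
  finally show ?thesis .
qed

end

section \<open>Modules for a cyclic group\<close>

text \<open>
Compare coefficients in \<open>(1 + X)\<^sup>q = 1 + X\<^sup>q\<close>.
\<close>

lemma binomial_prime_power_CHAR:
  assumes "prime CHAR('f::field)" "q = CHAR('f) ^ e" "0 < j" "j < q"
  shows "(of_nat (q choose j) :: 'f) = 0"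
proof -
  have 1: "[:1, 1:] = (1 :: 'f poly) + Polynomial.monom 1 1" by (simp add: Polynomial.monom_altdef one_pCons)
  have "[:1, 1:] ^ q = (1 + Polynomial.monom 1 q :: 'f poly)"
    unfolding 1 by (subst freshmans_dream'[of q e]) (use assms in \<open>simp_all add: Polynomial.monom_power\<close>)
  then have "Polynomial.coeff ([:1, 1:] ^ q :: 'f poly) j = 0" using assms by simp
  then show ?thesis using assms(4) by (simp add: coeff_linear_poly_power)
qed

text \<open>
The action of \<open>g - 1\<close>. For a generator \<open>g\<close> of a cyclic group it determines the module, and it is nilpotent in the
situation of the theorem.
\<close>

abbreviation aug :: "('g, 'v::ab_group_add) gmod \<Rightarrow> 'g \<Rightarrow> 'v \<Rightarrow> 'v"
  where "aug M g \<equiv> \<lambda>z. gact M g z - z"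

locale cyclic_group = group G for G :: "('g, 'h) monoid_scheme" (structure) +
  fixes g :: 'g
  assumes g: "g \<in> carrier G" and fin: "finite (carrier G)" and gen: "carrier G = generate G {g}"
begin

lemma carrier_pow:
  assumes "x \<in> carrier G"
  obtains k :: nat where "x = g [^] k"
  using assms gen generate_pow_on_finite_carrier[OF fin g] by blast

end

locale cyclic_module = cyclic_group G g + linear_space s
  for G :: "('g, 'h) monoid_scheme" (structure) and g :: 'g
    and s :: "'f::field \<Rightarrow> 'v::ab_group_add \<Rightarrow> 'v" +
  fixes M :: "('g, 'v) gmod"
  assumes fg: "fg_module G s M"
begin

abbreviation N :: "'v \<Rightarrow> 'v" where "N \<equiv> aug M g"

lemmas module_rules =
  fg_module.vspace_subspace[OF fg] fg_module.gact_closed[OF fg] fg_module.gact_add[OF fg]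
  fg_module.gact_scale[OF fg] fg_module.gact_one[OF fg] fg_module.gact_mult[OF fg]

lemma N_lin: "lin_on (vspace M) N"
  unfolding lin_on_def
  using g by (auto simp: module_rules scale_right_diff_distrib intro!: subspace_diff)

lemma gact_pow_Suc: "z \<in> vspace M \<Longrightarrow> gact M (g [^] Suc k) z = gact M (g [^] (k::nat)) (gact M g z)"
  using g by (simp add: module_rules)

lemma gact_pow_invariant:
  assumes "subspace A" "A \<subseteq> vspace M" "\<And>z. z \<in> A \<Longrightarrow> N z \<in> A" "z \<in> A"
  shows "gact M (g [^] (k::nat)) z \<in> A"
  using assms(4)
proof (induction k arbitrary: z)
  case 0
  then show ?case using assms(2) by (auto simp: module_rules)
next
  case (Suc k)
  have "gact M g z = N z + z" by simp
  also have "\<dots> \<in> A" using Suc.prems assms(3) by (intro subspace_add[OF assms(1)])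
  finally show ?case using Suc assms(2) by (subst gact_pow_Suc) auto
qed

lemma submodule_iff_invariant:
  "fg_submodule G s A M \<longleftrightarrow> subspace A \<and> A \<subseteq> vspace M \<and> (\<forall>z\<in>A. N z \<in> A)"
proof
  assume "fg_submodule G s A M"
  then show "subspace A \<and> A \<subseteq> vspace M \<and> (\<forall>z\<in>A. N z \<in> A)"
    unfolding fg_submodule_def using g by (auto intro: subspace_diff)
next
  assume R: "subspace A \<and> A \<subseteq> vspace M \<and> (\<forall>z\<in>A. N z \<in> A)"
  then show "fg_submodule G s A M"
    unfolding fg_submodule_def using gact_pow_invariant[of A] carrier_pow by metis
qed

lemma gact_pow_binomial:
  "z \<in> vspace M \<Longrightarrow> gact M (g [^] (k::nat)) z = (\<Sum>j\<le>k. s (of_nat (k choose j)) ((N ^^ j) z))"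
proof (induction k arbitrary: z)
  case 0
  then show ?case by (simp add: module_rules)
next
  case (Suc k)
  have Nz: "N z \<in> vspace M" using lin_on_closed[OF N_lin Suc.prems] .
  have gk: "g [^] k \<in> carrier G" using g by simp
  have "gact M (g [^] Suc k) z = gact M (g [^] k) (z + N z)"
    using Suc.prems by (subst gact_pow_Suc) auto
  also have "\<dots> = gact M (g [^] k) z + gact M (g [^] k) (N z)"
    by (rule fg_module.gact_add[OF fg gk Suc.prems Nz])
  also have "\<dots> = (\<Sum>j\<le>k. s (of_nat (k choose j)) ((N ^^ j) z)) +
      (\<Sum>j\<le>k. s (of_nat (k choose j)) ((N ^^ Suc j) z))"
    unfolding Suc.IH[OF Suc.prems] Suc.IH[OF Nz] by (simp add: funpow_Suc_right del: funpow.simps(2))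
  also have "\<dots> = (\<Sum>j\<le>Suc k. s (of_nat (Suc k choose j)) ((N ^^ j) z))"
    by (rule pascal_sum[symmetric])
  finally show ?case .
qed

text \<open>
Expand \<open>z = g\<^sup>q z\<close> with \<open>g = 1 + N\<close>; all middle binomial coefficients vanish in the field.
\<close>

lemma N_nilpotent:
  assumes "prime CHAR('f)" "q = CHAR('f) ^ e" "Coset.order G = q" "z \<in> vspace M"
  shows "(N ^^ q) z = 0"
proof -
  have q: "q > 0" using assms(1,2) prime_gt_0_nat by simp
  have "z = gact M (g [^] q) z"
    using assms g pow_order_eq_1[OF g] by (simp add: module_rules)
  also have "\<dots> = (\<Sum>j\<le>q. s (of_nat (q choose j)) ((N ^^ j) z))"
    by (rule gact_pow_binomial[OF assms(4)])
  also have "\<dots> = (\<Sum>j\<in>{0, q}. s (of_nat (q choose j)) ((N ^^ j) z))"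
    using binomial_prime_power_CHAR[OF assms(1,2)] by (intro sum.mono_neutral_right) auto
  also have "\<dots> = z + (N ^^ q) z" using q by simp
  finally show ?thesis by simp
qed

text \<open>
The space \<open>A\<close> is a single Jordan block of size \<open>l\<close> for \<open>N\<close>. It need not be all of the module, so that the
notion also applies to cyclic submodules.
\<close>

definition string_module :: "'v set \<Rightarrow> nat \<Rightarrow> 'v \<Rightarrow> bool"
  where "string_module A l z \<longleftrightarrow> z \<in> vspace M \<and> (N ^^ l) z = 0 \<and>
    fam_indep {..<l} (\<lambda>j. (N ^^ j) z) \<and> span ((\<lambda>j. (N ^^ j) z) ` {..<l}) = A"

lemma string_invariant:
  assumes z: "z \<in> vspace M" "(N ^^ l) z = 0"
  defines "A \<equiv> span ((\<lambda>j. (N ^^ j) z) ` {..<l})"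
  shows "subspace A" "A \<subseteq> vspace M" "x \<in> A \<Longrightarrow> N x \<in> A" "z \<in> A" "(N ^^ j) z \<in> A"
proof -
  have V: "(N ^^ j) z \<in> vspace M" for j
    using lin_on_closed[OF lin_on_funpow[OF N_lin]] z by blast
  show sub: "subspace A" by (simp add: A_def)
  show AV: "A \<subseteq> vspace M" unfolding A_def using V by (intro span_minimal) (auto simp: module_rules)
  have pow: "(N ^^ j) z \<in> A" for j
  proof (cases "j < l")
    case True
    then show ?thesis unfolding A_def by (intro span_base imageI) simp
  next
    case False
    then show ?thesis using funpow_ge_zero[OF N_lin z(2), of j] subspace_0[OF sub] by simp
  qed
  show "(N ^^ j) z \<in> A" by (rule pow)
  show "z \<in> A" using pow[of 0] by simp
  show "N x \<in> A" if x: "x \<in> A" for x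
  proof -
    obtain c where c: "x = (\<Sum>j<l. s (c j) ((N ^^ j) z))"
      using x fam_spanE[of "{..<l}" x "\<lambda>j. (N ^^ j) z"] unfolding A_def by blast
    have "N x = (\<Sum>j<l. s (c j) ((N ^^ Suc j) z))"
      unfolding c using V by (subst lin_on_sum[OF N_lin]) auto
    also have "\<dots> \<in> A" using pow sub by (intro subspace_sum subspace_scale) blast+
    finally show ?thesis .
  qed
qed

text \<open>
A string of maximal length is a direct summand, so an indecomposable module consists of one string.
\<close>

lemma indecomposable_string:
  assumes "prime CHAR('f)" "Coset.order G = CHAR('f) ^ e"
    and M: "fg_indecomposable G s M" "dim (vspace M) = i"
  obtains z where "string_module (vspace M) i z"
proof -
  have nz: "vspace M \<noteq> {0}" using M by (simp add: fg_indecomposable_def)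
  have nil: "(N ^^ (CHAR('f) ^ e)) x = 0" if "x \<in> vspace M" for x
    by (rule N_nilpotent[OF assms(1) refl assms(2) that])
  show thesis
  proof (rule nilpotent_cyclic_summand[OF N_lin _ nz])
    show "(N ^^ (CHAR('f) ^ e)) x = 0" if "x \<in> vspace M" for x by (rule nil[OF that])
  next
    fix z l B
    assume z: "z \<in> vspace M" "0 < l" "(N ^^ l) z = 0" "fam_indep {..<l} (\<lambda>j. (N ^^ j) z)"
      and B: "subspace B" "B \<subseteq> vspace M" "\<And>x. x \<in> B \<Longrightarrow> N x \<in> B"
      and AB: "span ((\<lambda>j. (N ^^ j) z) ` {..<l}) \<inter> B = {0}"
        "vspace M = {a + b |a b. a \<in> span ((\<lambda>j. (N ^^ j) z) ` {..<l}) \<and> b \<in> B}"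
    let ?A = "span ((\<lambda>j. (N ^^ j) z) ` {..<l})"
    note inv = string_invariant[OF z(1,3)]
    have "fg_submodule G s ?A M" "fg_submodule G s B M"
      unfolding submodule_iff_invariant using inv B by blast+
    then have "?A = {0} \<or> B = {0}" using M AB unfolding fg_indecomposable_def by blast
    moreover have "?A \<noteq> {0}"
    proof
      assume "?A = {0}"
      then have "z = 0" using inv(4) by blast
      then have "(\<Sum>j<l. s (if j = 0 then 1 else 0) ((N ^^ j) z)) = 0"
        using lin_on_zero[OF lin_on_funpow[OF N_lin]] by (intro sum.neutral) auto
      from fam_indepD[OF z(4) this, of 0] z(2) show False by simp
    qed
    ultimately have "B = {0}" by simp
    then have "vspace M = ?A" using AB(2) by auto
    moreover have "dim ?A = l"
    proof -
      have *: "inj_on (\<lambda>j. (N ^^ j) z) {..<l}" "independent ((\<lambda>j. (N ^^ j) z) ` {..<l})"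
        using z(4) fam_indep_iff[of "{..<l}"] by auto
      then show ?thesis using dim_span[of "(\<lambda>j. (N ^^ j) z) ` {..<l}"] dim_eq_card_independent[OF *(2)] card_image[OF *(1)] by simp
    qed
    ultimately have "l = i" using M(2) by simp
    then show thesis using that[of z] z \<open>vspace M = ?A\<close> by (simp add: string_module_def)
  qed
qed

text \<open>
The powers of \<open>g = 1 + N\<close> and the powers of \<open>N\<close> span the same operators.
\<close>

lemma fg_cyclic_string:
  assumes y: "y \<in> vspace M" "(N ^^ l) y = 0"
  shows "fg_cyclic G s M y = span ((\<lambda>j. (N ^^ j) y) ` {..<l})" (is "_ = ?A")
proof
  note inv = string_invariant[OF y]
  have "gact M x y \<in> ?A" if x: "x \<in> carrier G" for x
  proof -
    obtain k :: nat where "x = g [^] k" using carrier_pow[OF x] by blast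
    then show ?thesis using gact_pow_invariant[OF inv(1,2,3,4)] by simp
  qed
  then have "(\<Sum>x\<in>carrier G. s (c x) (gact M x y)) \<in> ?A" for c
    by (intro subspace_sum[OF inv(1)] subspace_scale[OF inv(1)])
  then show "fg_cyclic G s M y \<subseteq> ?A" unfolding fg_cyclic_def by blast
  let ?C = "fg_cyclic G s M y"
  have base: "gact M x y \<in> ?C" if "x \<in> carrier G" for x
    unfolding fg_cyclic_def
  proof (intro CollectI exI conjI)
    have "(\<Sum>x'\<in>carrier G. s (if x' = x then 1 else 0) (gact M x' y)) =
        (\<Sum>x'\<in>carrier G. if x' = x then gact M x y else 0)"
      by (intro sum.cong) auto
    then show "gact M x y = (\<Sum>x'\<in>carrier G. s (if x' = x then 1 else 0) (gact M x' y))"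
      using that fin by simp
  qed simp
  have sub: "subspace ?C"
  proof (rule subspaceI)
    show "0 \<in> ?C" unfolding fg_cyclic_def by (intro CollectI exI[of _ "\<lambda>_. 0"]) simp
    fix x z assume "x \<in> ?C" "z \<in> ?C"
    then obtain c d where "x = (\<Sum>x\<in>carrier G. s (c x) (gact M x y))" "z = (\<Sum>x\<in>carrier G. s (d x) (gact M x y))"
      unfolding fg_cyclic_def by blast
    then have "x + z = (\<Sum>x\<in>carrier G. s (c x + d x) (gact M x y))"
      by (simp add: sum.distrib scale_left_distrib)
    then show "x + z \<in> ?C"
      unfolding fg_cyclic_def by (intro CollectI exI[of _ "\<lambda>x. c x + d x"] conjI TrueI)
  next
    fix a x assume "x \<in> ?C"
    then obtain c where "x = (\<Sum>x\<in>carrier G. s (c x) (gact M x y))" unfolding fg_cyclic_def by blast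
    then have "s a x = (\<Sum>x\<in>carrier G. s (a * c x) (gact M x y))"
      by (simp add: scale_sum_right)
    then show "s a x \<in> ?C"
      unfolding fg_cyclic_def by (intro CollectI exI[of _ "\<lambda>x. a * c x"] conjI TrueI)
  qed
  have Ng: "N (gact M (g [^] (k::nat)) y) = gact M (g [^] Suc k) y - gact M (g [^] k) y" for k
  proof -
    have "g [^] k \<in> carrier G" using g by simp
    then have "gact M (g \<otimes> g [^] k) y = gact M g (gact M (g [^] k) y)"
      by (rule fg_module.gact_mult[OF fg g _ y(1)])
    then show ?thesis using nat_pow_Suc2[OF g, of k] by simp
  qed
  have NC: "N x \<in> ?C" if xC: "x \<in> ?C" for x
  proof -
    obtain c where c: "x = (\<Sum>x\<in>carrier G. s (c x) (gact M x y))" using xC unfolding fg_cyclic_def by blast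
    have "N x = (\<Sum>x\<in>carrier G. s (c x) (N (gact M x y)))"
      unfolding c using y by (intro lin_on_sum[OF N_lin]) (auto simp: module_rules)
    also have "\<dots> \<in> ?C"
    proof (intro subspace_sum[OF sub] subspace_scale[OF sub])
      fix x assume "x \<in> carrier G"
      then obtain k :: nat where "x = g [^] k" using carrier_pow by blast
      then show "N (gact M x y) \<in> ?C" using Ng base g by (simp add: subspace_diff[OF sub])
    qed
    finally show ?thesis .
  qed
  have "(N ^^ j) y \<in> ?C" for j
    by (induction j) (use base[of \<one>] y NC in \<open>auto simp: module_rules\<close>)
  then show "?A \<subseteq> ?C" using sub by (intro span_minimal) auto
qed

end

text \<open>
Matching the string vectors gives a linear bijection that commutes with \<open>N\<close>, hence with the generator \<open>g\<close>
and with the whole group.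
\<close>

lemma fg_iso_strings:
  assumes "cyclic_module G g s M" "cyclic_module G g t M'"
    and "cyclic_module.string_module g s M A l z" "cyclic_module.string_module g t M' (vspace M') l z'"
  shows "fg_iso G s (M\<lparr>vspace := A\<rparr>) t M'"
proof -
  interpret M: cyclic_module G g s M by fact
  interpret M': cyclic_module G g t M' by fact
  let ?e = "\<lambda>j. (M.N ^^ j) z" and ?e' = "\<lambda>j. (M'.N ^^ j) z'"
  have z: "z \<in> vspace M" "(M.N ^^ l) z = 0" "M.fam_indep {..<l} ?e" "M.span (?e ` {..<l}) = A"
    using assms(3) by (auto simp: M.string_module_def)
  have z': "z' \<in> vspace M'" "(M'.N ^^ l) z' = 0" "M'.fam_indep {..<l} ?e'" "M'.span (?e' ` {..<l}) = vspace M'"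
    using assms(4) by (auto simp: M'.string_module_def)
  have V: "?e j \<in> vspace M" for j using M.lin_on_closed[OF M.lin_on_funpow[OF M.N_lin] z(1)] .
  have V': "?e' j \<in> vspace M'" for j using M'.lin_on_closed[OF M'.lin_on_funpow[OF M'.N_lin] z'(1)] .
  have "\<exists>c. x = (\<Sum>j<l. s (c j) (?e j))" if "x \<in> A" for x
    using M.fam_spanE[of "{..<l}" x ?e] that z(4) by blast
  then obtain c where c: "\<And>x. x \<in> A \<Longrightarrow> x = (\<Sum>j<l. s (c x j) (?e j))" by metis
  have c_unique: "c x j = d j" if "x = (\<Sum>j<l. s (d j) (?e j))" "x \<in> A" "j < l" for x d j
  proof -
    have "(\<Sum>j<l. s (c x j - d j) (?e j)) = 0"
      using c[OF that(2)] that(1) by (simp add: M.scale_left_diff_distrib sum_subtractf)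
    from M.fam_indepD[OF z(3) this, of j] that(3) show ?thesis by simp
  qed
  define f where "f x = (\<Sum>j<l. t (c x j) (?e' j))" for x
  note inv = M.string_invariant[OF z(1,2), unfolded z(4)]
  have f_eq: "f x = (\<Sum>j<l. t (d j) (?e' j))" if "x = (\<Sum>j<l. s (d j) (?e j))" for x d
  proof -
    have "x \<in> A" unfolding that z(4)[symmetric] by (intro M.fam_spanI M.span_base imageI)
    then show ?thesis unfolding f_def using c_unique[OF that] by (intro sum.cong) auto
  qed
  have add: "f (x + y) = f x + f y" if "x \<in> A" "y \<in> A" for x y
  proof -
    have "x + y = (\<Sum>j<l. s (c x j + c y j) (?e j))"
      by (subst c[OF that(1)], subst c[OF that(2)]) (simp add: M.scale_left_distrib sum.distrib)
    from f_eq[OF this] show ?thesis by (simp add: f_def M'.scale_left_distrib sum.distrib)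
  qed
  have scale: "f (s a x) = t a (f x)" if "x \<in> A" for a x
  proof -
    have "s a x = (\<Sum>j<l. s (a * c x j) (?e j))"
      by (subst c[OF that]) (simp add: M.scale_sum_right)
    from f_eq[OF this] show ?thesis by (simp add: f_def M'.scale_sum_right)
  qed
  have fN: "f (M.N x) = M'.N (f x)" if "x \<in> A" for x
  proof -
    have "M.N x = M.N (\<Sum>j<l. s (c x j) (?e j))"
      by (rule arg_cong[where f = M.N, OF c[OF that]])
    also have "\<dots> = (\<Sum>j<l. s (c x j) (M.N (?e j)))"
      by (rule M.lin_on_sum[OF M.N_lin V])
    also have "\<dots> = (\<Sum>j<l. s (c x j) (?e (1 + j)))" by simp
    also have "\<dots> = (\<Sum>j<l. s (if 1 \<le> j then c x (j - 1) else 0) (?e j))"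
      by (rule M.string_shift[OF M.N_lin z(2)])
    finally have "f (M.N x) = (\<Sum>j<l. t (if 1 \<le> j then c x (j - 1) else 0) (?e' j))" by (rule f_eq)
    also have "\<dots> = (\<Sum>j<l. t (c x j) (?e' (1 + j)))"
      by (rule M'.string_shift[OF M'.N_lin z'(2), symmetric])
    also have "\<dots> = M'.N (f x)"
      unfolding f_def by (subst M'.lin_on_sum[OF M'.N_lin]) (use V' in auto)
    finally show ?thesis .
  qed
  have fV: "f x \<in> vspace M'" for x
    unfolding f_def z'(4)[symmetric] by (intro M'.fam_spanI M'.span_base imageI)
  have AV: "A \<subseteq> vspace M" by (rule inv(2))
  have fg: "f (gact M (g [^]\<^bsub>G\<^esub> k) x) = gact M' (g [^]\<^bsub>G\<^esub> k) (f x)" if "x \<in> A" for x and k :: nat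
    using that
  proof (induction k arbitrary: x)
    case 0
    then show ?case using fV AV M.module_rules(5) M'.module_rules(5) by auto
  next
    case (Suc k)
    have e: "gact M g x = M.N x + x" "gact M' g (f x) = M'.N (f x) + f x" by auto
    have NA: "M.N x \<in> A" using inv(3) Suc.prems .
    have gA: "gact M g x \<in> A" using M.subspace_add[OF inv(1) NA Suc.prems] by simp
    have "f (gact M (g [^]\<^bsub>G\<^esub> Suc k) x) = f (gact M (g [^]\<^bsub>G\<^esub> k) (gact M g x))"
      using AV Suc.prems by (subst M.gact_pow_Suc) auto
    also have "\<dots> = gact M' (g [^]\<^bsub>G\<^esub> k) (f (gact M g x))" by (rule Suc.IH[OF gA])
    also have "f (gact M g x) = gact M' g (f x)"
      using add[OF NA Suc.prems] fN[OF Suc.prems] e by metis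
    also have "gact M' (g [^]\<^bsub>G\<^esub> k) \<dots> = gact M' (g [^]\<^bsub>G\<^esub> Suc k) (f x)"
      by (rule M'.gact_pow_Suc[OF fV, symmetric])
    finally show ?case .
  qed
  have bij: "bij_betw f A (vspace M')"
    unfolding bij_betw_def
  proof (intro conjI)
    show "inj_on f A"
    proof (rule inj_onI)
      fix x y assume xy: "x \<in> A" "y \<in> A" "f x = f y"
      have "c x j = c y j" if "j < l" for j
      proof -
        have "(\<Sum>j<l. t (c x j - c y j) (?e' j)) = 0"
          using xy(3) by (simp add: f_def M'.scale_left_diff_distrib sum_subtractf)
        from M'.fam_indepD[OF z'(3) this, of j] that show ?thesis by simp
      qed
      then have "(\<Sum>j<l. s (c x j) (?e j)) = (\<Sum>j<l. s (c y j) (?e j))" by (intro sum.cong) auto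
      then show "x = y" using c[OF xy(1)] c[OF xy(2)] by simp
    qed
    show "f ` A = vspace M'"
    proof (intro equalityI subsetI)
      fix w assume "w \<in> vspace M'"
      then obtain d where d: "w = (\<Sum>j<l. t (d j) (?e' j))"
        using M'.fam_spanE[of "{..<l}" w ?e'] z'(4) by blast
      let ?x = "\<Sum>j<l. s (d j) (?e j)"
      have "?x \<in> A" unfolding z(4)[symmetric] by (intro M.fam_spanI M.span_base imageI)
      moreover have "f ?x = w" unfolding d by (rule f_eq[OF refl])
      ultimately show "w \<in> f ` A" by blast
    qed (use fV in auto)
  qed
  show ?thesis
    unfolding fg_iso_def
  proof (rule exI[of _ f], intro conjI)
    show "\<forall>x\<in>carrier G. \<forall>z\<in>vspace (M\<lparr>vspace := A\<rparr>). f (gact (M\<lparr>vspace := A\<rparr>) x z) = gact M' x (f z)"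
    proof (intro ballI)
      fix x z assume x: "x \<in> carrier G" and z: "z \<in> vspace (M\<lparr>vspace := A\<rparr>)"
      obtain k :: nat where "x = g [^]\<^bsub>G\<^esub> k" using M.carrier_pow[OF x] by blast
      then show "f (gact (M\<lparr>vspace := A\<rparr>) x z) = gact M' x (f z)" using fg[of z k] z by simp
    qed
  qed (use bij add scale in auto)
qed

context cyclic_module
begin

text \<open>
The generators of the summands \<open>V (lam i)\<close> are carried back along the isomorphism.
\<close>

lemma jordan_basis_of_iso:
  fixes t :: "'f \<Rightarrow> 'w::ab_group_add \<Rightarrow> 'w" and V :: "nat \<Rightarrow> ('g, 'w) gmod" and I :: "'i set"
  assumes I: "finite I"
    and iso: "fg_iso G s M (fam_scale t) (direct_sum I (\<lambda>i. V (lam i)))"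
    and V: "\<And>i. i \<in> I \<Longrightarrow> cyclic_module G g t (V (lam i))"
    and z: "\<And>i. i \<in> I \<Longrightarrow> cyclic_module.string_module g t (V (lam i)) (vspace (V (lam i))) (lam i) (z i)"
    and lam: "\<And>i. i \<in> I \<Longrightarrow> 0 < lam i"
  obtains \<zeta> where "jordan_basis (vspace M) N I lam \<zeta>"
proof -
  let ?DS = "direct_sum I (\<lambda>i. V (lam i))"
  obtain f where f: "bij_betw f (vspace M) (vspace ?DS)"
    "\<And>x y. x \<in> vspace M \<Longrightarrow> y \<in> vspace M \<Longrightarrow> f (x + y) = f x + f y"
    "\<And>c x. x \<in> vspace M \<Longrightarrow> f (s c x) = fam_scale t c (f x)"
    "\<And>a x. a \<in> carrier G \<Longrightarrow> x \<in> vspace M \<Longrightarrow> f (gact M a x) = gact ?DS a (f x)"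
    using iso unfolding fg_iso_def by blast
  let ?n = "\<lambda>i. aug (V (lam i)) g"
  have sub: "subspace (vspace M)" by (rule module_rules(1))
  have zV: "((?n i) ^^ j) (z i) \<in> vspace (V (lam i))" if "i \<in> I" for i j
  proof -
    interpret X: cyclic_module G g t "V (lam i)" by (rule V[OF that])
    show ?thesis using z[OF that] X.lin_on_closed[OF X.lin_on_funpow[OF X.N_lin]]
      by (simp add: X.string_module_def)
  qed
  have V0: "0 \<in> vspace (V (lam i))" "gact (V (lam i)) g 0 = 0" if "i \<in> I" for i
  proof -
    interpret X: cyclic_module G g t "V (lam i)" by (rule V[OF that])
    show "0 \<in> vspace (V (lam i))" using X.subspace_0[OF X.module_rules(1)] .
    show "gact (V (lam i)) g 0 = 0" using X.lin_on_zero[OF X.N_lin] by simp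
  qed
  \<comment> \<open>the element of the direct sum with the single component \<open>x\<close> at \<open>k\<close>\<close>
  define \<delta> where "\<delta> k x = (\<lambda>i. if i = k then x else 0)" for k :: 'i and x :: 'w
  have \<delta>: "\<delta> k x \<in> vspace ?DS" if "k \<in> I" "x \<in> vspace (V (lam k))" for k x
    using that V0 by (auto simp: \<delta>_def direct_sum_def)
  have "\<exists>y\<in>vspace M. f y = \<delta> k (z k)" if "k \<in> I" for k
    using f(1) \<delta>[OF that zV[OF that, of 0]] unfolding bij_betw_def by (force simp: image_iff)
  then obtain \<zeta> where \<zeta>: "\<And>k. k \<in> I \<Longrightarrow> \<zeta> k \<in> vspace M" "\<And>k. k \<in> I \<Longrightarrow> f (\<zeta> k) = \<delta> k (z k)" by metis
  have \<zeta>V: "(N ^^ j) (\<zeta> k) \<in> vspace M" if "k \<in> I" for j k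
    using lin_on_closed[OF lin_on_funpow[OF N_lin] \<zeta>(1)[OF that]] .
  have f_zero: "f 0 = 0"
    using f(2)[of 0 0] subspace_0[OF sub] by simp
  have f_minus: "f (x - y) = f x - f y" if "x \<in> vspace M" "y \<in> vspace M" for x y
    using f(2)[of "x - y" y] that subspace_diff[OF sub] by (simp add: algebra_simps)
  have f_sum: "f (\<Sum>i\<in>J. s (c i) (e i)) = (\<Sum>i\<in>J. fam_scale t (c i) (f (e i)))"
    if "finite J" "\<And>i. i \<in> J \<Longrightarrow> e i \<in> vspace M" for J :: "('i \<times> nat) set" and c e
    using that
  proof (induction J)
    case (insert i J)
    have "(\<Sum>i\<in>J. s (c i) (e i)) \<in> vspace M"
      using insert by (intro subspace_sum[OF sub] subspace_scale[OF sub]) auto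
    then show ?case using insert by (simp add: f(2,3) subspace_scale[OF sub])
  qed (simp add: f_zero)
  have f_pow: "f ((N ^^ j) (\<zeta> k)) = \<delta> k ((?n k ^^ j) (z k))" if k: "k \<in> I" for j k
  proof (induction j)
    case (Suc j)
    have gV: "gact M g ((N ^^ j) (\<zeta> k)) \<in> vspace M" using \<zeta>V[OF k] g by (simp add: module_rules)
    have "f ((N ^^ Suc j) (\<zeta> k)) = gact ?DS g (f ((N ^^ j) (\<zeta> k))) - f ((N ^^ j) (\<zeta> k))"
      using f_minus[OF gV \<zeta>V[OF k]] f(4)[OF g \<zeta>V[OF k]] by simp
    also have "\<dots> = \<delta> k ((?n k ^^ Suc j) (z k))"
      unfolding Suc.IH using k V0 by (auto simp: direct_sum_def \<delta>_def fun_eq_iff)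
    finally show ?case .
  qed (use \<zeta> k in simp)
  have f_comb: "f (\<Sum>x\<in>strings I lam. s (c x) (case x of (i, j) \<Rightarrow> (N ^^ j) (\<zeta> i))) k =
      (if k \<in> I then \<Sum>j<lam k. t (c (k, j)) ((?n k ^^ j) (z k)) else 0)" for c k
  proof -
    have sum_app: "(\<Sum>x\<in>J. F x) k = (\<Sum>x\<in>J. F x k)" for J and F :: "('i \<times> nat) \<Rightarrow> 'i \<Rightarrow> 'w"
      by (induction J rule: infinite_finite_induct) auto
    have "f (\<Sum>x\<in>strings I lam. s (c x) (case x of (i, j) \<Rightarrow> (N ^^ j) (\<zeta> i))) k =
        (\<Sum>x\<in>strings I lam. fam_scale t (c x) (f (case x of (i, j) \<Rightarrow> (N ^^ j) (\<zeta> i)))) k"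
      by (subst f_sum) (use I \<zeta>V in auto)
    also have "\<dots> = (\<Sum>x\<in>strings I lam. case x of (i, j) \<Rightarrow> t (c (i, j)) (\<delta> i ((?n i ^^ j) (z i)) k))"
      unfolding sum_app by (rule sum.cong) (auto simp: f_pow fam_scale_def)
    also have "\<dots> = (\<Sum>i\<in>I. \<Sum>j<lam i. t (c (i, j)) (\<delta> i ((?n i ^^ j) (z i)) k))"
      using I by (subst sum.Sigma) auto
    also have "\<dots> = (\<Sum>i\<in>I. if i = k then \<Sum>j<lam k. t (c (k, j)) ((?n k ^^ j) (z k)) else 0)"
    proof (rule sum.cong[OF refl])
      fix i assume i: "i \<in> I"
      interpret X: cyclic_module G g t "V (lam i)" by (rule V[OF i])
      show "(\<Sum>j<lam i. t (c (i, j)) (\<delta> i ((?n i ^^ j) (z i)) k)) =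
          (if i = k then \<Sum>j<lam k. t (c (k, j)) ((?n k ^^ j) (z k)) else 0)"
        by (auto simp: \<delta>_def)
    qed
    also have "\<dots> = (if k \<in> I then \<Sum>j<lam k. t (c (k, j)) ((?n k ^^ j) (z k)) else 0)"
      using I by simp
    finally show ?thesis .
  qed
  have inj: "inj_on f (vspace M)" using f(1) by (simp add: bij_betw_def)
  have comb_V: "(\<Sum>x\<in>strings I lam. s (c x) (case x of (i, j) \<Rightarrow> (N ^^ j) (\<zeta> i))) \<in> vspace M" for c
    using \<zeta>V by (intro subspace_sum[OF sub] subspace_scale[OF sub]) auto
  have "jordan_basis (vspace M) N I lam \<zeta>"
    unfolding jordan_basis_def
  proof (intro conjI ballI)
    fix i assume i: "i \<in> I"
    interpret X: cyclic_module G g t "V (lam i)" by (rule V[OF i])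
    show "\<zeta> i \<in> vspace M" "0 < lam i" using \<zeta> lam i by auto
    have "f ((N ^^ lam i) (\<zeta> i)) = f 0"
      unfolding f_pow[OF i] f_zero using z[OF i] by (auto simp: X.string_module_def \<delta>_def fun_eq_iff)
    then show "(N ^^ lam i) (\<zeta> i) = 0"
      using inj_onD[OF inj] \<zeta>V[OF i] subspace_0[OF sub] by blast
  next
    show "fam_indep (strings I lam) (\<lambda>(i, j). (N ^^ j) (\<zeta> i))"
      unfolding fam_indep_def
    proof (intro allI impI ballI)
      fix c x assume c: "(\<Sum>x\<in>strings I lam. s (c x) (case x of (i, j) \<Rightarrow> (N ^^ j) (\<zeta> i))) = 0"
        "x \<in> strings I lam"
      then obtain i j where x: "x = (i, j)" "i \<in> I" "j < lam i" by auto
      interpret X: cyclic_module G g t "V (lam i)" by (rule V[OF x(2)])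
      have "(\<Sum>j<lam i. t (c (i, j)) ((?n i ^^ j) (z i))) = 0"
        using f_comb[of c i] x f_zero c(1) by simp
      then show "c x = 0"
        using z[OF x(2)] X.fam_indepD[of "{..<lam i}" "\<lambda>j. (?n i ^^ j) (z i)" "\<lambda>j. c (i, j)" j] x
        by (simp add: X.string_module_def)
    qed
    show "span ((\<lambda>(i, j). (N ^^ j) (\<zeta> i)) ` strings I lam) = vspace M"
    proof
      show "span ((\<lambda>(i, j). (N ^^ j) (\<zeta> i)) ` strings I lam) \<subseteq> vspace M"
        using \<zeta>V by (intro span_minimal sub) auto
      show "vspace M \<subseteq> span ((\<lambda>(i, j). (N ^^ j) (\<zeta> i)) ` strings I lam)"
      proof
        fix x assume x: "x \<in> vspace M"
        then have fx: "f x \<in> vspace ?DS" using f(1) by (auto simp: bij_betw_def)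
        have "\<exists>d. f x i = (\<Sum>j<lam i. t (d j) ((?n i ^^ j) (z i)))" if i: "i \<in> I" for i
        proof -
          interpret X: cyclic_module G g t "V (lam i)" by (rule V[OF i])
          have "f x i \<in> X.span ((\<lambda>j. (?n i ^^ j) (z i)) ` {..<lam i})"
            using fx i z[OF i] by (simp add: direct_sum_def X.string_module_def)
          then show ?thesis using X.fam_spanE[of "{..<lam i}" "f x i" "\<lambda>j. (?n i ^^ j) (z i)"] by blast
        qed
        then obtain d where d: "\<And>i. i \<in> I \<Longrightarrow> f x i = (\<Sum>j<lam i. t (d i j) ((?n i ^^ j) (z i)))" by metis
        let ?y = "\<Sum>x\<in>strings I lam. s (case x of (i, j) \<Rightarrow> d i j) (case x of (i, j) \<Rightarrow> (N ^^ j) (\<zeta> i))"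
        have "f ?y = f x"
        proof
          fix k
          show "f ?y k = f x k"
            unfolding f_comb using d[of k] fx by (auto simp: direct_sum_def)
        qed
        then have "?y = x" using inj_onD[OF inj] comb_V x by blast
        moreover have "?y \<in> span ((\<lambda>(i, j). (N ^^ j) (\<zeta> i)) ` strings I lam)"
          by (rule fam_spanI) (intro span_base imageI)
        ultimately show "x \<in> span ((\<lambda>(i, j). (N ^^ j) (\<zeta> i)) ` strings I lam)" by simp
      qed
    qed
  qed
  then show thesis by (rule that)
qed

lemma internal_direct_sum_strings:
  assumes I: "finite I" and J: "jordan_basis (vspace M) N I lam y"
  shows "internal_direct_sum G s I (\<lambda>i. fg_cyclic G s M (y i)) M"
proof -
  have y: "y i \<in> vspace M" "(N ^^ lam i) (y i) = 0" if "i \<in> I" for i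
    using J that by (auto simp: jordan_basis_def)
  have ind: "fam_indep (strings I lam) (\<lambda>(i, j). (N ^^ j) (y i))"
    and spn: "span ((\<lambda>(i, j). (N ^^ j) (y i)) ` strings I lam) = vspace M"
    using J by (auto simp: jordan_basis_def)
  let ?A = "\<lambda>i. span ((\<lambda>j. (N ^^ j) (y i)) ` {..<lam i})"
  have cyc: "fg_cyclic G s M (y i) = ?A i" if "i \<in> I" for i
    by (rule fg_cyclic_string[OF y[OF that]])
  have A: "\<exists>c. x = (\<Sum>j<lam i. s (c j) ((N ^^ j) (y i)))" if "x \<in> ?A i" for x i
    using fam_spanE[of "{..<lam i}" x "\<lambda>j. (N ^^ j) (y i)"] that by blast
  have Sig: "(\<Sum>x\<in>strings I lam. s (case x of (i, j) \<Rightarrow> c i j) (case x of (i, j) \<Rightarrow> (N ^^ j) (y i))) =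
      (\<Sum>i\<in>I. \<Sum>j<lam i. s (c i j) ((N ^^ j) (y i)))" for c
    using I by (subst sum.Sigma) (auto intro!: sum.cong)
  show ?thesis
    unfolding internal_direct_sum_def
  proof (intro conjI ballI)
    fix i assume i: "i \<in> I"
    show "fg_submodule G s (fg_cyclic G s M (y i)) M"
      unfolding cyc[OF i] submodule_iff_invariant using string_invariant[OF y[OF i]] by blast
  next
    fix x assume x: "x \<in> vspace M"
    then have "x \<in> span ((\<lambda>(i, j). (N ^^ j) (y i)) ` strings I lam)" using spn by simp
    then obtain c where c: "x = (\<Sum>x\<in>strings I lam. s (c x) (case x of (i, j) \<Rightarrow> (N ^^ j) (y i)))"
      using fam_spanE[of "strings I lam" x] I by blast
    define F where "F i = (if i \<in> I then \<Sum>j<lam i. s (c (i, j)) ((N ^^ j) (y i)) else 0)" for i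
    have xF: "x = (\<Sum>i\<in>I. F i)"
      using Sig[of "\<lambda>i j. c (i, j)"] by (simp add: c F_def)
    show "\<exists>!f. (\<forall>i\<in>I. f i \<in> fg_cyclic G s M (y i)) \<and> (\<forall>i. i \<notin> I \<longrightarrow> f i = 0) \<and> x = (\<Sum>i\<in>I. f i)"
    proof (rule ex1I[of _ F])
      have "F i \<in> ?A i" if "i \<in> I" for i
        unfolding F_def if_P[OF that] by (intro fam_spanI span_base imageI)
      then show "(\<forall>i\<in>I. F i \<in> fg_cyclic G s M (y i)) \<and> (\<forall>i. i \<notin> I \<longrightarrow> F i = 0) \<and> x = (\<Sum>i\<in>I. F i)"
        using xF cyc by (auto simp: F_def)
    next
      fix f assume f: "(\<forall>i\<in>I. f i \<in> fg_cyclic G s M (y i)) \<and> (\<forall>i. i \<notin> I \<longrightarrow> f i = 0) \<and> x = (\<Sum>i\<in>I. f i)"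
      then have "\<forall>i\<in>I. \<exists>d. f i = (\<Sum>j<lam i. s (d j) ((N ^^ j) (y i)))" using cyc A by blast
      then obtain d where d: "\<And>i. i \<in> I \<Longrightarrow> f i = (\<Sum>j<lam i. s (d i j) ((N ^^ j) (y i)))" by metis
      have "(\<Sum>x\<in>strings I lam. s (case x of (i, j) \<Rightarrow> d i j - c (i, j)) (case x of (i, j) \<Rightarrow> (N ^^ j) (y i))) =
          (\<Sum>i\<in>I. f i) - (\<Sum>i\<in>I. F i)"
        unfolding Sig using d by (simp add: F_def scale_left_diff_distrib sum_subtractf)
      also have "\<dots> = 0" using f xF by simp
      finally have "d i j = c (i, j)" if "i \<in> I" "j < lam i" for i j
        using fam_indepD[OF ind, of "\<lambda>x. case x of (i, j) \<Rightarrow> d i j - c (i, j)" "(i, j)"] that by simp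
      then show "f = F" using f d by (auto simp: F_def fun_eq_iff)
    qed
  qed
qed

end

section \<open>The grid of vectors\<close>

lemma linear_space_field: "linear_space ((*) :: 'f::field \<Rightarrow> 'f \<Rightarrow> 'f)"
  by unfold_locales (auto simp: algebra_simps)

text \<open>
The situation of the tensor product, reduced to what the argument uses: vectors \<open>v i j\<close>, linear forms \<open>coef i j\<close>
dual to them, and the action of \<open>N\<close>. Outside the grid, \<open>v\<close> is 0 where \<open>N_v\<close> refers to it and \<open>coef\<close> is 0 everywhere,
which spares case distinctions at the borders. Elements are compared through their coefficients.
\<close>

locale grid = linear_space scale
  for scale :: "'f::field \<Rightarrow> 'b::ab_group_add \<Rightarrow> 'b" (infixr \<open>*s\<close> 75) +
  fixes m n :: nat and v :: "nat \<Rightarrow> nat \<Rightarrow> 'b" and coef :: "nat \<Rightarrow> nat \<Rightarrow> 'b \<Rightarrow> 'f"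
    and N :: "'b \<Rightarrow> 'b"
  assumes m_pos: "1 \<le> m" and m_le_n: "m \<le> n"
    and N_lin: "lin_on UNIV N"
    and coef_add: "coef i j (x + y) = coef i j x + coef i j y"
    and coef_scale: "coef i j (c *s x) = c * coef i j x"
    and coef_v: "i \<in> {1..m} \<Longrightarrow> j \<in> {1..n} \<Longrightarrow> coef i' j' (v i j) = (if i' = i \<and> j' = j then 1 else 0)"
    and coef_off: "\<not> (i \<in> {1..m} \<and> j \<in> {1..n}) \<Longrightarrow> coef i j x = 0"
    and v_off: "i = 0 \<or> j = 0 \<Longrightarrow> v i j = 0"
    and N_v: "i \<in> {1..m} \<Longrightarrow> j \<in> {1..n} \<Longrightarrow> N (v i j) = v (i - 1) j + v i (j - 1)"
begin

text \<open>
The space spanned by the grid, written as a span so that it can be identified with the tensor product.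
\<close>

definition total :: "'b set"
  where "total = span {v i j |i j. i \<in> {1..m} \<and> j \<in> {1..n}}"

definition layer :: "nat \<Rightarrow> 'b set"
  where "layer k = span {v i j |i j. i \<in> {1..m} \<and> j \<in> {1..n} \<and> i + j = k + 1}"

lemma subspace_total: "subspace total" by (simp add: total_def)
lemma subspace_layer: "subspace (layer k)" by (simp add: layer_def)

lemma layer_total: "layer k \<subseteq> total"
  unfolding layer_def total_def by (rule span_mono) auto

lemma v_total: "i \<le> m \<Longrightarrow> j \<le> n \<Longrightarrow> v i j \<in> total"
proof (cases "i = 0 \<or> j = 0")
  case False
  assume "i \<le> m" "j \<le> n"
  then have "v i j \<in> {v i j |i j. i \<in> {1..m} \<and> j \<in> {1..n}}" using False by (intro CollectI exI[of _ i] exI[of _ j]) auto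
  then show ?thesis unfolding total_def by (rule span_base)
qed (use v_off subspace_0[OF subspace_total] in simp)

lemma coef_zero: "coef i j 0 = 0"
  using coef_scale[of i j 0 0] by simp

lemma coef_sum: "coef i j (\<Sum>k\<in>K. f k) = (\<Sum>k\<in>K. coef i j (f k))"
  by (induction K rule: infinite_finite_induct) (auto simp: coef_zero coef_add)

lemma coef_uminus: "coef i j (- x) = - coef i j x"
  using coef_scale[of i j "-1" x] by simp

lemma coef_v_le:
  "i' \<le> m \<Longrightarrow> j' \<le> n \<Longrightarrow> 1 \<le> i \<Longrightarrow> 1 \<le> j \<Longrightarrow>
    coef i j (v i' j') = (if i = i' \<and> j = j' then 1 else 0)"
  using coef_v[of i' j' i j] v_off[of i' j'] coef_zero
  by (cases "i' = 0 \<or> j' = 0") auto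

lemma total_expand:
  assumes "z \<in> total"
  shows "z = (\<Sum>i=1..m. \<Sum>j=1..n. coef i j z *s v i j)"
  using assms unfolding total_def
proof (induction rule: span_induct_alt)
  case base
  show ?case by (simp add: coef_zero)
next
  case (step c x y)
  then obtain i j where ij: "x = v i j" "i \<in> {1..m}" "j \<in> {1..n}" by auto
  have "(\<Sum>i'=1..m. \<Sum>j'=1..n. coef i' j' x *s v i' j') =
      (\<Sum>i'=1..m. \<Sum>j'=1..n. if j' = j then (if i' = i then x else 0) else 0)"
    using ij by (intro sum.cong) (auto simp: coef_v)
  also have "\<dots> = x" using ij by (simp add: sum.delta)
  finally have x: "(\<Sum>i'=1..m. \<Sum>j'=1..n. coef i' j' x *s v i' j') = x" .
  have "(\<Sum>i'=1..m. \<Sum>j'=1..n. coef i' j' (c *s x + y) *s v i' j') =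
      c *s (\<Sum>i'=1..m. \<Sum>j'=1..n. coef i' j' x *s v i' j') +
      (\<Sum>i'=1..m. \<Sum>j'=1..n. coef i' j' y *s v i' j')"
    by (simp add: coef_add coef_scale scale_left_distrib sum.distrib scale_sum_right)
  then show ?case unfolding x step.IH[symmetric] by (rule sym)
qed

lemma total_ext:
  assumes "z \<in> total" "z' \<in> total"
    and "\<And>i j. i \<in> {1..m} \<Longrightarrow> j \<in> {1..n} \<Longrightarrow> coef i j z = coef i j z'"
  shows "z = z'"
proof -
  have "(\<Sum>i=1..m. \<Sum>j=1..n. coef i j z *s v i j) = (\<Sum>i=1..m. \<Sum>j=1..n. coef i j z' *s v i j)"
    using assms(3) by (intro sum.cong refl) simp
  then show ?thesis unfolding total_expand[OF assms(1), symmetric] total_expand[OF assms(2), symmetric] .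
qed

lemma total_eq_0: "z \<in> total \<Longrightarrow> (\<And>i j. i \<in> {1..m} \<Longrightarrow> j \<in> {1..n} \<Longrightarrow> coef i j z = 0) \<Longrightarrow> z = 0"
  using total_ext[of z 0] subspace_0[OF subspace_total] by (simp add: coef_zero)

lemma layer_coef:
  assumes "z \<in> layer k" "coef i j z \<noteq> 0"
  shows "i + j = k + 1"
proof (rule ccontr)
  assume ne: "i + j \<noteq> k + 1"
  from assms(1) have "coef i j z = 0"
    unfolding layer_def
  proof (induction rule: span_induct_alt)
    case (step c x y)
    then show ?case using ne by (auto simp: coef_add coef_scale coef_v split: if_splits)
  qed (rule coef_zero)
  with assms(2) show False by simp
qed

lemma layerI:
  assumes "z \<in> total" "\<And>i j. coef i j z \<noteq> 0 \<Longrightarrow> i + j = k + 1"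
  shows "z \<in> layer k"
proof -
  have "(\<Sum>i=1..m. \<Sum>j=1..n. coef i j z *s v i j) \<in> layer k"
  proof (intro subspace_sum[OF subspace_layer])
    fix i j assume ij: "i \<in> {1..m}" "j \<in> {1..n}"
    show "coef i j z *s v i j \<in> layer k"
    proof (cases "coef i j z = 0")
      case False
      then show ?thesis using ij assms(2)[of i j] unfolding layer_def
        by (intro span_scale span_base) blast
    qed (use subspace_0[OF subspace_layer] in simp)
  qed
  then show ?thesis using total_expand[OF assms(1)] by simp
qed

lemma layer_eq_0:
  assumes "z \<in> layer k" "k = 0 \<or> m + n \<le> k"
  shows "z = 0"
proof (rule total_eq_0)
  show "z \<in> total" using assms layer_total by blast
  fix i j assume "i \<in> {1..m}" "j \<in> {1..n}"
  then have "i + j \<noteq> k + 1" using assms(2) by auto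
  then show "coef i j z = 0" using layer_coef[OF assms(1)] by blast
qed

text \<open>
The sums of multiples of vectors on one antidiagonal that occur below all have this shape; the condition on \<open>A\<close>
says that the second index stays between 1 and \<open>n\<close>.
\<close>

lemma coef_line:
  assumes "A \<subseteq> {1..m}" "\<And>i. i \<in> A \<Longrightarrow> i \<le> k \<and> k + 1 \<le> n + i"
  shows "coef i j (\<Sum>t\<in>A. \<alpha> t *s v t (k + 1 - t)) = (if i \<in> A \<and> i + j = k + 1 then \<alpha> i else 0)"
proof -
  have "finite A" using assms(1) finite_subset by blast
  have "coef i j (\<Sum>t\<in>A. \<alpha> t *s v t (k + 1 - t)) =
      (\<Sum>t\<in>A. if t = i then (if i + j = k + 1 then \<alpha> i else 0) else 0)"
    unfolding coef_sum coef_scale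
  proof (rule sum.cong[OF refl])
    fix t assume t: "t \<in> A"
    then have "t \<in> {1..m}" "k + 1 - t \<in> {1..n}" using assms(1) assms(2)[OF t] by auto
    then have "coef i j (v t (k + 1 - t)) = (if i = t \<and> j = k + 1 - t then 1 else 0)"
      by (rule coef_v)
    then show "\<alpha> t * coef i j (v t (k + 1 - t)) = (if t = i then (if i + j = k + 1 then \<alpha> i else 0) else 0)"
      using assms(2)[OF t] by auto
  qed
  then show ?thesis using \<open>finite A\<close> by simp
qed

lemma line_layer:
  assumes "A \<subseteq> {1..m}" "\<And>i. i \<in> A \<Longrightarrow> i \<le> k \<and> k + 1 \<le> n + i"
  shows "(\<Sum>t\<in>A. \<alpha> t *s v t (k + 1 - t)) \<in> layer k"
  unfolding layer_def
proof (intro span_sum span_scale span_base)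
  fix t assume t: "t \<in> A"
  then have "t \<in> {1..m}" "k + 1 - t \<in> {1..n}" "t + (k + 1 - t) = k + 1"
    using assms(1) assms(2)[OF t] by auto
  then show "v t (k + 1 - t) \<in> {v i j |i j. i \<in> {1..m} \<and> j \<in> {1..n} \<and> i + j = k + 1}" by blast
qed

text \<open>
Projection onto a layer along the other layers.
\<close>

definition proj :: "nat \<Rightarrow> 'b \<Rightarrow> 'b"
  where "proj k z = (\<Sum>t\<in>{t \<in> {1..m}. t \<le> k \<and> k + 1 \<le> n + t}. coef t (k + 1 - t) z *s v t (k + 1 - t))"

lemma coef_proj: "coef i j (proj k z) = (if i + j = k + 1 then coef i j z else 0)"
proof -
  have "coef i j (proj k z) = (if i \<in> {t \<in> {1..m}. t \<le> k \<and> k + 1 \<le> n + t} \<and> i + j = k + 1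
      then coef i (k + 1 - i) z else 0)"
    unfolding proj_def by (rule coef_line) auto
  also have "\<dots> = (if i + j = k + 1 then coef i j z else 0)"
  proof (cases "i \<in> {1..m} \<and> j \<in> {1..n} \<and> i + j = k + 1")
    case True
    then have "k + 1 - i = j" by auto
    then show ?thesis using True by auto
  next
    case False
    then show ?thesis using coef_off[of i j z] by auto
  qed
  finally show ?thesis .
qed

lemma proj_layer: "proj k z \<in> layer k"
  unfolding proj_def by (rule line_layer) auto

lemma proj_total: "proj k z \<in> total"
  using proj_layer layer_total by blast

lemma proj_id:
  assumes "z \<in> layer k"
  shows "proj k z = z"
proof (rule total_ext[OF proj_total])
  show "z \<in> total" using assms layer_total by blast
  show "coef i j (proj k z) = coef i j z" for i j
    using layer_coef[OF assms, of i j] by (auto simp: coef_proj)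
qed

lemma sum_proj:
  assumes "z \<in> total"
  shows "(\<Sum>k=1..m + n. proj k z) = z"
proof (rule total_ext)
  show "(\<Sum>k=1..m + n. proj k z) \<in> total"
    using proj_total by (intro subspace_sum[OF subspace_total])
  fix i j assume ij: "i \<in> {1..m}" "j \<in> {1..n}"
  have "coef i j (\<Sum>k=1..m + n. proj k z) = (\<Sum>k=1..m + n. if k = i + j - 1 then coef i j z else 0)"
    unfolding coef_sum coef_proj using ij by (intro sum.cong) auto
  moreover have "i + j - 1 \<in> {1..m + n}" using ij by auto
  ultimately show "coef i j (\<Sum>k=1..m + n. proj k z) = coef i j z" by simp
qed (rule assms)

lemma N_add: "N (x + y) = N x + N y" and N_scale: "N (c *s x) = c *s N x"
  using N_lin by (auto simp: lin_on_def)

lemma N_zero: "N 0 = 0" using lin_on_zero[OF N_lin] .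

lemma funpow_scale: "(N ^^ r) (c *s x) = c *s (N ^^ r) x"
  using lin_on_funpow[OF N_lin] by (auto simp: lin_on_def)

text \<open>
Both claims are proved together since the induction over the span needs the first one for the second.
\<close>

lemma N_total_coef:
  assumes "z \<in> total"
  shows "N z \<in> total \<and> (\<forall>i j. 1 \<le> i \<longrightarrow> 1 \<le> j \<longrightarrow> coef i j (N z) = coef (Suc i) j z + coef i (Suc j) z)"
  using assms unfolding total_def
proof (induction rule: span_induct_alt)
  case base
  show ?case using subspace_0[OF subspace_total] by (simp add: N_zero coef_zero total_def)
next
  case (step c x y)
  then obtain i' j' where ij: "x = v i' j'" "i' \<in> {1..m}" "j' \<in> {1..n}" by auto
  have Nx: "N x = v (i' - 1) j' + v i' (j' - 1)" using ij N_v by simp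
  have Nt: "N x \<in> total" unfolding Nx using ij by (intro subspace_add[OF subspace_total] v_total) auto
  have Nc: "coef i j (N x) = coef (Suc i) j x + coef i (Suc j) x" if "1 \<le> i" "1 \<le> j" for i j
  proof -
    have "i' - 1 \<le> m" "i' \<le> m" "j' - 1 \<le> n" "j' \<le> n" using ij by auto
    then show ?thesis unfolding Nx unfolding ij(1) coef_add using ij that by (auto simp: coef_v_le)
  qed
  have IH: "N y \<in> total" "\<And>i j. 1 \<le> i \<Longrightarrow> 1 \<le> j \<Longrightarrow> coef i j (N y) = coef (Suc i) j y + coef i (Suc j) y"
    using step.IH unfolding total_def by auto
  have "N (c *s x + y) \<in> total"
    unfolding N_add N_scale
    by (intro subspace_add[OF subspace_total] subspace_scale[OF subspace_total] Nt IH)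
  moreover have "coef i j (N (c *s x + y)) = coef (Suc i) j (c *s x + y) + coef i (Suc j) (c *s x + y)"
    if "1 \<le> i" "1 \<le> j" for i j
    unfolding N_add N_scale coef_add coef_scale Nc[OF that] IH(2)[OF that] by (simp add: algebra_simps)
  ultimately show ?case unfolding total_def by blast
qed

lemma N_total: "z \<in> total \<Longrightarrow> N z \<in> total"
  using N_total_coef by blast

lemma coef_N: "z \<in> total \<Longrightarrow> 1 \<le> i \<Longrightarrow> 1 \<le> j \<Longrightarrow> coef i j (N z) = coef (Suc i) j z + coef i (Suc j) z"
  using N_total_coef by blast

lemma N_lin_total: "lin_on total N"
  using N_total N_lin subspace_total by (auto simp: lin_on_def)

lemma funpow_total: "z \<in> total \<Longrightarrow> (N ^^ r) z \<in> total"
  using lin_on_closed[OF lin_on_funpow[OF N_lin_total]] .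

lemma N_layer:
  assumes "z \<in> layer k"
  shows "N z \<in> layer (k - 1)"
proof (rule layerI)
  have z: "z \<in> total" using assms layer_total by blast
  show "N z \<in> total" using N_total[OF z] .
  fix i j assume ij: "coef i j (N z) \<noteq> 0"
  then have "i \<in> {1..m}" "j \<in> {1..n}" using coef_off by blast+
  then have "coef (Suc i) j z \<noteq> 0 \<or> coef i (Suc j) z \<noteq> 0" using coef_N[OF z] ij by auto
  then have "i + j = k" using layer_coef[OF assms] by force
  then show "i + j = k - 1 + 1" using \<open>i \<in> {1..m}\<close> by auto
qed

lemma funpow_layer: "z \<in> layer k \<Longrightarrow> (N ^^ r) z \<in> layer (k - r)"
proof (induction r)
  case (Suc r)
  then show ?case using N_layer[of "(N ^^ r) z" "k - r"] by simp
qed simp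

text \<open>
In the polynomial picture this is the binomial expansion of \<open>(X + Y)\<^sup>r\<close>.
\<close>

lemma coef_funpow:
  "z \<in> total \<Longrightarrow> 1 \<le> i \<Longrightarrow> 1 \<le> j \<Longrightarrow>
    coef i j ((N ^^ r) z) = (\<Sum>s\<le>r. of_nat (r choose s) * coef (i + s) (j + r - s) z)"
proof (induction r arbitrary: z)
  case (Suc r)
  have "coef i j ((N ^^ Suc r) z) = coef i j ((N ^^ r) (N z))" by (simp add: funpow_swap1)
  also have "\<dots> = (\<Sum>s\<le>r. of_nat (r choose s) * coef (i + s) (j + r - s) (N z))"
    using Suc N_total by simp
  also have "\<dots> = (\<Sum>s\<le>r. of_nat (r choose s) * coef (i + s) (j + Suc r - s) z +
      of_nat (r choose s) * coef (i + Suc s) (j + Suc r - Suc s) z)"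
    using Suc.prems by (intro sum.cong refl) (simp add: coef_N Suc_diff_le algebra_simps)
  also have "\<dots> = (\<Sum>s\<le>Suc r. of_nat (Suc r choose s) * coef (i + s) (j + Suc r - s) z)"
    unfolding linear_space.pascal_sum[OF linear_space_field] sum.distrib ..
  finally show ?case .
qed simp

lemma funpow_proj:
  assumes "z \<in> total"
  shows "(N ^^ r) (proj (k + r) z) = proj k ((N ^^ r) z)"
proof -
  have 1: "N (proj (Suc k) z) = proj k (N z)" if "z \<in> total" for z k
  proof (rule total_ext[OF N_total[OF proj_total] proj_total])
    fix i j assume "i \<in> {1..m}" "j \<in> {1..n}"
    then show "coef i j (N (proj (Suc k) z)) = coef i j (proj k (N z))"
      using that proj_total by (simp add: coef_N coef_proj)
  qed
  show ?thesis
    using assms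
  proof (induction r arbitrary: k)
    case (Suc r)
    have "(N ^^ Suc r) (proj (k + Suc r) z) = N ((N ^^ r) (proj (Suc k + r) z))" by simp
    also have "\<dots> = N (proj (Suc k) ((N ^^ r) z))" unfolding Suc.IH[OF Suc.prems] ..
    also have "\<dots> = proj k (N ((N ^^ r) z))" by (rule 1[OF funpow_total[OF Suc.prems]])
    finally show ?case by simp
  qed simp
qed

text \<open>
Multiplication by \<open>X\<close> in the polynomial picture: it commutes with \<open>N\<close> and relates the kernel vectors of
neighbouring layers.
\<close>

definition shift :: "'b \<Rightarrow> 'b"
  where "shift z = (\<Sum>i=1..m. \<Sum>j=1..n. coef i j z *s v (i - 1) j)"

lemma shift_total: "shift z \<in> total"
  unfolding shift_def by (intro subspace_sum[OF subspace_total] subspace_scale[OF subspace_total] v_total) auto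

lemma coef_shift:
  assumes "1 \<le> i" "1 \<le> j"
  shows "coef i j (shift z) = coef (Suc i) j z"
proof -
  have "coef i j (shift z) = (\<Sum>i'=1..m. \<Sum>j'=1..n. if j' = j then (if i' = Suc i then coef (Suc i) j z else 0) else 0)"
    unfolding shift_def coef_sum coef_scale
  proof (intro sum.cong refl)
    fix i' j' assume ij: "i' \<in> {1..m}" "j' \<in> {1..n}"
    then have "i' - 1 \<le> m" "j' \<le> n" by auto
    then have "coef i j (v (i' - 1) j') = (if i = i' - 1 \<and> j = j' then 1 else 0)"
      using assms by (rule coef_v_le)
    then show "coef i' j' z * coef i j (v (i' - 1) j') =
        (if j' = j then (if i' = Suc i then coef (Suc i) j z else 0) else 0)"
      using ij assms by auto
  qed
  also have "\<dots> = (if j \<in> {1..n} \<and> Suc i \<in> {1..m} then coef (Suc i) j z else 0)"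
    by (cases "j \<in> {1..n}") (auto intro!: sum.neutral)
  finally show ?thesis using coef_off[of "Suc i" j z] by auto
qed

lemma coef_shift_funpow: "1 \<le> i \<Longrightarrow> 1 \<le> j \<Longrightarrow> coef i j ((shift ^^ r) z) = coef (i + r) j z"
  by (induction r arbitrary: i) (auto simp: coef_shift)

lemma shift_funpow_total: "z \<in> total \<Longrightarrow> (shift ^^ r) z \<in> total"
  by (induction r) (auto simp: shift_total)

lemma shift_funpow_layer:
  assumes "z \<in> layer k"
  shows "(shift ^^ r) z \<in> layer (k - r)"
proof (rule layerI)
  show "(shift ^^ r) z \<in> total" using assms layer_total shift_funpow_total by blast
  fix i j assume c: "coef i j ((shift ^^ r) z) \<noteq> 0"
  then have "1 \<le> i" "1 \<le> j" using coef_off[of i j] by force+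
  then have "coef (i + r) j z \<noteq> 0" using c coef_shift_funpow by simp
  then show "i + j = k - r + 1" using layer_coef[OF assms] \<open>1 \<le> i\<close> \<open>1 \<le> j\<close> by force
qed

lemma N_shift:
  assumes "z \<in> total"
  shows "N (shift z) = shift (N z)"
  by (rule total_ext[OF N_total[OF shift_total] shift_total])
     (use assms shift_total in \<open>simp add: coef_N coef_shift\<close>)

lemma funpow_shift: "z \<in> total \<Longrightarrow> (N ^^ r) (shift z) = shift ((N ^^ r) z)"
  by (induction r) (auto simp: N_shift funpow_total)

lemma funpow_shift_funpow: "z \<in> total \<Longrightarrow> (N ^^ r) ((shift ^^ s) z) = (shift ^^ s) ((N ^^ r) z)"
  by (induction s) (auto simp: funpow_shift shift_funpow_total)

text \<open>
The socle vectors called \<open>x i\<close> in the theorem.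
\<close>

definition soc :: "nat \<Rightarrow> 'b"
  where "soc i = (\<Sum>j=1..i. (-1) ^ (j - 1) *s v j (i + 1 - j))"

lemma soc_layer: "i \<le> m \<Longrightarrow> soc i \<in> layer i"
  unfolding soc_def by (rule line_layer) (use m_le_n in auto)

lemma soc_total: "i \<le> m \<Longrightarrow> soc i \<in> total"
  using soc_layer layer_total by blast

lemma coef_soc: "i \<le> m \<Longrightarrow> coef i' j' (soc i) = (if i' \<in> {1..i} \<and> i' + j' = i + 1 then (-1) ^ (i' - 1) else 0)"
  unfolding soc_def by (rule coef_line) (use m_le_n in auto)

lemma N_soc:
  assumes "i \<le> m"
  shows "N (soc i) = 0"
proof (rule total_eq_0)
  show "N (soc i) \<in> total" using assms soc_total N_total by blast
  fix i' j' assume ij: "i' \<in> {1..m}" "j' \<in> {1..n}"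
  then have "(-1 :: 'f) ^ i' = - ((-1) ^ (i' - 1))" by (cases i') auto
  then show "coef i' j' (N (soc i)) = 0"
    using ij assms soc_total by (auto simp: coef_N coef_soc)
qed

lemma shift_soc:
  assumes "1 \<le> i" "Suc i \<le> m"
  shows "shift (soc (Suc i)) = - soc i"
proof (rule total_ext[OF shift_total])
  show "- soc i \<in> total" using soc_total[of i] assms subspace_neg[OF subspace_total] by simp
  fix i' j' assume ij: "i' \<in> {1..m}" "j' \<in> {1..n}"
  then have "(-1 :: 'f) ^ i' = - ((-1) ^ (i' - 1))" by (cases i') auto
  then show "coef i' j' (shift (soc (Suc i))) = coef i' j' (- soc i)"
    using ij assms by (auto simp: coef_shift coef_soc coef_uminus)
qed

lemma shift_scale: "shift (c *s z) = c *s shift z"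
  by (simp add: shift_def coef_scale scale_sum_right)

lemma shift_funpow_soc:
  assumes "r < i" "i \<le> m"
  shows "(shift ^^ r) (soc i) = (-1) ^ r *s soc (i - r)"
  using assms
proof (induction r)
  case (Suc r)
  have 1: "i - r = Suc (i - Suc r)" using Suc by simp
  have 2: "shift (soc (Suc (i - Suc r))) = - soc (i - Suc r)"
    using Suc by (intro shift_soc) auto
  have "(shift ^^ Suc r) (soc i) = shift ((-1) ^ r *s soc (i - r))" using Suc by simp
  also have "\<dots> = (-1) ^ Suc r *s soc (i - Suc r)" unfolding shift_scale 1 2 by simp
  finally show ?case .
qed simp

lemma fam_indep_soc: "fam_indep {1..m} soc"
  unfolding fam_indep_def
proof (intro allI impI ballI)
  fix c i assume c: "(\<Sum>i=1..m. c i *s soc i) = 0" "i \<in> {1..m}"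
  have "0 = coef 1 i (\<Sum>i=1..m. c i *s soc i)" using c by (simp add: coef_zero)
  also have "\<dots> = (\<Sum>k=1..m. if k = i then c i else 0)"
    unfolding coef_sum coef_scale by (intro sum.cong) (auto simp: coef_soc)
  also have "\<dots> = c i" using c by simp
  finally show "c i = 0" by simp
qed

lemma soc_nonzero: "i \<in> {1..m} \<Longrightarrow> soc i \<noteq> 0"
  using coef_soc[of i 1 i] coef_zero[of 1 i] by auto

text \<open>
For a kernel vector, adjacent coefficients on an antidiagonal are negatives of each other. Above layer \<open>m\<close> the
antidiagonal can be continued beyond the row \<open>m\<close>, where the coefficients vanish.
\<close>

lemma kernel_layer_large:
  assumes z: "z \<in> layer k" "N z = 0" and k: "m < k"
  shows "z = 0"
proof -
  have zt: "z \<in> total" using z layer_total by blast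
  have "\<forall>i j. m + 1 - i = d \<longrightarrow> coef i j z = 0" for d
  proof (induction d)
    case 0
    show ?case using coef_off by auto
  next
    case (Suc d)
    show ?case
    proof (intro allI impI)
      fix i j assume i: "m + 1 - i = Suc d"
      show "coef i j z = 0"
      proof (cases "i \<in> {1..m} \<and> i + j = k + 1")
        case True
        then obtain j' where j': "j = Suc j'" "1 \<le> j'" using k by (cases j) auto
        then have "0 = coef (Suc i) j' z + coef i j z"
          using coef_N[OF zt, of i j'] True z(2) coef_zero by simp
        then show ?thesis using Suc i by simp
      qed (use coef_off layer_coef[OF z(1)] in blast)
    qed
  qed
  then show ?thesis using zt by (intro total_eq_0) auto
qed

text \<open>
Adjacent coefficients on the antidiagonal are negatives of each other, so the first one determines the vector.
\<close>

lemma kernel_layer_small: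
  assumes z: "z \<in> layer k" "N z = 0" and k: "k \<in> {1..m}"
  shows "z = coef 1 k z *s soc k"
proof (rule total_ext)
  show zt: "z \<in> total" using z layer_total by blast
  show "coef 1 k z *s soc k \<in> total" using soc_total k subspace_scale[OF subspace_total] by simp
  have step: "coef (Suc i) j z = (-1) ^ i * coef 1 k z" if "Suc i + j = k + 1" "1 \<le> j" for i j
    using that
  proof (induction i arbitrary: j)
    case (Suc i)
    have "0 = coef (Suc (Suc i)) j z + coef (Suc i) (Suc j) z"
      using coef_N[OF zt, of "Suc i" j] Suc.prems z(2) coef_zero by simp
    then show ?case using Suc.IH[of "Suc j"] Suc.prems by (simp add: eq_neg_iff_add_eq_0)
  qed simp
  fix i j assume ij: "i \<in> {1..m}" "j \<in> {1..n}"
  show "coef i j z = coef i j (coef 1 k z *s soc k)"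
  proof (cases "i + j = k + 1")
    case True
    then show ?thesis using step[of "i - 1" j] ij k by (simp add: coef_scale coef_soc)
  next
    case False
    then have "coef i j z = 0" using layer_coef[OF z(1)] by blast
    then show ?thesis using False k by (simp add: coef_scale coef_soc)
  qed
qed

text \<open>
The socle vector \<open>soc i\<close> is the end of a string of length more than \<open>r\<close>.
\<close>

definition high :: "nat \<Rightarrow> nat \<Rightarrow> bool"
  where "high r i \<longleftrightarrow> soc i \<in> (N ^^ r) ` total"

text \<open>
As \<open>N\<close> is homogeneous, a preimage of a homogeneous vector may be replaced by its homogeneous component.
\<close>

lemma high_layer:
  assumes "i \<in> {1..m}" "high r i"
  obtains y where "y \<in> layer (i + r)" "(N ^^ r) y = soc i"
proof -
  obtain w where w: "w \<in> total" "soc i = (N ^^ r) w" using assms(2) by (auto simp: high_def)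
  have "(N ^^ r) (proj (i + r) w) = proj i (soc i)" unfolding w(2) by (rule funpow_proj[OF w(1)])
  also have "\<dots> = soc i" using assms soc_layer by (intro proj_id) auto
  finally show thesis using that proj_layer by blast
qed

text \<open>
Multiplication by \<open>- X\<close> carries a preimage of \<open>soc (i+1)\<close> to a preimage of \<open>soc i\<close>.
\<close>

lemma high_Suc:
  assumes "1 \<le> i" "Suc i \<le> m" "high r (Suc i)"
  shows "high r i"
proof -
  obtain w where w: "w \<in> total" "soc (Suc i) = (N ^^ r) w" using assms(3) by (auto simp: high_def)
  have "(N ^^ r) ((-1) *s shift w) = (-1) *s shift (soc (Suc i))"
    unfolding funpow_scale w(2) using w(1) funpow_shift by simp
  also have "\<dots> = soc i" using shift_soc assms by simp
  finally have e: "(N ^^ r) ((-1) *s shift w) = soc i" .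
  show ?thesis unfolding high_def e[symmetric]
    by (intro imageI subspace_scale[OF subspace_total] shift_total)
qed

lemma high_antimono: "1 \<le> i \<Longrightarrow> i \<le> j \<Longrightarrow> j \<le> m \<Longrightarrow> high r j \<Longrightarrow> high r i"
proof (induction "j - i" arbitrary: i)
  case (Suc d)
  then have "high r (Suc i)" by simp
  then show ?case using high_Suc Suc by simp
qed simp

lemma highI:
  assumes "z \<in> total" "(N ^^ r) z = c *s soc i" "c \<noteq> 0"
  shows "high r i"
proof -
  have "(N ^^ r) (inverse c *s z) = soc i" unfolding funpow_scale assms(2) using assms(3) by simp
  moreover have "inverse c *s z \<in> total" using assms(1) subspace_scale[OF subspace_total] by blast
  ultimately show ?thesis unfolding high_def by (metis imageI)
qed

text \<open>
The homogeneous components of a kernel vector in the image of \<open>N\<^sup>r\<close> are again of this kind, and by the description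
of the kernel in a layer they are multiples of socle vectors.
\<close>

lemma kernel_image:
  assumes z: "z \<in> total" "N ((N ^^ r) z) = 0"
  shows "(N ^^ r) z \<in> span (soc ` {i \<in> {1..m}. high r i})"
proof -
  let ?z = "(N ^^ r) z"
  have "proj k ?z \<in> span (soc ` {i \<in> {1..m}. high r i})" if k: "k \<ge> 1" for k
  proof -
    have e: "(N ^^ r) (proj (k + r) z) = proj k ?z" by (rule funpow_proj[OF z(1)])
    have "N (proj k ?z) = proj (k - 1) (N ?z)"
      using funpow_proj[OF funpow_total[OF z(1)], of 1 "k - 1" r] k by simp
    also have "\<dots> = 0" using z by (simp add: proj_def coef_zero)
    finally have N0: "N (proj k ?z) = 0" .
    show ?thesis
    proof (cases "m < k")
      case True
      then show ?thesis using kernel_layer_large[OF proj_layer N0] by (simp add: span_zero)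
    next
      case False
      define c where "c = coef 1 k (proj k ?z)"
      have c: "proj k ?z = c *s soc k"
        unfolding c_def using kernel_layer_small[OF proj_layer N0] k False by simp
      show ?thesis
      proof (cases "c = 0")
        case False
        have "high r k" by (rule highI[OF proj_total e[unfolded c] False])
        then show ?thesis unfolding c using k \<open>\<not> m < k\<close> by (intro span_scale span_base) auto
      qed (simp add: c span_zero)
    qed
  qed
  then have "(\<Sum>k=1..m + n. proj k ?z) \<in> span (soc ` {i \<in> {1..m}. high r i})"
    by (intro span_sum) auto
  then show ?thesis using sum_proj[OF funpow_total[OF z(1)]] by simp
qed

text \<open>
On the way to 0 a nonzero vector of layer \<open>k\<close> last becomes a multiple of some \<open>soc i\<close>, after \<open>s = k - i\<close> steps.
\<close>

lemma funpow_inj_layer: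
  assumes z: "z \<in> layer k" "(N ^^ r) z = 0"
    and no: "\<And>s i. s < r \<Longrightarrow> i \<in> {1..m} \<Longrightarrow> i + s = k \<Longrightarrow> \<not> high s i"
  shows "z = 0"
proof (rule ccontr)
  assume nz: "z \<noteq> 0"
  have zt: "z \<in> total" using z layer_total by blast
  define s where "s = (LEAST s. (N ^^ Suc s) z = 0)"
  have r: "r > 0" using nz z(2) by (cases r) auto
  then have ex: "(N ^^ Suc (r - 1)) z = 0" using z(2) by simp
  have s0: "(N ^^ Suc s) z = 0" unfolding s_def by (rule LeastI[where P = "\<lambda>s. (N ^^ Suc s) z = 0", OF ex])
  have "s \<le> r - 1" unfolding s_def by (rule Least_le[where P = "\<lambda>s. (N ^^ Suc s) z = 0", OF ex])
  then have sr: "s < r" using r by simp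
  have s1: "(N ^^ s) z \<noteq> 0"
  proof (cases s)
    case (Suc t)
    then have "t < (LEAST s. (N ^^ Suc s) z = 0)" unfolding s_def[symmetric] by simp
    then show ?thesis unfolding Suc by (rule not_less_Least)
  qed (use nz in simp)
  let ?y = "(N ^^ s) z"
  have y: "?y \<in> layer (k - s)" "N ?y = 0" using funpow_layer[OF z(1)] s0 by auto
  have "k - s \<noteq> 0" using s1 layer_eq_0[OF y(1) disjI1] by metis
  moreover have "\<not> m < k - s" using s1 kernel_layer_large[OF y] by metis
  ultimately have k: "k - s \<in> {1..m}" by auto
  define c where "c = coef 1 (k - s) ?y"
  have c: "?y = c *s soc (k - s)" unfolding c_def by (rule kernel_layer_small[OF y k])
  then have "c \<noteq> 0" using s1 by auto
  then have "high s (k - s)" by (rule highI[OF zt c])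
  then show False using no[OF sr k] k by auto
qed

lemma layer_span_line: "layer k = span ((\<lambda>i. v i (k + 1 - i)) ` {i \<in> {1..m}. i \<le> k \<and> k + 1 \<le> n + i})"
proof -
  have "{v i j |i j. i \<in> {1..m} \<and> j \<in> {1..n} \<and> i + j = k + 1} =
      (\<lambda>i. v i (k + 1 - i)) ` {i \<in> {1..m}. i \<le> k \<and> k + 1 \<le> n + i}"
  proof (intro equalityI subsetI)
    fix x assume "x \<in> {v i j |i j. i \<in> {1..m} \<and> j \<in> {1..n} \<and> i + j = k + 1}"
    then obtain i j where ij: "x = v i j" "i \<in> {1..m}" "j \<in> {1..n}" "i + j = k + 1" by blast
    then have "j = k + 1 - i" by simp
    then show "x \<in> (\<lambda>i. v i (k + 1 - i)) ` {i \<in> {1..m}. i \<le> k \<and> k + 1 \<le> n + i}"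
      using ij by (intro image_eqI[of _ _ i]) auto
  next
    fix x assume "x \<in> (\<lambda>i. v i (k + 1 - i)) ` {i \<in> {1..m}. i \<le> k \<and> k + 1 \<le> n + i}"
    then obtain i where "i \<in> {1..m}" "i \<le> k" "k + 1 \<le> n + i" "x = v i (k + 1 - i)" by blast
    then show "x \<in> {v i j |i j. i \<in> {1..m} \<and> j \<in> {1..n} \<and> i + j = k + 1}"
      by (intro CollectI exI[of _ i] exI[of _ "k + 1 - i"]) auto
  qed
  then show ?thesis by (simp add: layer_def)
qed

lemma funpow_linear:
  "(N ^^ r) (x + y) = (N ^^ r) x + (N ^^ r) y" "(N ^^ r) (x - y) = (N ^^ r) x - (N ^^ r) y"
proof -
  show add: "(N ^^ r) (x + y) = (N ^^ r) x + (N ^^ r) y" for x y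
    using lin_on_funpow[OF N_lin] by (auto simp: lin_on_def)
  show "(N ^^ r) (x - y) = (N ^^ r) x - (N ^^ r) y"
    using add[of "x - y" y] by (simp add: algebra_simps)
qed

text \<open>
This is the map \<open>U\<close> applied to a power of \<open>N\<close>. Along an antidiagonal that power acts on the coefficients as
convolution with the coefficients of \<open>(1 + t)\<^sup>b\<^sup>-\<^sup>a\<^sup>-\<^sup>1\<close>, by \<open>coef_funpow\<close>.
\<close>

lemma alternating_inverse:
  assumes ab: "a + 1 < b" "b \<le> m" and z: "z \<in> layer (m + n - a - 1)"
  shows "(\<Sum>k=m - a..m. (\<Sum>t=k..m. (-1) ^ (t - k) * of_nat ((t - k + b - a - 2) choose (b - a - 2)) *
    coef t (m + n - b + 1 - t) ((N ^^ (b - a - 1)) z)) *s v k (m + n - a - k)) = z"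
    (is "(\<Sum>k=m - a..m. ?\<alpha> k *s v k (m + n - a - k)) = z")
proof -
  define c where "c = b - a - 1"
  have c: "1 \<le> c" "b - a - 2 = c - 1" "b = a + 1 + c" using ab by (auto simp: c_def)
  have zt: "z \<in> total" using z layer_total by blast
  define h where "h u = coef u (m + n - a - u) z" for u
  have h0: "h u = 0" if "m < u" for u using that coef_off by (simp add: h_def)
  have co: "coef t (m + n - b + 1 - t) ((N ^^ c) z) = (\<Sum>s\<le>c. of_nat (c choose s) * h (t + s))"
    if "1 \<le> t" "t \<le> m" for t
  proof -
    have "coef t (m + n - b + 1 - t) ((N ^^ c) z) =
        (\<Sum>s\<le>c. of_nat (c choose s) * coef (t + s) (m + n - b + 1 - t + c - s) z)"
      using that ab m_le_n by (intro coef_funpow[OF zt]) auto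
    also have "\<dots> = (\<Sum>s\<le>c. of_nat (c choose s) * h (t + s))"
    proof (intro sum.cong refl)
      fix s assume "s \<in> {..c}"
      then have "m + n - b + 1 - t + c - s = m + n - a - (t + s)"
        using that ab m_le_n c by auto
      then show "of_nat (c choose s) * coef (t + s) (m + n - b + 1 - t + c - s) z =
          of_nat (c choose s) * h (t + s)" by (simp add: h_def)
    qed
    finally show ?thesis .
  qed
  have \<alpha>: "?\<alpha> k = h k" if k: "k \<in> {m - a..m}" for k
  proof -
    have "?\<alpha> k = (\<Sum>t=k..m. (-1) ^ (t - k) * of_nat ((t - k + c - 1) choose (c - 1)) *
        (\<Sum>s\<le>c. of_nat (c choose s) * h (t + s)))"
    proof (intro sum.cong refl)
      fix t assume t: "t \<in> {k..m}"
      then have "1 \<le> t" "t \<le> m" using k ab by auto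
      moreover have "t - k + b - a - 2 = t - k + c - 1" using c ab by simp
      ultimately show "(-1) ^ (t - k) * of_nat ((t - k + b - a - 2) choose (b - a - 2)) *
          coef t (m + n - b + 1 - t) ((N ^^ (b - a - 1)) z) =
          (-1) ^ (t - k) * of_nat ((t - k + c - 1) choose (c - 1)) * (\<Sum>s\<le>c. of_nat (c choose s) * h (t + s))"
        using co[of t] c(2) by (simp only: c_def[symmetric])
    qed
    also have "\<dots> = h k" by (rule convolution_inverse[OF c(1) h0]) (use k in auto)
    finally show ?thesis .
  qed
  let ?k = "m + n - a - 1"
  have A: "{m - a..m} \<subseteq> {1..m}" using ab by auto
  have A': "i \<le> ?k \<and> ?k + 1 \<le> n + i" if "i \<in> {m - a..m}" for i using that ab m_le_n by auto
  have e: "(\<Sum>k=m - a..m. ?\<alpha> k *s v k (m + n - a - k)) = (\<Sum>k\<in>{m - a..m}. h k *s v k (?k + 1 - k))"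
  proof (intro sum.cong refl)
    fix k assume k: "k \<in> {m - a..m}"
    have "m + n - a - k = ?k + 1 - k" using ab m_le_n by simp
    then show "?\<alpha> k *s v k (m + n - a - k) = h k *s v k (?k + 1 - k)" unfolding \<alpha>[OF k] by simp
  qed
  show ?thesis unfolding e
  proof (rule total_ext[OF _ zt])
    show "(\<Sum>k\<in>{m - a..m}. h k *s v k (?k + 1 - k)) \<in> total"
      using line_layer[of "{m - a..m}" ?k h, OF A A'] layer_total by blast
    fix i j assume ij: "i \<in> {1..m}" "j \<in> {1..n}"
    have "coef i j (\<Sum>k\<in>{m - a..m}. h k *s v k (?k + 1 - k)) =
        (if i \<in> {m - a..m} \<and> i + j = ?k + 1 then h i else 0)"
      by (rule coef_line[OF A A'])
    also have "\<dots> = coef i j z"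
    proof (cases "i + j = ?k + 1")
      case True
      then have "j = m + n - a - i" "i \<in> {m - a..m}" using ij ab m_le_n by auto
      then show ?thesis using True by (simp add: h_def)
    next
      case False
      then show ?thesis using layer_coef[OF z, of i j] by auto
    qed
    finally show "coef i j (\<Sum>k\<in>{m - a..m}. h k *s v k (?k + 1 - k)) = coef i j z" .
  qed
qed

text \<open>
The sum that defines the later generators of a block is a power of \<open>shift\<close> applied to the first generator.
\<close>

lemma shift_explicit:
  assumes i: "a + 1 \<le> i" "i \<le> m" and z: "z \<in> layer (m + n - a - 1)"
  shows "(\<Sum>j=m - i + 1..m + a - i + 1. coef (j + i - a - 1) (m + n - a - (j + i - a - 1)) z *s
    v j (m + n + 1 - i - j)) = (shift ^^ (i - a - 1)) z"
proof -
  have zt: "z \<in> total" using z layer_total by blast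
  let ?k = "m + n - i" and ?A = "{m - i + 1..m + a - i + 1}"
  let ?h = "\<lambda>j. coef (j + i - a - 1) (m + n - a - (j + i - a - 1)) z"
  have A: "?A \<subseteq> {1..m}" and A': "\<And>t. t \<in> ?A \<Longrightarrow> t \<le> ?k \<and> ?k + 1 \<le> n + t" using i m_le_n by auto
  have k: "m + n + 1 - i = ?k + 1" using i m_le_n by simp
  show ?thesis
    unfolding k
  proof (rule total_ext[OF _ shift_funpow_total[OF zt]])
    show "(\<Sum>j\<in>?A. ?h j *s v j (?k + 1 - j)) \<in> total"
      using line_layer[of ?A ?k ?h, OF A A'] layer_total by blast
    fix i' j' assume ij: "i' \<in> {1..m}" "j' \<in> {1..n}"
    have "coef i' j' (\<Sum>j\<in>?A. ?h j *s v j (?k + 1 - j)) =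
        (if i' \<in> ?A \<and> i' + j' = ?k + 1 then ?h i' else 0)"
      by (rule coef_line[OF A A'])
    also have "\<dots> = coef (i' + (i - a - 1)) j' z"
    proof (cases "i' + j' = ?k + 1")
      case True
      show ?thesis
      proof (cases "i' \<in> ?A")
        case inA: True
        have "i' + i - a - 1 = i' + (i - a - 1)" "m + n - a - (i' + (i - a - 1)) = j'"
          using True inA ij i m_le_n by auto
        then have h: "?h i' = coef (i' + (i - a - 1)) j' z" by (simp only:)
        have c: "i' \<in> ?A \<and> i' + j' = ?k + 1" using True inA by blast
        show ?thesis unfolding if_P[OF c] by (rule h)
      next
        case False
        then have "m < i' + (i - a - 1)" using True ij i m_le_n by auto
        then show ?thesis using False coef_off by auto
      qed
    next
      case False
      then have "i' + (i - a - 1) + j' \<noteq> m + n - a - 1 + 1" using i m_le_n by auto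
      then have "coef (i' + (i - a - 1)) j' z = 0" using layer_coef[OF z] by blast
      then show ?thesis using False by simp
    qed
    also have "\<dots> = coef i' j' ((shift ^^ (i - a - 1)) z)"
      using ij by (simp add: coef_shift_funpow)
    finally show "coef i' j' (\<Sum>j\<in>?A. ?h j *s v j (?k + 1 - j)) = coef i' j' ((shift ^^ (i - a - 1)) z)" .
  qed
qed

lemma fam_indep_line: "fam_indep {i \<in> {1..m}. i \<le> k \<and> k + 1 \<le> n + i} (\<lambda>i. v i (k + 1 - i))"
  (is "fam_indep ?L _")
  unfolding fam_indep_def
proof (intro allI impI ballI)
  fix c i assume c: "(\<Sum>i\<in>?L. c i *s v i (k + 1 - i)) = 0" "i \<in> ?L"
  have "coef i (k + 1 - i) (\<Sum>i\<in>?L. c i *s v i (k + 1 - i)) =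
      (if i \<in> ?L \<and> i + (k + 1 - i) = k + 1 then c i else 0)"
    by (rule coef_line) auto
  then show "c i = 0" using c by (auto simp: coef_zero)
qed

lemma representation_line:
  assumes z: "z \<in> layer k" and i: "i \<in> {i \<in> {1..m}. i \<le> k \<and> k + 1 \<le> n + i}" (is "_ \<in> ?L")
  shows "representation ((\<lambda>i. v i (k + 1 - i)) ` ?L) z (v i (k + 1 - i)) = coef i (k + 1 - i) z"
proof -
  let ?e = "\<lambda>i. v i (k + 1 - i)"
  have L: "inj_on ?e ?L" "independent (?e ` ?L)"
    using fam_indep_line[of k] fam_indep_iff[of ?L ?e] by auto
  have "z = (\<Sum>t\<in>?L. coef t (k + 1 - t) z *s ?e t)" using proj_id[OF z] by (simp add: proj_def)
  then have "representation (?e ` ?L) z (?e i) =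
      representation (?e ` ?L) (\<Sum>t\<in>?L. coef t (k + 1 - t) z *s ?e t) (?e i)" by simp
  also have "\<dots> = (\<Sum>t\<in>?L. representation (?e ` ?L) (coef t (k + 1 - t) z *s ?e t) (?e i))"
    by (subst representation_sum[OF L(2)]) (intro span_scale span_base imageI, simp_all)
  also have "\<dots> = (\<Sum>t\<in>?L. if t = i then coef i (k + 1 - i) z else 0)"
  proof (rule sum.cong[OF refl])
    fix t assume t: "t \<in> ?L"
    have "representation (?e ` ?L) (coef t (k + 1 - t) z *s ?e t) (?e i) =
        coef t (k + 1 - t) z * representation (?e ` ?L) (?e t) (?e i)"
      by (subst representation_scale[OF L(2) span_base[OF imageI[OF t]]]) simp
    also have "representation (?e ` ?L) (?e t) (?e i) = (if ?e i = ?e t then 1 else 0)"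
      by (subst representation_basis[OF L(2) imageI[OF t]]) simp
    also have "?e i = ?e t \<longleftrightarrow> t = i" using inj_onD[OF L(1)] i t by blast
    finally show "representation (?e ` ?L) (coef t (k + 1 - t) z *s ?e t) (?e i) =
        (if t = i then coef i (k + 1 - i) z else 0)" by auto
  qed
  also have "\<dots> = coef i (k + 1 - i) z" using i by simp
  finally show ?thesis .
qed

text \<open>
The vectors \<open>v (m - k + 1 + i) (n - i)\<close> for \<open>i < k\<close> are the basis of layer \<open>m + n - k\<close>, ordered by the first index
and counted from 0.
\<close>

lemma upper_line_layer:
  assumes "k \<in> {1..m}"
  shows "(\<Sum>i<k. c i *s v (m - k + 1 + i) (n - i)) \<in> layer (m + n - k)"
proof -
  have "v (m - k + 1 + i) (n - i) \<in> layer (m + n - k)" if "i < k" for i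
    unfolding layer_def using that assms m_le_n
    by (intro span_base CollectI exI[of _ "m - k + 1 + i"] exI[of _ "n - i"]) auto
  then show ?thesis
    by (intro subspace_sum[OF subspace_layer] subspace_scale[OF subspace_layer]) auto
qed

lemma coef_upper_line:
  assumes "k \<in> {1..m}" "j < k"
  shows "coef (m - k + 1 + j) (n - j) (\<Sum>i<k. c i *s v (m - k + 1 + i) (n - i)) = c j"
proof -
  have "coef (m - k + 1 + j) (n - j) (\<Sum>i<k. c i *s v (m - k + 1 + i) (n - i)) =
      (\<Sum>i<k. if i = j then c j else 0)"
    unfolding coef_sum coef_scale
  proof (rule sum.cong[OF refl])
    fix i assume i: "i \<in> {..<k}"
    then have "m - k + 1 + i \<in> {1..m}" "n - i \<in> {1..n}" using assms m_le_n by auto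
    then have "coef (m - k + 1 + j) (n - j) (v (m - k + 1 + i) (n - i)) =
        (if m - k + 1 + j = m - k + 1 + i \<and> n - j = n - i then 1 else 0)"
      by (rule coef_v)
    then show "c i * coef (m - k + 1 + j) (n - j) (v (m - k + 1 + i) (n - i)) = (if i = j then c j else 0)"
      by auto
  qed
  then show ?thesis using assms by simp
qed

lemma funpow_upper_line:
  assumes k: "k \<in> {1..m}" and j: "j < k"
  shows "(N ^^ (m + n - 2 * k)) (v (m - k + 1 + j) (n - j)) =
    (\<Sum>i<k. of_nat (shift_binom (m + n - 2 * k) (m - k) i j) *s v (Suc i) (k - i))"
proof -
  let ?r = "m + n - 2 * k" and ?z = "v (m - k + 1 + j) (n - j)"
  let ?h = "\<lambda>t. of_nat (shift_binom ?r (m - k) (t - 1) j) :: 'f"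
  have ze: "?z = (\<Sum>i<k. (if i = j then 1 else 0) *s v (m - k + 1 + i) (n - i))"
  proof -
    have "(\<Sum>i<k. (if i = j then 1 else 0) *s v (m - k + 1 + i) (n - i)) =
        (\<Sum>i<k. if i = j then ?z else 0)" by (rule sum.cong) auto
    then show ?thesis using j by simp
  qed
  have z: "?z \<in> layer (m + n - k)" by (subst ze) (rule upper_line_layer[OF k])
  have zt: "?z \<in> total" using z layer_total by blast
  have Nz: "(N ^^ ?r) ?z \<in> layer k"
    using funpow_layer[OF z, of ?r] k m_le_n by simp
  have e: "(\<Sum>i<k. of_nat (shift_binom ?r (m - k) i j) *s v (Suc i) (k - i)) =
      (\<Sum>t\<in>{1..k}. ?h t *s v t (k + 1 - t))"
    by (rule sum.reindex_bij_witness[of _ "\<lambda>t. t - 1" Suc]) auto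
  have A: "{1..k} \<subseteq> {1..m}" "\<And>i. i \<in> {1..k} \<Longrightarrow> i \<le> k \<and> k + 1 \<le> n + i" using k m_le_n by auto
  show ?thesis unfolding e
  proof (rule total_ext[OF funpow_total[OF zt]])
    show "(\<Sum>t\<in>{1..k}. ?h t *s v t (k + 1 - t)) \<in> total"
      using line_layer[of "{1..k}" k ?h, OF A] layer_total by blast
    fix i0 j0 assume ij: "i0 \<in> {1..m}" "j0 \<in> {1..n}"
    have rhs: "coef i0 j0 (\<Sum>t\<in>{1..k}. ?h t *s v t (k + 1 - t)) =
        (if i0 \<in> {1..k} \<and> i0 + j0 = k + 1 then ?h i0 else 0)" by (rule coef_line[OF A])
    show "coef i0 j0 ((N ^^ ?r) ?z) = coef i0 j0 (\<Sum>t\<in>{1..k}. ?h t *s v t (k + 1 - t))"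
    proof (cases "i0 + j0 = k + 1")
      case False
      then show ?thesis unfolding rhs using layer_coef[OF Nz, of i0 j0] by auto
    next
      case True
      let ?s = "m - k + 1 + j - i0"
      have "m - k + 1 + j \<in> {1..m}" "n - j \<in> {1..n}" using k j m_le_n by auto
      note cv = coef_v[OF this]
      have "coef i0 j0 ((N ^^ ?r) ?z) = (\<Sum>s\<le>?r. of_nat (?r choose s) * coef (i0 + s) (j0 + ?r - s) ?z)"
        using ij by (intro coef_funpow[OF zt]) auto
      also have "\<dots> = (\<Sum>s\<le>?r. if s = ?s then ?h i0 else 0)"
      proof (rule sum.cong[OF refl])
        fix s assume s: "s \<in> {..?r}"
        have iff: "i0 + s = m - k + 1 + j \<and> j0 + ?r - s = n - j \<longleftrightarrow> i0 \<le> m - k + 1 + j \<and> s = ?s"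
          using True k j m_le_n ij s by auto
        show "of_nat (?r choose s) * coef (i0 + s) (j0 + ?r - s) ?z = (if s = ?s then ?h i0 else 0)"
          unfolding cv iff using ij by (auto simp: shift_binom_def Suc_diff_le)
      qed
      also have "\<dots> = ?h i0"
      proof (cases "?s \<le> ?r")
        case False
        then have "?r < m - k + j - (i0 - 1)" using ij by auto
        then show ?thesis using False by (simp add: shift_binom_def binomial_eq_0)
      qed simp
      finally show ?thesis unfolding rhs using True ij by auto
    qed
  qed
qed

text \<open>
If the image of \<open>d\<close> in the field were 0, the determinant of the matrix over the field would be 0, and a null vector
would contradict injectivity. After this, the formula is the integer identity of \<open>binomial_matrix_inverse\<close> mapped
to the field and divided by \<open>d\<close>.
\<close>

lemma middle_inverse:
  assumes k: "k \<in> {1..m}" and inj: "inj_on (N ^^ (m + n - 2 * k)) (layer (m + n - k))"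
  obtains d :: int and z :: "nat \<Rightarrow> nat \<Rightarrow> int"
  where "of_int d = d_rat (m + n - 2 * k) (m - k) k"
    and "\<And>i j. i \<in> {1..k} \<Longrightarrow> j \<in> {1..k} \<Longrightarrow> of_int (z i j) = z_rat (m + n - 2 * k) (m - k) k i j"
    and "(of_int d :: 'f) \<noteq> 0"
    and "\<And>j. j < k \<Longrightarrow> (N ^^ (m + n - 2 * k))
      (\<Sum>i<k. (inverse (of_int d) * of_int (z (Suc i) (Suc j))) *s v (m - k + 1 + i) (n - i)) =
      v (Suc j) (k - j)"
proof -
  let ?r = "m + n - 2 * k"
  let ?e = "\<lambda>i. v (m - k + 1 + i) (n - i)" and ?f = "\<lambda>i. v (Suc i) (k - i)"
  have "m - k \<le> ?r" using k m_le_n by auto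
  then obtain d z where d: "of_int d = d_rat ?r (m - k) k"
    and z: "\<And>i j. i \<in> {1..k} \<Longrightarrow> j \<in> {1..k} \<Longrightarrow> of_int (z i j) = z_rat ?r (m - k) k i j"
    and det: "d = det (mat k k (\<lambda>(i, j). int (shift_binom ?r (m - k) i j)))"
    and prod: "\<And>i j. i < k \<Longrightarrow> j < k \<Longrightarrow>
      (\<Sum>l<k. int (shift_binom ?r (m - k) i l) * z (Suc l) (Suc j)) = (if i = j then d else 0)"
    using binomial_matrix_inverse[of "m - k" ?r k] by blast
  have N_comb: "(N ^^ ?r) (\<Sum>i<k. c i *s ?e i) =
      (\<Sum>l<k. (\<Sum>i<k. of_nat (shift_binom ?r (m - k) l i) * c i) *s ?f l)" for c
  proof -
    have "(N ^^ ?r) (\<Sum>i<k. c i *s ?e i) = (\<Sum>i<k. c i *s (N ^^ ?r) (?e i))"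
      by (rule lin_on_sum[OF lin_on_funpow[OF N_lin]]) simp
    also have "\<dots> = (\<Sum>i<k. c i *s (\<Sum>l<k. of_nat (shift_binom ?r (m - k) l i) *s ?f l))"
      by (intro sum.cong refl) (simp only: funpow_upper_line[OF k] lessThan_iff)
    also have "\<dots> = (\<Sum>i<k. \<Sum>l<k. (of_nat (shift_binom ?r (m - k) l i) * c i) *s ?f l)"
      by (simp add: scale_sum_right mult.commute)
    also have "\<dots> = (\<Sum>l<k. \<Sum>i<k. (of_nat (shift_binom ?r (m - k) l i) * c i) *s ?f l)"
      by (rule sum.swap)
    finally show ?thesis by (simp only: scale_sum_left)
  qed
  have d0: "(of_int d :: 'f) \<noteq> 0"
  proof
    assume d0: "(of_int d :: 'f) = 0"
    let ?M = "mat k k (\<lambda>(i, j). of_nat (shift_binom ?r (m - k) i j) :: 'f)"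
    have "?M = map_mat of_int (mat k k (\<lambda>(i, j). int (shift_binom ?r (m - k) i j)))"
      by (rule eq_matI) auto
    then have "det ?M = 0" using d0 det by (simp add: of_int_hom.hom_det)
    then obtain x where x: "x \<in> carrier_vec k" "x \<noteq> 0\<^sub>v k" "?M *\<^sub>v x = 0\<^sub>v k"
      using det_0_iff_vec_prod_zero_field[of ?M k] by auto
    have "(\<Sum>i<k. of_nat (shift_binom ?r (m - k) l i) * x $ i) = 0" if l: "l < k" for l
    proof -
      have "(?M *\<^sub>v x) $ l = (\<Sum>i<k. of_nat (shift_binom ?r (m - k) l i) * x $ i)"
        using l x(1) by (auto simp: scalar_prod_def lessThan_atLeast0)
      then show ?thesis using x(3) l by simp
    qed
    then have "(N ^^ ?r) (\<Sum>i<k. x $ i *s ?e i) = 0" unfolding N_comb by simp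
    moreover have "(N ^^ ?r) 0 = 0" using lin_on_zero[OF lin_on_funpow[OF N_lin]] .
    ultimately have x0: "(\<Sum>i<k. x $ i *s ?e i) = 0"
      using inj_onD[OF inj _ upper_line_layer[OF k] subspace_0[OF subspace_layer]] by simp
    have "x $ j = 0" if "j < k" for j
      using coef_upper_line[OF k that, of "\<lambda>i. x $ i"] x0 by (simp add: coef_zero)
    then have "x = 0\<^sub>v k" using x(1) by (intro eq_vecI) auto
    with x(2) show False by simp
  qed
  have "(N ^^ ?r) (\<Sum>i<k. (inverse (of_int d) * of_int (z (Suc i) (Suc j))) *s ?e i) = ?f j"
    if j: "j < k" for j
  proof -
    have "(\<Sum>i<k. of_nat (shift_binom ?r (m - k) l i) * (inverse (of_int d) * of_int (z (Suc i) (Suc j)))) =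
        (if l = j then 1 else 0 :: 'f)" if l: "l < k" for l
    proof -
      have "(\<Sum>i<k. of_nat (shift_binom ?r (m - k) l i) * (inverse (of_int d) * of_int (z (Suc i) (Suc j)))) =
          inverse (of_int d) * (of_int (\<Sum>i<k. int (shift_binom ?r (m - k) l i) * z (Suc i) (Suc j)) :: 'f)"
        by (simp add: sum_distrib_left mult_ac)
      also have "\<dots> = (if l = j then 1 else 0)" unfolding prod[OF l j] using d0 by simp
      finally show ?thesis .
    qed
    then have "(N ^^ ?r) (\<Sum>i<k. (inverse (of_int d) * of_int (z (Suc i) (Suc j))) *s ?e i) =
        (\<Sum>l<k. (if l = j then 1 else 0) *s ?f l)" unfolding N_comb by (intro sum.cong) auto
    also have "\<dots> = (\<Sum>l<k. if l = j then ?f j else 0)" by (rule sum.cong) auto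
    also have "\<dots> = ?f j" using j by simp
    finally show ?thesis .
  qed
  note inverse = this
  show thesis
  proof (rule that[of d z])
    show "of_int (z i j) = z_rat ?r (m - k) k i j" if "i \<in> {1..k}" "j \<in> {1..k}" for i j
      using z that .
  qed (fact d d0 inverse)+
qed

end

section \<open>Layered permutations\<close>

text \<open>
The count of values up to \<open>t\<close> says that every value in \<open>{1..m}\<close> is taken exactly once. Suppose \<open>\<sigma>\<close> increases
from \<open>i\<close> to \<open>i + 1\<close>. To get later to a value below \<open>\<sigma> i\<close>, it would have to take the value \<open>\<sigma> i\<close> again, because it
descends by steps of one. Going backwards from \<open>i\<close> in the same way, all values up to \<open>i\<close> lie below all values after
\<open>i\<close>, and therefore they are \<open>1, ..., i\<close>.
\<close>

lemma layered_permutation: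
  fixes \<sigma> :: "nat \<Rightarrow> nat"
  assumes cnt: "\<And>t. t \<in> {1..m} \<Longrightarrow> card {i \<in> {1..m}. \<sigma> i \<le> t} = t"
    and pos: "\<And>i. i \<in> {1..m} \<Longrightarrow> 1 \<le> \<sigma> i"
    and desc: "\<And>i. 1 \<le> i \<Longrightarrow> i < m \<Longrightarrow> \<sigma> i \<le> \<sigma> (Suc i) + 1"
  shows "bij_betw \<sigma> {1..m} {1..m}"
    and "i \<le> m \<Longrightarrow> i = 0 \<or> i = m \<or> \<sigma> i \<le> \<sigma> (Suc i) \<Longrightarrow> \<sigma> ` {1..i} = {1..i}"
proof -
  have surj: "t \<in> \<sigma> ` {1..m}" if t: "t \<in> {1..m}" for t
  proof (rule ccontr)
    assume "t \<notin> \<sigma> ` {1..m}"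
    then have "{i \<in> {1..m}. \<sigma> i \<le> t} = {i \<in> {1..m}. \<sigma> i \<le> t - 1}"
      by (auto simp: le_less image_iff)
    moreover have "card {i \<in> {1..m}. \<sigma> i \<le> t - 1} = t - 1"
    proof (cases "t = 1")
      case True
      then have "{i \<in> {1..m}. \<sigma> i \<le> t - 1} = {}" using pos by force
      then show ?thesis using True by (metis card.empty diff_self_eq_0)
    next
      case False
      then show ?thesis using t by (intro cnt) auto
    qed
    ultimately show False using cnt[OF t] t by auto
  qed
  have le: "\<sigma> i \<le> m" if "i \<in> {1..m}" for i
  proof -
    have "m \<in> {1..m}" using that by auto
    then have "{i \<in> {1..m}. \<sigma> i \<le> m} = {1..m}"
      using cnt[of m] by (intro card_subset_eq) auto
    then show ?thesis using that by blast
  qed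
  have img: "\<sigma> ` {1..m} = {1..m}" using surj le pos by force
  then have inj: "inj_on \<sigma> {1..m}" by (intro eq_card_imp_inj_on) auto
  show "bij_betw \<sigma> {1..m} {1..m}" using img inj by (simp add: bij_betw_def)
  assume i: "i \<le> m" "i = 0 \<or> i = m \<or> \<sigma> i \<le> \<sigma> (Suc i)"
  show "\<sigma> ` {1..i} = {1..i}"
  proof (cases "i = 0 \<or> i = m")
    case True
    then show ?thesis using img by auto
  next
    case False
    have ne: "\<sigma> j \<noteq> \<sigma> k" if "j \<in> {1..m}" "k \<in> {1..m}" "j \<noteq> k" for j k
      using inj_onD[OF inj] that by blast
  have up: "\<sigma> i < \<sigma> k" if "Suc i \<le> k" "k \<le> m" for k
      using that
    proof (induction k rule: nat_induct_at_least)
      case base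
      then show ?case using False i ne[of i "Suc i"] by auto
    next
      case (Suc k)
      then show ?case using desc[of k] ne[of i "Suc k"] False i by auto
    qed
    have sep: "\<sigma> j < \<sigma> k" if "j \<le> i" "1 \<le> j" "k \<in> {Suc i..m}" for j k
      using that
    proof (induction j rule: inc_induct)
      case base
      then show ?case using up by simp
    next
      case (step j)
      then have "\<sigma> (Suc j) < \<sigma> k" by simp
      then show ?case using desc[of j] ne[of j k] step i by auto
    qed
    have "\<sigma> ` {1..i} \<subseteq> {1..i}"
    proof
      fix s assume "s \<in> \<sigma> ` {1..i}"
      then obtain j where j: "j \<in> {1..i}" "s = \<sigma> j" by auto
      have "\<sigma> ` {Suc i..m} \<subseteq> {Suc s..m}" using sep j le by force
      then have "card (\<sigma> ` {Suc i..m}) \<le> card {Suc s..m}" by (intro card_mono) auto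
      moreover have "card (\<sigma> ` {Suc i..m}) = m - i"
        by (subst card_image) (auto intro: inj_on_subset[OF inj])
      ultimately have "s \<le> i" using i le[of j] j by auto
      then show "s \<in> {1..i}" using pos[of j] j i by auto
    qed
    moreover have "card (\<sigma> ` {1..i}) = i"
      using i by (subst card_image) (auto intro: inj_on_subset[OF inj])
    ultimately show ?thesis by (intro card_subset_eq) auto
  qed
qed

text \<open>
At both ends of a maximal interval on which \<open>lam\<close> is constant, \<open>\<sigma>\<close> does not descend, so \<open>\<sigma>\<close> permutes the
interval. Inside it, \<open>\<sigma> k + k\<close> is constant, so \<open>\<sigma>\<close> is the reversal \<open>k \<mapsto> a + b + 1 - k\<close>.
\<close>

lemma layered_block:
  fixes \<sigma> lam :: "nat \<Rightarrow> nat"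
  assumes bij: "bij_betw \<sigma> {1..m} {1..m}"
    and invar: "\<And>i. i \<le> m \<Longrightarrow> i = 0 \<or> i = m \<or> \<sigma> i \<le> \<sigma> (Suc i) \<Longrightarrow> \<sigma> ` {1..i} = {1..i}"
    and sum: "\<And>i. i \<in> {1..m} \<Longrightarrow> \<sigma> i + lam i + i = s + 1"
    and anti: "\<And>i j. 1 \<le> i \<Longrightarrow> i \<le> j \<Longrightarrow> j \<le> m \<Longrightarrow> lam j \<le> lam i"
    and ab: "a < b" "b \<le> m"
    and const: "\<And>k. k \<in> {a+1..b} \<Longrightarrow> lam k = l"
    and a: "a = 0 \<or> lam a \<noteq> l" and b: "b = m \<or> lam (Suc b) \<noteq> l"
  shows "\<sigma> ` {1..b} = {1..b}"
    and "\<And>k. k \<in> {a+1..b} \<Longrightarrow> \<sigma> k + k = a + b + 1"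
    and "l + a + b = s"
proof -
  have fa: "\<sigma> ` {1..a} = {1..a}"
  proof (rule invar)
    show "a = 0 \<or> a = m \<or> \<sigma> a \<le> \<sigma> (Suc a)"
    proof (cases "a = 0")
      case False
      then have "lam (Suc a) < lam a"
        using a ab const[of "Suc a"] anti[of a "Suc a"] by auto
      then show ?thesis using sum[of a] sum[of "Suc a"] ab False by auto
    qed simp
  qed (use ab in simp)
  show fb: "\<sigma> ` {1..b} = {1..b}"
  proof (rule invar)
    show "b = 0 \<or> b = m \<or> \<sigma> b \<le> \<sigma> (Suc b)"
    proof (cases "b = m")
      case False
      then have "lam (Suc b) < lam b"
        using b ab const[of b] anti[of b "Suc b"] by auto
      then show ?thesis using sum[of b] sum[of "Suc b"] ab False by auto
    qed simp
  qed (use ab in simp)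
  have inj: "inj_on \<sigma> {1..m}" using bij by (simp add: bij_betw_def)
  have img: "\<sigma> ` {a+1..b} = {a+1..b}"
  proof -
    have "{a+1..b} = {1..b} - {1..a}" using ab by auto
    then have "\<sigma> ` {a+1..b} = \<sigma> ` {1..b} - \<sigma> ` {1..a}"
      using ab by (simp only:) (intro inj_on_image_set_diff[OF inj]; auto)
    then show ?thesis using fa fb ab by auto
  qed
  have c: "\<sigma> k + k = s + 1 - l" if "k \<in> {a+1..b}" for k
    using sum[of k] const[OF that] that ab by auto
  have "b \<in> \<sigma> ` {a+1..b}" unfolding img using ab by auto
  then obtain k where k: "k \<in> {a+1..b}" "\<sigma> k = b" by auto
  have "\<sigma> (a + 1) \<in> {a+1..b}" using img ab by auto
  then have "s + 1 - l = a + b + 1" using c[OF k(1)] c[of "a + 1"] k ab by auto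
  then show "\<sigma> k + k = a + b + 1" if "k \<in> {a+1..b}" for k using c[OF that] by simp
  show "l + a + b = s" using \<open>s + 1 - l = a + b + 1\<close> by simp
qed

section \<open>Jordan strings of the grid\<close>

text \<open>
The isomorphism with a direct sum of string modules enters through a basis of strings of the given lengths.
This basis need not be homogeneous; it serves to count dimensions, and homogeneous strings are found from \<open>high_layer\<close>.
\<close>

locale grid_jordan = grid +
  fixes lam :: "nat \<Rightarrow> nat" and \<zeta> :: "nat \<Rightarrow> 'b"
  assumes jordan: "jordan_basis total N {1..m} lam \<zeta>"
    and lam_antimono: "\<And>i j. 1 \<le> i \<Longrightarrow> i \<le> j \<Longrightarrow> j \<le> m \<Longrightarrow> lam j \<le> lam i"
begin

lemma lam_pos: "i \<in> {1..m} \<Longrightarrow> 0 < lam i"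
  using jordan by (simp add: jordan_basis_def)

text \<open>
Both sides are the dimension of the intersection of the kernel of \<open>N\<close> with the image of \<open>N\<^sup>r\<close>. One basis
consists of last vectors of strings, the other one of socle vectors.
\<close>

lemma card_high: "card {i \<in> {1..m}. r < lam i} = card {i \<in> {1..m}. high r i}"
proof (rule antisym)
  have \<zeta>: "\<zeta> k \<in> total" "(N ^^ lam k) (\<zeta> k) = 0" if "k \<in> {1..m}" for k
    using jordan that by (auto simp: jordan_basis_def)
  show "card {i \<in> {1..m}. r < lam i} \<le> card {i \<in> {1..m}. high r i}"
  proof (rule fam_card_le)
    let ?h = "\<lambda>k. (k, lam k - 1)"
    have "fam_indep (?h ` {i \<in> {1..m}. r < lam i}) (\<lambda>(i, j). (N ^^ j) (\<zeta> i))"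
    proof (rule fam_indep_subset)
      show "fam_indep (strings {1..m} lam) (\<lambda>(i, j). (N ^^ j) (\<zeta> i))"
        using jordan by (simp add: jordan_basis_def)
    qed auto
    from fam_indep_reindex[OF _ this]
    show "fam_indep {i \<in> {1..m}. r < lam i} (\<lambda>k. (N ^^ (lam k - 1)) (\<zeta> k))"
      by (simp add: inj_on_def)
    fix k assume k: "k \<in> {i \<in> {1..m}. r < lam i}"
    let ?z = "(N ^^ (lam k - 1 - r)) (\<zeta> k)"
    have "(N ^^ r) ?z = (N ^^ (r + (lam k - 1 - r))) (\<zeta> k)" by (simp add: funpow_add)
    also have "r + (lam k - 1 - r) = lam k - 1" using k by auto
    finally have e: "(N ^^ r) ?z = (N ^^ (lam k - 1)) (\<zeta> k)" .
    have "N ((N ^^ (lam k - 1)) (\<zeta> k)) = (N ^^ Suc (lam k - 1)) (\<zeta> k)" by simp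
    also have "\<dots> = 0" using k \<zeta>(2)[of k] by simp
    finally have "(N ^^ r) ?z \<in> span (soc ` {i \<in> {1..m}. high r i})"
      using k \<zeta>(1) by (intro kernel_image funpow_total) (simp_all only: e, auto)
    then show "(N ^^ (lam k - 1)) (\<zeta> k) \<in> span (soc ` {i \<in> {1..m}. high r i})"
      by (simp only: e)
  qed auto
  show "card {i \<in> {1..m}. high r i} \<le> card {i \<in> {1..m}. r < lam i}"
  proof (rule fam_card_le)
    show "fam_indep {i \<in> {1..m}. high r i} soc"
      by (rule fam_indep_subset[OF _ _ fam_indep_soc]) auto
    fix i assume i: "i \<in> {i \<in> {1..m}. high r i}"
    then obtain w where "w \<in> total" "soc i = (N ^^ r) w" by (auto simp: high_def)
    then show "soc i \<in> span ((\<lambda>k. (N ^^ (lam k - 1)) (\<zeta> k)) ` {i \<in> {1..m}. r < lam i})"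
      using i N_soc[of i] by (intro jordan_basis_socle[OF N_lin_total _ jordan]) auto
  qed auto
qed

text \<open>
For fixed \<open>r\<close>, both conditions define initial segments of \<open>{1..m}\<close>, and these have the same size.
\<close>

lemma high_iff:
  assumes i: "i \<in> {1..m}"
  shows "high r i \<longleftrightarrow> r < lam i"
proof -
  let ?A = "{i \<in> {1..m}. r < lam i}" and ?B = "{i \<in> {1..m}. high r i}"
  have "?A \<subseteq> ?B \<or> ?B \<subseteq> ?A"
  proof (rule ccontr)
    assume "\<not> ?thesis"
    then obtain i j where ij: "i \<in> ?A" "\<not> high r i" "j \<in> ?B" "\<not> r < lam j" by blast
    show False
    proof (cases "i \<le> j")
      case True
      then show ?thesis using ij high_antimono[of i j r] by auto
    next
      case False
      then show ?thesis using ij lam_antimono[of j i] by auto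
    qed
  qed
  then have "?A = ?B" using card_high[of r] card_subset_eq[of ?B ?A] card_subset_eq[of ?A ?B] by auto
  then show ?thesis using i by blast
qed

lemma lam_le:
  assumes "i \<in> {1..m}"
  shows "i + lam i \<le> m + n"
proof -
  have "high (lam i - 1) i" using high_iff[OF assms, of "lam i - 1"] lam_pos[OF assms] by simp
  then obtain y where y: "y \<in> layer (i + (lam i - 1))" "(N ^^ (lam i - 1)) y = soc i"
    using high_layer assms by blast
  have "y \<noteq> 0" using y(2) soc_nonzero[OF assms] lin_on_zero[OF lin_on_funpow[OF N_lin]] by auto
  then show ?thesis using layer_eq_0[OF y(1)] lam_pos[OF assms] by force
qed

text \<open>
The strings are independent because their last vectors are distinct socle vectors, and there are as many vectors
in them as in the given basis of strings.
\<close>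

lemma strings_jordan:
  assumes y: "\<And>i. i \<in> {1..m} \<Longrightarrow> y i \<in> total"
    and s: "\<And>i. i \<in> {1..m} \<Longrightarrow> (N ^^ (lam i - 1)) (y i) = soc (\<tau> i)"
    and \<tau>: "inj_on \<tau> {1..m}" "\<tau> ` {1..m} \<subseteq> {1..m}"
  shows "jordan_basis total N {1..m} lam y"
proof -
  have zero: "(N ^^ lam i) (y i) = 0" if i: "i \<in> {1..m}" for i
  proof -
    have "(N ^^ Suc (lam i - 1)) (y i) = N (soc (\<tau> i))" using s[OF i] by simp
    also have "\<dots> = 0" using subsetD[OF \<tau>(2) imageI[OF i]] by (intro N_soc) auto
    finally show ?thesis using lam_pos[OF i] by simp
  qed
  have "fam_indep (\<tau> ` {1..m}) soc"
    by (rule fam_indep_subset[OF _ _ fam_indep_soc]) (use \<tau> in auto)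
  from fam_indep_reindex[OF \<tau>(1) this]
  have "fam_indep {1..m} (\<lambda>i. (N ^^ (lam i - 1)) (y i))"
    using s by (subst fam_indep_cong[of _ _ "\<lambda>i. soc (\<tau> i)"]) auto
  then have ind: "fam_indep (strings {1..m} lam) (\<lambda>(i, j). (N ^^ j) (y i))"
    using y zero lam_pos by (intro strings_indep[OF N_lin_total]) auto
  have tot: "span ((\<lambda>(i, j). (N ^^ j) (\<zeta> i)) ` strings {1..m} lam) = total"
    using jordan by (simp add: jordan_basis_def)
  have "span ((\<lambda>(i, j). (N ^^ j) (y i)) ` strings {1..m} lam) =
      span ((\<lambda>(i, j). (N ^^ j) (\<zeta> i)) ` strings {1..m} lam)"
  proof (rule fam_span_eq[OF _ _ ind])
    show "(\<lambda>(i, j). (N ^^ j) (y i)) x \<in> span ((\<lambda>(i, j). (N ^^ j) (\<zeta> i)) ` strings {1..m} lam)"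
      if "x \<in> strings {1..m} lam" for x
      unfolding tot using that y by (auto intro!: funpow_total)
  qed auto
  then show ?thesis using ind y zero lam_pos tot by (auto simp: jordan_basis_def)
qed

lemma sum_lam: "(\<Sum>i=1..m. lam i) = m * n"
proof -
  let ?G = "{1..m} \<times> {1..n}" and ?g = "\<lambda>(i, j). v i j" and ?e = "\<lambda>(i, j). (N ^^ j) (\<zeta> i)"
  have g: "fam_indep ?G ?g"
    unfolding fam_indep_def
  proof (intro allI impI ballI)
    fix c x assume c: "(\<Sum>x\<in>?G. c x *s ?g x) = 0" "x \<in> ?G"
    obtain i j where ij: "x = (i, j)" by (cases x)
    have "0 = coef i j (\<Sum>x\<in>?G. c x *s ?g x)" using c by (simp add: coef_zero)
    also have "\<dots> = (\<Sum>y\<in>?G. if y = x then c x else 0)"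
      unfolding coef_sum coef_scale ij
      by (intro sum.cong) (auto simp: coef_v split: if_splits)
    also have "\<dots> = c x" using c by simp
    finally show "c x = 0" by simp
  qed
  have "{v i j |i j. i \<in> {1..m} \<and> j \<in> {1..n}} = ?g ` ?G" by (auto simp: image_iff) blast
  then have tg: "span (?g ` ?G) = total" by (simp add: total_def)
  have e: "fam_indep (strings {1..m} lam) ?e" and te: "span (?e ` strings {1..m} lam) = total"
    using jordan by (auto simp: jordan_basis_def)
  have "card ?G \<le> card (strings {1..m} lam)"
  proof (rule fam_card_le[OF _ _ g, of _ ?e])
    show "?g x \<in> span (?e ` strings {1..m} lam)" if "x \<in> ?G" for x
      unfolding te using that by (auto intro!: v_total)
  qed auto
  moreover have "card (strings {1..m} lam) \<le> card ?G"
  proof (rule fam_card_le[OF _ _ e, of _ ?g])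
    show "?e x \<in> span (?g ` ?G)" if "x \<in> strings {1..m} lam" for x
      unfolding tg te[symmetric] using that by (intro span_base imageI)
  qed auto
  moreover have "card (strings {1..m} lam) = (\<Sum>i=1..m. lam i)" by simp
  ultimately show ?thesis by simp
qed

text \<open>
The vectors of a homogeneous basis of strings that lie in layer \<open>k\<close> are independent, which gives one inequality for every
layer. Summed over all layers, both sides become \<open>m * n\<close>, so equality holds in each.
\<close>

lemma card_strings_through_layer:
  assumes k: "k \<in> {1..m + n - 1}"
  shows "card {i \<in> {1..m}. i \<le> k \<and> k < i + lam i} = card {i \<in> {1..m}. i \<le> k \<and> k + 1 \<le> n + i}"
proof -
  have "\<exists>y. y \<in> layer (i + (lam i - 1)) \<and> (N ^^ (lam i - 1)) y = soc i" if i: "i \<in> {1..m}" for i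
  proof -
    have "high (lam i - 1) i" using high_iff[OF i, of "lam i - 1"] lam_pos[OF i] by simp
    then show ?thesis using high_layer[OF i] by blast
  qed
  then obtain y where y: "\<And>i. i \<in> {1..m} \<Longrightarrow> y i \<in> layer (i + (lam i - 1))"
    "\<And>i. i \<in> {1..m} \<Longrightarrow> (N ^^ (lam i - 1)) (y i) = soc i" by metis
  have "jordan_basis total N {1..m} lam y"
    by (rule strings_jordan[where \<tau> = "\<lambda>i. i"]) (use y layer_total in auto)
  then have ind: "fam_indep (strings {1..m} lam) (\<lambda>(i, j). (N ^^ j) (y i))"
    by (simp add: jordan_basis_def)
  have le: "card {i \<in> {1..m}. i \<le> k \<and> k < i + lam i} \<le> card {i \<in> {1..m}. i \<le> k \<and> k + 1 \<le> n + i}"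
    (is "card (?S k) \<le> card (?L k)") for k
  proof (rule fam_card_le)
    let ?h = "\<lambda>i. (i, i + lam i - 1 - k)"
    have "fam_indep (?h ` ?S k) (\<lambda>(i, j). (N ^^ j) (y i))"
      by (rule fam_indep_subset[OF _ _ ind]) auto
    from fam_indep_reindex[OF _ this]
    show "fam_indep (?S k) (\<lambda>i. (N ^^ (i + lam i - 1 - k)) (y i))" by (simp add: inj_on_def)
    fix i assume i: "i \<in> ?S k"
    then have "(N ^^ (i + lam i - 1 - k)) (y i) \<in> layer (i + (lam i - 1) - (i + lam i - 1 - k))"
      by (intro funpow_layer y) auto
    also have "i + (lam i - 1) - (i + lam i - 1 - k) = k" using i by auto
    finally show "(N ^^ (i + lam i - 1 - k)) (y i) \<in> span ((\<lambda>i. v i (k + 1 - i)) ` ?L k)"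
      unfolding layer_span_line .
  qed auto
  \<comment> \<open>double counting: sum over the layers, then over the strings or rows\<close>
  let ?K = "{1..m + n - 1}"
  have sw: "(\<Sum>k\<in>?K. card {i \<in> {1..m}. P i k}) = (\<Sum>i=1..m. card {k \<in> ?K. P i k})" for P
  proof -
    have c: "card {x \<in> A. Q x} = (\<Sum>x\<in>A. if Q x then 1 else 0)" if "finite A" for A :: "nat set" and Q
      using that by (simp add: sum.inter_filter[symmetric])
    show ?thesis unfolding c[OF finite_atLeastAtMost] by (rule sum.swap)
  qed
  have "(\<Sum>k\<in>?K. card (?S k)) = (\<Sum>i=1..m. lam i)"
    unfolding sw
  proof (rule sum.cong[OF refl])
    fix i assume i: "i \<in> {1..m}"
    then have "{k \<in> ?K. i \<le> k \<and> k < i + lam i} = {i..<i + lam i}"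
      using lam_le[OF i] by auto
    then show "card {k \<in> ?K. i \<le> k \<and> k < i + lam i} = lam i" by simp
  qed
  moreover have "(\<Sum>k\<in>?K. card (?L k)) = (\<Sum>i=1..m. n)"
    unfolding sw
  proof (rule sum.cong[OF refl])
    fix i assume i: "i \<in> {1..m}"
    then have "{k \<in> ?K. i \<le> k \<and> k + 1 \<le> n + i} = {i..<i + n}" by auto
    then show "card {k \<in> ?K. i \<le> k \<and> k + 1 \<le> n + i} = n" by simp
  qed
  ultimately have "(\<Sum>k\<in>?K. card (?S k)) = (\<Sum>k\<in>?K. card (?L k))" using sum_lam by simp
  then show ?thesis by (rule sum_mono_inv) (use le k in auto)
qed

text \<open>
The string that ends in \<open>soc i\<close> starts in layer \<open>m + n - \<sigma> i\<close>.
\<close>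

definition \<sigma> :: "nat \<Rightarrow> nat"
  where "\<sigma> i = m + n + 1 - i - lam i"

lemma \<sigma>_lam: "i \<in> {1..m} \<Longrightarrow> \<sigma> i + lam i + i = m + n + 1"
  using lam_le[of i] by (simp add: \<sigma>_def)

text \<open>
For \<open>t \<le> m\<close> the strings with \<open>\<sigma> i \<le> t\<close> are those that pass through layer \<open>m + n - t\<close>, which has dimension \<open>t\<close>.
\<close>

lemma \<sigma>_layered:
  shows "bij_betw \<sigma> {1..m} {1..m}"
    and "i \<le> m \<Longrightarrow> i = 0 \<or> i = m \<or> \<sigma> i \<le> \<sigma> (Suc i) \<Longrightarrow> \<sigma> ` {1..i} = {1..i}"
proof -
  have 1: "card {i \<in> {1..m}. \<sigma> i \<le> t} = t" if t: "t \<in> {1..m}" for t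
  proof -
    have e: "{i \<in> {1..m}. \<sigma> i \<le> t} = {i \<in> {1..m}. i \<le> m + n - t \<and> m + n - t < i + lam i}"
    proof (rule Collect_cong, rule conj_cong[OF refl])
      fix i assume i: "i \<in> {1..m}"
      then show "\<sigma> i \<le> t \<longleftrightarrow> i \<le> m + n - t \<and> m + n - t < i + lam i"
        using \<sigma>_lam[OF i] t m_le_n by auto
    qed
    have "card {i \<in> {1..m}. \<sigma> i \<le> t} = card {i \<in> {1..m}. i \<le> m + n - t \<and> m + n - t + 1 \<le> n + i}"
      unfolding e by (rule card_strings_through_layer) (use t m_le_n in auto)
    also have "{i \<in> {1..m}. i \<le> m + n - t \<and> m + n - t + 1 \<le> n + i} = {m - t + 1..m}"
      using t m_le_n by auto
    finally show ?thesis using t by simp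
  qed
  have 2: "1 \<le> \<sigma> i" if "i \<in> {1..m}" for i
    using lam_le[OF that] by (simp add: \<sigma>_def)
  have 3: "\<sigma> i \<le> \<sigma> (Suc i) + 1" if "1 \<le> i" "i < m" for i
    using \<sigma>_lam[of i] \<sigma>_lam[of "Suc i"] lam_antimono[of i "Suc i"] that by auto
  note L = layered_permutation[of m \<sigma>, OF 1 2 3]
  show "bij_betw \<sigma> {1..m} {1..m}" by (rule L(1))
  show "i \<le> m \<Longrightarrow> i = 0 \<or> i = m \<or> \<sigma> i \<le> \<sigma> (Suc i) \<Longrightarrow> \<sigma> ` {1..i} = {1..i}" by (rule L(2))
qed

text \<open>
A nonzero kernel vector would give a string that ends in a layer \<open>i > b\<close> and starts in layer \<open>m + n - b\<close> or above, so that
\<open>\<sigma> i \<le> b\<close>. This is impossible as \<open>\<sigma>\<close> permutes \<open>{1..b}\<close>. Both layers have dimension \<open>b\<close>.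
\<close>

lemma bij_middle:
  assumes b: "1 \<le> b" "b \<le> m" "\<sigma> ` {1..b} = {1..b}"
  shows "bij_betw (N ^^ (m + n - 2 * b)) (layer (m + n - b)) (layer b)"
proof -
  let ?r = "m + n - 2 * b" and ?k = "m + n - b"
  have kr: "?k - ?r = b" using b m_le_n by simp
  have zero: "z = 0" if z: "z \<in> layer ?k" "(N ^^ ?r) z = 0" for z
  proof (rule funpow_inj_layer[OF z])
    fix s i assume s: "s < ?r" "i \<in> {1..m}" "i + s = ?k"
    then have "i \<notin> {1..b}" by auto
    moreover have "inj_on \<sigma> {1..m}" using \<sigma>_layered(1) by (simp add: bij_betw_def)
    ultimately have "\<sigma> i \<notin> \<sigma> ` {1..b}" using s b by (subst inj_on_image_mem_iff) auto
    moreover have "\<sigma> i \<in> {1..m}" using \<sigma>_layered(1) s(2) by (auto simp: bij_betw_def)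
    ultimately have "b < \<sigma> i" using b by auto
    then show "\<not> high s i" using high_iff[OF s(2)] \<sigma>_lam[OF s(2)] s by auto
  qed
  have sub: "x - y \<in> layer ?k" if "x \<in> layer ?k" "y \<in> layer ?k" for x y
    using subspace_diff[OF subspace_layer] that .
  have inj: "inj_on (N ^^ ?r) (layer ?k)"
    using zero sub by (intro inj_onI) (metis funpow_linear(2) right_minus_eq)
  have into: "(N ^^ ?r) z \<in> layer b" if "z \<in> layer ?k" for z
    using funpow_layer[OF that, of ?r] kr by simp
  let ?A = "{i \<in> {1..m}. i \<le> ?k \<and> ?k + 1 \<le> n + i}" and ?B = "{i \<in> {1..m}. i \<le> b \<and> b + 1 \<le> n + i}"
  let ?e = "\<lambda>i. v i (?k + 1 - i)"
  have cA: "?A = {m - b + 1..m}" and cB: "?B = {1..b}" using b m_le_n by auto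
  have eA: "?e i \<in> layer ?k" if "i \<in> ?A" for i
    unfolding layer_span_line[of ?k] using that by (intro span_base imageI)
  have sum: "(N ^^ ?r) (\<Sum>i\<in>?A. c i *s ?e i) = (\<Sum>i\<in>?A. c i *s (N ^^ ?r) (?e i))" for c
    by (rule lin_on_sum[OF lin_on_funpow[OF N_lin]]) simp
  have lay: "(\<Sum>i\<in>?A. c i *s ?e i) \<in> layer ?k" for c
    by (rule line_layer) auto
  have "fam_indep ?A (\<lambda>i. (N ^^ ?r) (?e i))"
    unfolding fam_indep_def
  proof (intro allI impI ballI)
    fix c i assume c: "(\<Sum>i\<in>?A. c i *s (N ^^ ?r) (?e i)) = 0" "i \<in> ?A"
    then have "(\<Sum>i\<in>?A. c i *s ?e i) = 0" using zero[OF lay] sum by simp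
    then have "0 = coef i (?k + 1 - i) (\<Sum>i\<in>?A. c i *s ?e i)" by (simp only: coef_zero)
    also have "\<dots> = (if i \<in> ?A \<and> i + (?k + 1 - i) = ?k + 1 then c i else 0)"
      by (rule coef_line) auto
    also have "\<dots> = c i" using c(2) by auto
    finally show "c i = 0" ..
  qed
  then have spn: "span ((\<lambda>i. (N ^^ ?r) (?e i)) ` ?A) = span ((\<lambda>i. v i (b + 1 - i)) ` ?B)"
  proof (rule fam_span_eq[rotated 2])
    show "card ?B \<le> card ?A" unfolding cA cB using b by simp
    show "(N ^^ ?r) (?e i) \<in> span ((\<lambda>i. v i (b + 1 - i)) ` ?B)" if "i \<in> ?A" for i
      unfolding layer_span_line[symmetric] by (rule into[OF eA[OF that]])
  qed auto
  have fA: "finite ?A" by simp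
  have "layer b \<subseteq> (N ^^ ?r) ` layer ?k"
  proof
    fix z assume "z \<in> layer b"
    then have "z \<in> span ((\<lambda>i. (N ^^ ?r) (?e i)) ` ?A)"
      unfolding spn layer_span_line[symmetric] .
    then obtain c where c: "z = (\<Sum>i\<in>?A. c i *s (N ^^ ?r) (?e i))"
      using fam_spanE[OF fA] by blast
    show "z \<in> (N ^^ ?r) ` layer ?k" unfolding c sum[symmetric] by (rule imageI[OF lay])
  qed
  then show ?thesis using inj into by (auto simp: bij_betw_def)
qed

text \<open>
A maximal interval \<open>{a+1..b}\<close> on which \<open>lam\<close> has the constant value \<open>l\<close>.
\<close>

definition block :: "nat \<Rightarrow> nat \<Rightarrow> nat \<Rightarrow> bool"
  where "block a b l \<longleftrightarrow> a < b \<and> b \<le> m \<and> (\<forall>k\<in>{a+1..b}. lam k = l) \<and>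
    (a = 0 \<or> lam a \<noteq> l) \<and> (b = m \<or> lam (Suc b) \<noteq> l)"

lemma block_facts:
  assumes "block a b l"
  shows "a < b" "b \<le> m" "\<sigma> ` {1..b} = {1..b}"
    and "k \<in> {a+1..b} \<Longrightarrow> \<sigma> k + k = a + b + 1" and "l + a + b = m + n" and "0 < l"
    and "k \<in> {a+1..b} \<Longrightarrow> lam k = l"
proof -
  note B = assms[unfolded block_def]
  show ab: "a < b" "b \<le> m" using B by auto
  note L = layered_block[of \<sigma> m lam "m + n" a b l, OF \<sigma>_layered(1) _ \<sigma>_lam _ ab]
  have const: "\<And>k. k \<in> {a+1..b} \<Longrightarrow> lam k = l" and a: "a = 0 \<or> lam a \<noteq> l" and b: "b = m \<or> lam (Suc b) \<noteq> l"
    using B by blast+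
  show "\<sigma> ` {1..b} = {1..b}"
    by (rule L(1)[OF _ _ _ const a b]) (use \<sigma>_layered(2) lam_antimono in blast)+
  show "\<sigma> k + k = a + b + 1" if k: "k \<in> {a+1..b}"
    by (rule L(2)[OF _ _ _ const a b k]) (use \<sigma>_layered(2) lam_antimono in blast)+
  show "l + a + b = m + n"
    by (rule L(3)[OF _ _ _ const a b]) (use \<sigma>_layered(2) lam_antimono in blast)+
  show "0 < l" using B lam_pos[of b] by auto
  show "k \<in> {a+1..b} \<Longrightarrow> lam k = l" using B by blast
qed

lemma block_bij:
  assumes "block a b l"
  shows "bij_betw (N ^^ (m + n - 2 * b)) (layer (m + n - b)) (layer b)"
  using block_facts[OF assms] by (intro bij_middle) auto

lemma block_top:
  assumes "block a b l"
  obtains y where "y \<in> layer (m + n - a - 1)" "(N ^^ (l - 1)) y = soc b"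
proof -
  note B = block_facts[OF assms]
  have b: "b \<in> {1..m}" "lam b = l" using B(1,2) B(7)[of b] by auto
  then have "high (l - 1) b" using high_iff[of b "l - 1"] B(6) by simp
  moreover have "b + (l - 1) = m + n - a - 1" using B(5,6) by auto
  ultimately show thesis using high_layer[OF b(1)] that by metis
qed

text \<open>
The layers involved all lie above \<open>m\<close>, where \<open>N\<close> has no kernel.
\<close>

lemma upper_inj:
  assumes "a < b" "b \<le> m"
  shows "inj_on (N ^^ (b - a - 1)) (layer (m + n - a - 1))"
proof (rule inj_onI)
  fix x y assume xy: "x \<in> layer (m + n - a - 1)" "y \<in> layer (m + n - a - 1)"
    "(N ^^ (b - a - 1)) x = (N ^^ (b - a - 1)) y"
  have "x - y = 0"
  proof (rule funpow_inj_layer)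
    show "x - y \<in> layer (m + n - a - 1)" using subspace_diff[OF subspace_layer] xy by blast
    show "(N ^^ (b - a - 1)) (x - y) = 0" using xy by (simp add: funpow_linear)
  qed (use assms m_le_n in auto)
  then show "x = y" by simp
qed

text \<open>
The two signs, from the definition of the generator and from \<open>shift_funpow_soc\<close>, cancel.
\<close>

lemma shifted_generator:
  assumes y: "y \<in> total" "(N ^^ r) y = soc b" and t: "t < b" "b \<le> m"
  shows "(N ^^ r) ((-1) ^ t *s (shift ^^ t) y) = soc (b - t)"
proof -
  have "(N ^^ r) ((-1) ^ t *s (shift ^^ t) y) = (-1) ^ t *s ((-1) ^ t *s soc (b - t))"
    unfolding funpow_scale funpow_shift_funpow[OF y(1)] y(2) shift_funpow_soc[OF t] ..
  also have "\<dots> = soc (b - t)" by (simp add: power_mult_distrib[symmetric])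
  finally show ?thesis .
qed

end

section \<open>The tensor product as a grid\<close>

lemma bilinear_pure_tensor: "bilinear_on s A t B tensor_scale (pure_tensor s A t B)"
  unfolding bilinear_on_def
  by (intro conjI ballI allI ext)
     (auto simp: pure_tensor_def tensor_scale_def bilinear_on_def[of s A t B "(*)"])

lemma linear_space_tensor: "linear_space tensor_scale"
  by (simp add: linear_space_def vector_space_tensor_scale)

lemma lin_on_aug_tensor: "linear_space.lin_on tensor_scale UNIV (aug (tensor_mod s M t M') g)"
proof -
  interpret linear_space tensor_scale by (rule linear_space_tensor)
  show ?thesis
    unfolding lin_on_def by (auto simp: tensor_mod_def tensor_scale_def fun_eq_iff algebra_simps)
qed

text \<open>
The vectors \<open>v i j\<close> have a dual family because elements of the tensor space are functions on bilinear forms: \<open>coef i j\<close>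
is evaluation at the form that multiplies the coordinate of \<open>u i\<close> in the first argument with the coordinate of \<open>w j\<close> in
the second one, after undoing the twist by \<open>g\<^sup>n\<^sup>-\<^sup>i\<close>. This twist is also what makes \<open>N\<close> act so simply on the grid,
since \<open>g (g\<^sup>n\<^sup>-\<^sup>i w j)\<close> is the second factor that belongs to \<open>i - 1\<close>.
\<close>

lemma tensor_grid:
  fixes s :: "'f::field \<Rightarrow> 'v::ab_group_add \<Rightarrow> 'v" and G :: "('g, 'h) monoid_scheme"
    and A B :: "('g, 'v) gmod"
  assumes A: "cyclic_module G g s A" and B: "cyclic_module G g s B"
    and mn: "1 \<le> m" "m \<le> n"
    and u: "basis_of s {1..m} u (vspace A)" "gact A g (u 1) = u 1"
      "\<And>i. 1 < i \<Longrightarrow> i \<le> m \<Longrightarrow> gact A g (u i) = u (i - 1) + u i"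
    and w: "basis_of s {1..n} w (vspace B)" "gact B g (w 1) = w 1"
      "\<And>i. 1 < i \<Longrightarrow> i \<le> n \<Longrightarrow> gact B g (w i) = w (i - 1) + w i"
    and v: "v = (\<lambda>i j. if 1 \<le> i \<and> 1 \<le> j
      then pure_tensor s (vspace A) s (vspace B) (u i) (gact B (g [^]\<^bsub>G\<^esub> (n - i)) (w j)) else 0)"
  obtains coef where "grid tensor_scale m n v coef (aug (tensor_mod s A s B) g)"
    and "TS.span {v i j |i j. i \<in> {1..m} \<and> j \<in> {1..n}} = vspace (tensor_mod s A s B)"
proof -
  interpret A: cyclic_module G g s A by (rule A)
  interpret B: cyclic_module G g s B by (rule B)
  interpret T: linear_space tensor_scale by (rule linear_space_tensor)
  let ?p = "pure_tensor s (vspace A) s (vspace B)" and ?T = "tensor_mod s A s B"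
  let ?h = "\<lambda>i. g [^]\<^bsub>G\<^esub> (n - i)"
  have h: "?h i \<in> carrier G" for i using A.g by simp
  have hi: "inv\<^bsub>G\<^esub> (?h i) \<in> carrier G" for i using h by simp
  have u': "inj_on u {1..m}" "A.independent (u ` {1..m})" "A.span (u ` {1..m}) = vspace A"
    using u(1) by (auto simp: basis_of_def)
  have w': "inj_on w {1..n}" "A.independent (w ` {1..n})" "A.span (w ` {1..n}) = vspace B"
    using w(1) by (auto simp: basis_of_def)
  have uV: "u i \<in> vspace A" if "i \<in> {1..m}" for i
    unfolding u'(3)[symmetric] using that by (intro A.span_base imageI)
  have wV: "w i \<in> vspace B" if "i \<in> {1..n}" for i
    unfolding w'(3)[symmetric] using that by (intro A.span_base imageI)
  have gV: "gact B x z \<in> vspace B" if "x \<in> carrier G" "z \<in> vspace B" for x z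
    using that by (rule B.module_rules(2))
  have bil: "?p (x + x') z = ?p x z + ?p x' z" "?p x (z + z') = ?p x z + ?p x z'"
    "?p (s c x) z = c *\<^sub>T ?p x z" "?p x (s c z) = c *\<^sub>T ?p x z"
    if "x \<in> vspace A" "x' \<in> vspace A" "z \<in> vspace B" "z' \<in> vspace B" for x x' z z' c
    using bilinear_pure_tensor[of s "vspace A" s "vspace B"] that unfolding bilinear_on_def by metis+
  have zV: "0 \<in> vspace A" "0 \<in> vspace B"
    using A.subspace_0[OF A.module_rules(1)] A.subspace_0[OF B.module_rules(1)] by auto
  have bil0: "?p 0 z = 0" "?p x 0 = 0" if "x \<in> vspace A" "z \<in> vspace B" for x z
    using bil(3)[of x x z z 0] bil(4)[of x x z z 0] that by simp_all

  define ru where "ru = A.representation (u ` {1..m})"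
  define rw where "rw = A.representation (w ` {1..n})"
  have ru: "ru (x + x') e = ru x e + ru x' e" "ru (s c x) e = c * ru x e"
    if "x \<in> vspace A" "x' \<in> vspace A" for x x' c e
    using that unfolding ru_def u'(3)[symmetric]
    by (simp_all only: A.representation_add[OF u'(2)] A.representation_scale[OF u'(2)])
  have rw: "rw (x + x') e = rw x e + rw x' e" "rw (s c x) e = c * rw x e"
    if "x \<in> vspace B" "x' \<in> vspace B" for x x' c e
    using that unfolding rw_def w'(3)[symmetric]
    by (simp_all only: A.representation_add[OF w'(2)] A.representation_scale[OF w'(2)])
  have ru_basis: "ru (u i) (u i') = (if i' = i then 1 else 0)" if "i \<in> {1..m}" "i' \<in> {1..m}" for i i'
    using that inj_onD[OF u'(1), of i i'] unfolding ru_def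
    by (subst A.representation_basis[OF u'(2)]) auto
  have rw_basis: "rw (w i) (w i') = (if i' = i then 1 else 0)" if "i \<in> {1..n}" "i' \<in> {1..n}" for i i'
    using that inj_onD[OF w'(1), of i i'] unfolding rw_def
    by (subst A.representation_basis[OF w'(2)]) auto
  define \<beta> where "\<beta> i j = (\<lambda>x z. ru x (u i) * rw (gact B (inv\<^bsub>G\<^esub> (?h i)) z) (w j))" for i j
  have \<beta>_bil: "bilinear_on s (vspace A) s (vspace B) (*) (\<beta> i j)" for i j
    unfolding bilinear_on_def \<beta>_def
    using B.module_rules(2)[OF hi] B.module_rules(3)[OF hi] B.module_rules(4)[OF hi]
    by (simp add: ru rw algebra_simps)
  define coef where "coef i j z = (if i \<in> {1..m} \<and> j \<in> {1..n} then z (\<beta> i j) else 0)"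
    for i j and z :: "('f, 'v, 'v) tensor"
  have coef_v: "coef i' j' (v i j) = (if i' = i \<and> j' = j then 1 else 0)"
    if ij: "i \<in> {1..m}" "j \<in> {1..n}" for i j i' j'
  proof (cases "i' \<in> {1..m} \<and> j' \<in> {1..n}")
    case True
    have "coef i' j' (v i j) = \<beta> i' j' (u i) (gact B (?h i) (w j))"
      using True ij \<beta>_bil by (simp add: coef_def v pure_tensor_def)
    also have "\<dots> = (if i' = i \<and> j' = j then 1 else 0)"
    proof (cases "i' = i")
      case True': True
      have "gact B (inv\<^bsub>G\<^esub> (?h i)) (gact B (?h i) (w j)) = gact B (inv\<^bsub>G\<^esub> (?h i) \<otimes>\<^bsub>G\<^esub> ?h i) (w j)"
        using B.module_rules(6)[OF hi h wV[OF ij(2)]] by simp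
      also have "\<dots> = w j" using h wV[OF ij(2)] by (simp add: B.module_rules(5))
      finally have e: "gact B (inv\<^bsub>G\<^esub> (?h i)) (gact B (?h i) (w j)) = w j" .
      then show ?thesis
        using True' ij True by (simp add: \<beta>_def e ru_basis rw_basis del: atLeastAtMost_iff)
    next
      case False
      then show ?thesis
        using ij True by (simp add: \<beta>_def ru_basis del: atLeastAtMost_iff)
    qed
    finally show ?thesis .
  qed (use ij in \<open>auto simp: coef_def\<close>)
  have N_v: "aug ?T g (v i j) = v (i - 1) j + v i (j - 1)" if ij: "i \<in> {1..m}" "j \<in> {1..n}" for i j
  proof -
    let ?y = "gact B (?h i) (w j)"
    have yV: "?y \<in> vspace B" by (rule gV[OF h wV[OF ij(2)]])
    have gyV: "gact B g ?y \<in> vspace B" by (rule gV[OF A.g yV])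
    have "gact ?T g (v i j) = ?p (gact A g (u i)) (gact B g ?y)"
      using ij gact_tensor_pure[OF A.fg B.fg A.g] by (simp add: v)
    also have "\<dots> = v (i - 1) j + ?p (u i) (gact B g ?y)"
    proof (cases "i = 1")
      case False
      then have i: "1 < i" "i \<le> m" "i - 1 \<in> {1..m}" using ij by auto
      have "gact B g ?y = gact B (g \<otimes>\<^bsub>G\<^esub> ?h i) (w j)"
        using B.module_rules(6)[OF A.g h wV[OF ij(2)]] by simp
      also have "g \<otimes>\<^bsub>G\<^esub> ?h i = ?h (i - 1)"
        using A.nat_pow_Suc2[OF A.g, of "n - i"] i mn by (simp add: Suc_diff_le)
      finally have e: "gact B g ?y = gact B (?h (i - 1)) (w j)" .
      show ?thesis
        unfolding u(3)[OF i(1,2)] bil(1)[OF uV[OF i(3)] uV[OF ij(1)] gyV gyV]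
        using i ij by (simp add: v e)
    qed (use u(2) in \<open>simp add: v\<close>)
    also have "gact B g ?y = ?y + (gact B g ?y - ?y)" by simp
    also have "?p (u i) \<dots> = ?p (u i) ?y + ?p (u i) (gact B g ?y - ?y)"
      by (rule bil(2)[OF uV[OF ij(1)] uV[OF ij(1)] yV A.subspace_diff[OF B.module_rules(1) gyV yV]])
    also have "gact B g ?y - ?y = gact B (?h i) (gact B g (w j) - w j)"
    proof -
      have gw: "gact B g (w j) \<in> vspace B" by (rule gV[OF A.g wV[OF ij(2)]])
      have "gact B g ?y = gact B (?h i) (gact B g (w j))"
      proof -
        have "g \<otimes>\<^bsub>G\<^esub> ?h i = ?h i \<otimes>\<^bsub>G\<^esub> g" using A.nat_pow_Suc2[OF A.g, of "n - i"] by simp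
        then show ?thesis
          using B.module_rules(6)[OF A.g h wV[OF ij(2)], of i] B.module_rules(6)[OF h A.g wV[OF ij(2)], of i]
          by metis
      qed
      moreover have "gact B (?h i) (gact B g (w j)) =
          gact B (?h i) (gact B g (w j) - w j) + gact B (?h i) (w j)"
        using B.module_rules(3)[OF h A.subspace_diff[OF B.module_rules(1) gw wV[OF ij(2)]] wV[OF ij(2)]] by simp
      ultimately show ?thesis by simp
    qed
    also have "?p (u i) \<dots> = v i (j - 1)"
    proof (cases "j = 1")
      case True
      have "gact B (?h i) 0 = 0" using B.module_rules(4)[OF h zV(2), of i 0] by simp
      then show ?thesis using True w(2) bil0(2)[OF uV[OF ij(1)] zV(2)] by (simp add: v)
    next
      case False
      then have "1 \<le> j - 1" "1 < j" "j \<le> n" using ij by auto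
      then show ?thesis using w(3)[of j] ij by (simp add: v)
    qed
    finally have e: "gact ?T g (v i j) = v (i - 1) j + (?p (u i) ?y + v i (j - 1))" .
    have vij: "v i j = ?p (u i) ?y" using ij by (simp add: v)
    have cancel: "X + (Y + Z) - Y = X + Z" for X Y Z :: "('f, 'v, 'v) tensor" by (simp add: algebra_simps)
    show ?thesis unfolding e unfolding vij by (rule cancel)
  qed
  have "grid tensor_scale m n v coef (aug ?T g)"
  proof unfold_locales
    show "T.lin_on UNIV (aug ?T g)" by (rule lin_on_aug_tensor)
  qed (use mn coef_v N_v in \<open>auto simp: coef_def tensor_scale_def v\<close>)
  moreover have "TS.span {v i j |i j. i \<in> {1..m} \<and> j \<in> {1..n}} = vspace ?T" (is "TS.span ?S = _")
  proof
    have vT: "vspace ?T = TS.span {?p x y |x y. x \<in> vspace A \<and> y \<in> vspace B}"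
      by (simp add: tensor_mod_def tensor_space_def)
    have "?S \<subseteq> vspace ?T"
    proof
      fix z assume "z \<in> ?S"
      then obtain i j where ij: "z = v i j" "i \<in> {1..m}" "j \<in> {1..n}" by auto
      have "z = ?p (u i) (gact B (?h i) (w j))" using ij by (simp add: v)
      then show "z \<in> vspace ?T"
        unfolding vT using uV[OF ij(2)] gV[OF h wV[OF ij(3)]] by (intro TS.span_base) blast
    qed
    then show "TS.span ?S \<subseteq> vspace ?T" unfolding vT by (intro TS.span_minimal) auto
    have p1: "?p (u i) y \<in> TS.span ?S" if i: "i \<in> {1..m}" and y: "y \<in> vspace B" for i y
    proof -
      have 1: "y \<in> vspace B \<and> ?p (u i) (gact B (?h i) y) \<in> TS.span ?S" if y: "y \<in> A.span (w ` {1..n})" for y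
        using y
      proof (induction rule: A.span_induct_alt)
        case base
        have "gact B (?h i) 0 = 0" using B.module_rules(4)[OF h zV(2), of i 0] by simp
        then show ?case using TS.span_zero zV(2) by (simp only: bil0(2)[OF uV[OF i] zV(2)] simp_thms)
      next
        case (step c x y)
        then obtain j where j: "x = w j" "j \<in> {1..n}" by auto
        have xV: "x \<in> vspace B" "y \<in> vspace B" using wV j step.IH by auto
        have cV: "s c x \<in> vspace B" using xV A.subspace_scale[OF B.module_rules(1)] by blast
        have e: "?p (u i) (gact B (?h i) (s c x + y)) =
            c *\<^sub>T ?p (u i) (gact B (?h i) x) + ?p (u i) (gact B (?h i) y)"
          unfolding B.module_rules(3)[OF h cV xV(2)] B.module_rules(4)[OF h xV(1)]
          using bil(2,4) uV[OF i] gV[OF h] xV A.subspace_scale[OF B.module_rules(1)] by simp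
        have x: "?p (u i) (gact B (?h i) x) \<in> TS.span ?S"
          using i j by (intro TS.span_base CollectI exI[of _ i] exI[of _ j]) (auto simp: v)
        show ?case
          unfolding e using A.subspace_add[OF B.module_rules(1) cV xV(2)]
            TS.span_add[OF TS.span_scale[OF x] conjunct2[OF step.IH]] by (rule conjI)
      qed
      have "y = gact B (?h i \<otimes>\<^bsub>G\<^esub> inv\<^bsub>G\<^esub> (?h i)) y" using h y by (simp add: B.module_rules(5))
      also have "\<dots> = gact B (?h i) (gact B (inv\<^bsub>G\<^esub> (?h i)) y)" by (rule B.module_rules(6)[OF h hi y])
      finally have e: "y = gact B (?h i) (gact B (inv\<^bsub>G\<^esub> (?h i)) y)" .
      have "gact B (inv\<^bsub>G\<^esub> (?h i)) y \<in> A.span (w ` {1..n})" unfolding w'(3) by (rule gV[OF hi y])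
      from 1[OF this] show ?thesis by (subst e) (rule conjunct2)
    qed
    have p2: "x \<in> vspace A \<and> ?p x y \<in> TS.span ?S" if x: "x \<in> A.span (u ` {1..m})" and y: "y \<in> vspace B" for x y
      using x
    proof (induction rule: A.span_induct_alt)
      case base
      show ?case using TS.span_zero zV(1) by (simp only: bil0(1)[OF zV(1) y] simp_thms)
    next
      case (step c a x)
      then obtain i where i: "a = u i" "i \<in> {1..m}" by auto
      have xV: "a \<in> vspace A" "x \<in> vspace A" using uV i step.IH by auto
      have cV: "s c a \<in> vspace A" using xV A.subspace_scale[OF A.module_rules(1)] by blast
      have e: "?p (s c a + x) y = c *\<^sub>T ?p a y + ?p x y"
        unfolding bil(1)[OF cV xV(2) y y] bil(3)[OF xV(1) xV(1) y y] ..
      have "?p a y \<in> TS.span ?S" unfolding i(1) by (rule p1[OF i(2) y])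
      then have "c *\<^sub>T ?p a y + ?p x y \<in> TS.span ?S"
        using step.IH by (intro TS.span_add TS.span_scale) blast+
      with A.subspace_add[OF A.module_rules(1) cV xV(2)] show ?case unfolding e by (rule conjI)
    qed
    show "vspace ?T \<subseteq> TS.span ?S"
    proof -
      have "{?p x y |x y. x \<in> vspace A \<and> y \<in> vspace B} \<subseteq> TS.span ?S"
        using p2 unfolding u'(3) by blast
      then show ?thesis unfolding vT by (intro TS.span_minimal) auto
    qed
  qed
  ultimately show thesis by (rule that)
qed

section \<open>The decomposition of the tensor product\<close>

lemma filter_upt_interval:
  assumes "1 \<le> lo" "hi \<le> M" "\<And>i. 1 \<le> i \<Longrightarrow> i < M \<Longrightarrow> P i \<longleftrightarrow> lo \<le> i \<and> i < hi"
  shows "filter P [1..<M] = [lo..<hi]"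
  using assms by (intro sorted_distinct_set_unique sorted_wrt_filter) auto

lemma level_block:
  fixes lam :: "nat \<Rightarrow> nat"
  assumes i: "i \<in> {1..m}"
    and anti: "\<And>i j. 1 \<le> i \<Longrightarrow> i \<le> j \<Longrightarrow> j \<le> m \<Longrightarrow> lam j \<le> lam i"
    and a: "a + 1 = Min {k \<in> {1..m}. lam k = lam i}"
    and b: "b = Max {k \<in> {1..m}. lam k = lam i}"
  shows "a + 1 \<le> i" "i \<le> b" "b \<le> m" "k \<in> {a+1..b} \<Longrightarrow> lam k = lam i"
    "a = 0 \<or> lam a \<noteq> lam i" "b = m \<or> lam (Suc b) \<noteq> lam i"
proof -
  let ?S = "{k \<in> {1..m}. lam k = lam i}"
  have S: "finite ?S" "i \<in> ?S" using i by auto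
  then have S': "?S \<noteq> {}" by blast
  have mem: "a + 1 \<in> ?S" "b \<in> ?S" unfolding a b using S S' Min_in Max_in by blast+
  show "a + 1 \<le> i" "i \<le> b" unfolding a b using S by (auto intro: Min_le Max_ge)
  show "b \<le> m" using mem by simp
  show "lam k = lam i" if "k \<in> {a+1..b}"
  proof (rule antisym)
    show "lam k \<le> lam i" using anti[of "a + 1" k] that mem by auto
    show "lam i \<le> lam k" using anti[of k b] that mem by auto
  qed
  have "a \<notin> ?S"
  proof
    assume "a \<in> ?S"
    then have "a + 1 \<le> a" unfolding a by (rule Min_le[OF S(1)])
    then show False by simp
  qed
  then show "a = 0 \<or> lam a \<noteq> lam i" using mem by auto
  have "Suc b \<notin> ?S"
  proof
    assume "Suc b \<in> ?S"
    then have "Suc b \<le> b" unfolding b using Max_ge[OF S(1)] by blast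
    then show False by simp
  qed
  then show "b = m \<or> lam (Suc b) \<noteq> lam i" using \<open>b \<le> m\<close> by auto
qed

lemma the_inv_into_restrict:
  assumes "bij_betw f A B" "w \<in> A"
  shows "the_inv_into A (restrict f A) (f w) = w"
proof -
  have "inj_on (restrict f A) A" using assms(1) by (simp add: bij_betw_def inj_on_def)
  from the_inv_into_f_f[OF this assms(2)] show ?thesis using assms(2) by simp
qed

theorem theorem1:
  fixes G :: "('g, 'h) monoid_scheme" and g :: 'g
    and p e q m n :: nat
    and s :: "'f::field \<Rightarrow> 'v::ab_group_add \<Rightarrow> 'v"
    and V :: "nat \<Rightarrow> ('g, 'v) gmod"
    and u w :: "nat \<Rightarrow> 'v"
    and lam a b :: "nat \<Rightarrow> nat"
    and T :: "('g, ('f, 'v, 'v) tensor) gmod"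
    and N :: "('f, 'v, 'v) tensor \<Rightarrow> ('f, 'v, 'v) tensor"
    and v :: "nat \<Rightarrow> nat \<Rightarrow> ('f, 'v, 'v) tensor"
    and D :: "nat \<Rightarrow> ('f, 'v, 'v) tensor set"
    and \<B> :: "nat \<Rightarrow> ('f, 'v, 'v) tensor list"
    and x y :: "nat \<Rightarrow> ('f, 'v, 'v) tensor"
    and S Sinv :: "nat \<Rightarrow> ('f, 'v, 'v) tensor \<Rightarrow> ('f, 'v, 'v) tensor"
    and R U :: "nat \<Rightarrow> nat \<Rightarrow> ('f, 'v, 'v) tensor \<Rightarrow> ('f, 'v, 'v) tensor"
    and coord :: "nat \<Rightarrow> ('f, 'v, 'v) tensor \<Rightarrow> nat \<Rightarrow> 'f"
  assumes char: "CHAR('f) = p" "p > 0"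
    and grp: "group G" "Coset.order G = q" "q = p ^ e" "e > 0"
      "g \<in> carrier G" "carrier G = generate G {g}"
    and vs: "vector_space s"
    and V: "\<And>i. 1 \<le> i \<Longrightarrow> i \<le> q \<Longrightarrow>
      fg_indecomposable G s (V i) \<and> vector_space.dim s (vspace (V i)) = i"
    and mn: "1 \<le> m" "m \<le> n" "n \<le> q"
    and u: "basis_of s {1..m} u (vspace (V m))" "gact (V m) g (u 1) = u 1"
      "\<And>i. 1 < i \<Longrightarrow> i \<le> m \<Longrightarrow> gact (V m) g (u i) = u (i - 1) + u i"
    and w: "basis_of s {1..n} w (vspace (V n))" "gact (V n) g (w 1) = w 1"
      "\<And>i. 1 < i \<Longrightarrow> i \<le> n \<Longrightarrow> gact (V n) g (w i) = w (i - 1) + w i"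
    and T: "T = tensor_mod s (V m) s (V n)"
    and N: "N = (\<lambda>z. gact T g z - z)"
    and v: "v = (\<lambda>i j. if 1 \<le> i \<and> 1 \<le> j
      then pure_tensor s (vspace (V m)) s (vspace (V n)) (u i) (gact (V n) (g [^]\<^bsub>G\<^esub> (n - i)) (w j))
      else 0)"
    and D: "D = (\<lambda>k. module.span tensor_scale
      {v i j |i j. i \<in> {1..m} \<and> j \<in> {1..n} \<and> i + j = k + 1})"
    and \<B>: "\<B> = (\<lambda>k. map (\<lambda>i. v i (k + 1 - i)) (filter (\<lambda>i. i \<le> k \<and> k + 1 - i \<le> n) [1..<Suc m]))"
    and coord: "coord = (\<lambda>k z i. module.representation tensor_scale (set (\<B> k)) z (v i (k + 1 - i)))"
    and x: "x = (\<lambda>i. \<Sum>j=1..i. (-1) ^ (j - 1) *\<^sub>T v j (i + 1 - j))"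
    and lam: "fg_iso G tensor_scale T (fam_scale s) (direct_sum {1..m} (\<lambda>i. V (lam i)))"
      "\<And>i. i \<in> {1..m} \<Longrightarrow> 0 < lam i \<and> lam i \<le> q"
      "\<And>i j. 1 \<le> i \<Longrightarrow> i \<le> j \<Longrightarrow> j \<le> m \<Longrightarrow> lam j \<le> lam i"
    and a: "\<And>i. i \<in> {1..m} \<Longrightarrow> a i + 1 = Min {k \<in> {1..m}. lam k = lam i}"
    and b: "\<And>i. i \<in> {1..m} \<Longrightarrow> b i = Max {k \<in> {1..m}. lam k = lam i}"
    and S: "S = (\<lambda>k. restrict (N ^^ (m + n - 2 * k)) (D (m + n - k)))"
    and Sinv: "Sinv = (\<lambda>k. the_inv_into (D (m + n - k)) (S k))"
    and R: "R = (\<lambda>a b. restrict (N ^^ (b - a - 1)) (D (m + n - a - 1)))"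
    and U: "U = (\<lambda>a b z. \<Sum>k=m - a..m.
      (\<Sum>t=k..m. (-1) ^ (t - k) * of_nat ((t - k + b - a - 2) choose (b - a - 2)) *
        coord (m + n - b) z t) *\<^sub>T v k (m + n - a - k))"
    and y1: "\<And>i. i \<in> {1..m} \<Longrightarrow> a i + 1 = b i \<Longrightarrow> y (b i) = Sinv (b i) (x (b i))"
    and y2: "\<And>i. i \<in> {1..m} \<Longrightarrow> a i + 1 < b i \<Longrightarrow> i = a i + 1 \<Longrightarrow>
      y (a i + 1) = U (a i) (b i) (Sinv (b i) (x (b i)))"
    and y3: "\<And>i. i \<in> {1..m} \<Longrightarrow> a i + 1 < b i \<Longrightarrow> a i + 2 \<le> i \<Longrightarrow> i \<le> b i \<Longrightarrow>
      y i = (-1) ^ (i - a i - 1) *\<^sub>T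
        (\<Sum>j=m - i + 1..m + a i - i + 1.
          coord (m + n - a i - 1) (y (a i + 1)) (j + i - a i - 1) *\<^sub>T v j (m + n + 1 - i - j))"
  shows
    "(\<forall>i\<in>{1..m}.
        (\<forall>k\<in>{a i + 1..b i}. lam k = m + n - a i - b i \<and> m + n - a i - b i = lam i) \<and>
        bij_betw (N ^^ (m + n - 2 * b i)) (D (m + n - b i)) (D (b i))) \<and>
     (\<forall>i\<in>{1..m}. a i + 1 = b i \<longrightarrow>
        i = b i \<and> lam i = m + n - 2 * i + 1 \<and> m + n - 2 * i + 1 = m + n - 2 * b i + 1 \<and>
        (\<exists>(d :: int) (z :: nat \<Rightarrow> nat \<Rightarrow> int).
           of_int d = d_rat (m + n - 2 * b i) (m - b i) (b i) \<and>
           (\<forall>i'\<in>{1..b i}. \<forall>j'\<in>{1..b i}.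
              of_int (z i' j') = z_rat (m + n - 2 * b i) (m - b i) (b i) i' j') \<and>
           (of_int d :: 'f) \<noteq> 0 \<and>
           is_matrix_of tensor_scale (\<B> (b i)) (\<B> (m + n - b i)) (Sinv (b i))
             (inverse (of_int d) \<cdot>\<^sub>m mat (b i) (b i) (\<lambda>(i', j'). of_int (z (i' + 1) (j' + 1)))))) \<and>
     (\<forall>i\<in>{1..m}. a i + 1 < b i \<and> i = a i + 1 \<longrightarrow>
        N ^^ (lam i - 1) \<in> D (m + n - a i - 1) \<rightarrow> D (b i) \<and>
        R (a i) (b i) \<in> D (m + n - a i - 1) \<rightarrow> D (m + n - b i) \<and>
        inj_on (R (a i) (b i)) (D (m + n - a i - 1)) \<and>
        (\<forall>z\<in>D (m + n - a i - 1). (N ^^ (lam i - 1)) z = S (b i) (R (a i) (b i) z)) \<and>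
        Sinv (b i) (x (b i)) \<in> R (a i) (b i) ` D (m + n - a i - 1) \<and>
        (\<forall>\<alpha> :: nat \<Rightarrow> 'f.
           U (a i) (b i) (\<Sum>j=m - b i + 1..m. \<alpha> j *\<^sub>T v j (m + n - b i + 1 - j)) =
           (\<Sum>k=m - a i..m.
              (\<Sum>t=k..m. (-1) ^ (t - k) * of_nat ((t - k + b i - a i - 2) choose (b i - a i - 2)) * \<alpha> t)
                *\<^sub>T v k (m + n - a i - k))) \<and>
        (\<forall>z\<in>D (m + n - a i - 1). U (a i) (b i) (R (a i) (b i) z) = z) \<and>
        (\<forall>z\<in>R (a i) (b i) ` D (m + n - a i - 1).
           U (a i) (b i) z \<in> D (m + n - a i - 1) \<and> R (a i) (b i) (U (a i) (b i) z) = z) \<and>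
        y (a i + 1) \<in> D (m + n - a i - 1)) \<and>
     (\<forall>i\<in>{1..m}. a i + 1 < b i \<and> a i + 2 \<le> i \<and> i \<le> b i \<longrightarrow>
        (\<exists>\<alpha> :: nat \<Rightarrow> 'f.
           y (a i + 1) = (\<Sum>j=m - a i..m. \<alpha> j *\<^sub>T v j (m + n - a i - j)) \<and>
           y i = (-1) ^ (i - a i - 1) *\<^sub>T
             (\<Sum>j=m - i + 1..m + a i - i + 1. \<alpha> (j + i - a i - 1) *\<^sub>T v j (m + n + 1 - i - j))) \<and>
        y i \<in> D (m + n - i)) \<and>
     (\<forall>i\<in>{1..m}.
        (N ^^ (lam i - 1)) (y i) = x (m + n - i - lam i + 1) \<and>
        fg_iso G tensor_scale (T\<lparr>vspace := fg_cyclic G tensor_scale T (y i)\<rparr>) s (V (lam i))) \<and>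
     internal_direct_sum G tensor_scale {1..m} (\<lambda>i. fg_cyclic G tensor_scale T (y i)) T"
proof -
  interpret L: linear_space s using vs by (simp add: linear_space_def)
  interpret TL: linear_space tensor_scale by (rule linear_space_tensor)
  have prime: "prime CHAR('f)" using char prime_CHAR_semidom[where ?'a = 'f] by simp
  have ordG: "Coset.order G = CHAR('f) ^ e" using grp char by simp
  have fin: "finite (carrier G)"
    using grp(2,3) char(2) by (intro card_ge_0_finite) (simp add: Coset.order_def)
  have cyc: "cyclic_group G g"
    using grp(1,5,6) fin by (simp add: cyclic_group_def cyclic_group_axioms_def)
  have Vmod: "cyclic_module G g s (V i)" if "1 \<le> i" "i \<le> q" for i
    using V[OF that] cyc L.linear_space_axioms
    by (simp add: cyclic_module_def cyclic_module_axioms_def fg_indecomposable_def)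
  have Vstring: "\<exists>z. cyclic_module.string_module g s (V i) (vspace (V i)) i z" if "1 \<le> i" "i \<le> q" for i
  proof -
    interpret VI: cyclic_module G g s "V i" by (rule Vmod[OF that])
    show ?thesis using VI.indecomposable_string[OF prime ordG] V[OF that] by metis
  qed
  have mq: "m \<le> q" and nq: "1 \<le> n" using mn by auto
  have fgT: "fg_module G tensor_scale T"
    unfolding T using Vmod[OF mn(1) mq] Vmod[OF nq mn(3)]
    by (intro fg_module_tensor_mod) (auto simp: cyclic_module_def cyclic_module_axioms_def)
  interpret CT: cyclic_module G g tensor_scale T
    using cyc fgT TL.linear_space_axioms by (simp add: cyclic_module_def cyclic_module_axioms_def)
  obtain coef where grid: "grid tensor_scale m n v coef N"
    and tot: "TS.span {v i j |i j. i \<in> {1..m} \<and> j \<in> {1..n}} = vspace T"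
    unfolding N T
    by (rule tensor_grid[OF Vmod[OF mn(1) mq] Vmod[OF nq mn(3)] mn(1,2) u w v])
  have lamq: "1 \<le> lam i" "lam i \<le> q" if "i \<in> {1..m}" for i using lam(2)[OF that] by auto
  have "\<forall>i\<in>{1..m}. \<exists>z. cyclic_module.string_module g s (V (lam i)) (vspace (V (lam i))) (lam i) z"
    using Vstring[OF lamq] by (rule ballI)
  from bchoice[OF this] obtain zV where zV: "\<And>i. i \<in> {1..m} \<Longrightarrow>
      cyclic_module.string_module g s (V (lam i)) (vspace (V (lam i))) (lam i) (zV i)"
    by blast
  obtain \<zeta> where "TL.jordan_basis (vspace T) CT.N {1..m} lam \<zeta>"
    by (rule CT.jordan_basis_of_iso[OF finite_atLeastAtMost lam(1) Vmod[OF lamq] zV])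
       (use lam(2) in auto)
  then have \<zeta>: "TL.jordan_basis (vspace T) N {1..m} lam \<zeta>" unfolding N .
  interpret GR: grid tensor_scale m n v coef N by (rule grid)
  have total: "GR.total = vspace T" unfolding GR.total_def by (rule tot)
  interpret GJ: grid_jordan tensor_scale m n v coef N lam \<zeta>
    by unfold_locales (use \<zeta> lam(3) in \<open>auto simp: total\<close>)
  have D: "D = GR.layer" unfolding D GR.layer_def ..
  have x: "x = GR.soc" unfolding x GR.soc_def ..

  have level: "a i + 1 \<le> i" "i \<le> b i" "b i \<le> m" "\<And>k. k \<in> {a i + 1..b i} \<Longrightarrow> lam k = lam i"
    "a i = 0 \<or> lam (a i) \<noteq> lam i" "b i = m \<or> lam (Suc (b i)) \<noteq> lam i" if i: "i \<in> {1..m}" for i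
    by (rule level_block[OF i lam(3) a[OF i] b[OF i]]; assumption)+
  have block: "GJ.block (a i) (b i) (lam i)" if i: "i \<in> {1..m}" for i
    unfolding GJ.block_def
  proof (intro conjI ballI)
    show "a i < b i" using level(1,2)[OF i] by simp
  qed (rule level[OF i]; assumption)+
  \<comment> \<open>The hypotheses fix \<open>y (a i + 1)\<close> through the index \<open>a i + 1\<close>, which has the same block as \<open>i\<close>.\<close>
  have same: "a k = a i \<and> b k = b i" if i: "i \<in> {1..m}" and k: "k \<in> {a i + 1..b i}" for i k
  proof -
    have k': "k \<in> {1..m}" using k level(1-3)[OF i] by auto
    have "lam k = lam i" using level(4)[OF i k] .
    then show ?thesis using a[OF i] a[OF k'] b[OF i] b[OF k'] by simp
  qed
  have sum: "lam i + a i + b i = m + n" if "i \<in> {1..m}" for i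
    using GJ.block_facts(5)[OF block[OF that]] .
  have lam_eq: "lam i = m + n - a i - b i" "m + n - a i - b i = lam i"
    "lam i - 1 = m + n - 2 * b i + (b i - a i - 1)" if i: "i \<in> {1..m}" for i
    using sum[OF i] level(1-3)[OF i] mn by auto
  have bij: "bij_betw (N ^^ (m + n - 2 * b i)) (D (m + n - b i)) (D (b i))" if "i \<in> {1..m}" for i
    unfolding D by (rule GJ.block_bij[OF block[OF that]])
  have Sinv_eq: "Sinv k = the_inv_into (D (m + n - k)) (restrict (N ^^ (m + n - 2 * k)) (D (m + n - k)))" for k
    by (simp add: Sinv S)
  note Sinv_S = the_inv_into_restrict[OF bij, folded Sinv_eq]

  have \<B>_line: "set (\<B> k) = (\<lambda>i. v i (k + 1 - i)) ` {i \<in> {1..m}. i \<le> k \<and> k + 1 \<le> n + i}" for k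
    unfolding \<B> by auto
  have coord: "coord k z i = coef i (k + 1 - i) z"
    if "z \<in> D k" "i \<in> {i \<in> {1..m}. i \<le> k \<and> k + 1 \<le> n + i}" for k z i
    unfolding coord \<B>_line using that unfolding D by (rule GR.representation_line)

  have U_coef: "U (a i) (b i) z = (\<Sum>k=m - a i..m.
      (\<Sum>t=k..m. (-1) ^ (t - k) * of_nat ((t - k + b i - a i - 2) choose (b i - a i - 2)) *
        coef t (m + n - b i + 1 - t) z) *\<^sub>T v k (m + n - a i - k))"
    if i: "i \<in> {1..m}" and z: "z \<in> D (m + n - b i)" for i z
    unfolding U
  proof (intro sum.cong refl arg_cong[where f = "\<lambda>c. c *\<^sub>T _"] arg_cong[where f = "\<lambda>c. _ * c"])
    fix k t assume "k \<in> {m - a i..m}" "t \<in> {k..m}"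
    then show "coord (m + n - b i) z t = coef t (m + n - b i + 1 - t) z"
      using level(1-3)[OF i] mn by (intro coord[OF z]) auto
  qed
  have R_eq: "R (a i) (b i) z = (N ^^ (b i - a i - 1)) z" if "z \<in> D (m + n - a i - 1)" for i z
    using that by (simp add: R)
  have R_in: "(N ^^ (b i - a i - 1)) z \<in> D (m + n - b i)" if i: "i \<in> {1..m}" and z: "z \<in> D (m + n - a i - 1)" for i z
  proof -
    have "m + n - a i - 1 - (b i - a i - 1) = m + n - b i" using level(1-3)[OF i] mn by auto
    then show ?thesis using GR.funpow_layer[of z "m + n - a i - 1" "b i - a i - 1"] z unfolding D by simp
  qed
  have U_R: "U (a i) (b i) ((N ^^ (b i - a i - 1)) z) = z"
    if i: "i \<in> {1..m}" and ab: "a i + 1 < b i" and z: "z \<in> D (m + n - a i - 1)" for i z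
    unfolding U_coef[OF i R_in[OF i z]]
    by (rule GR.alternating_inverse[OF ab level(3)[OF i]]) (use z in \<open>simp add: D\<close>)
  have S_R: "(N ^^ (lam i - 1)) z = (N ^^ (m + n - 2 * b i)) ((N ^^ (b i - a i - 1)) z)" if "i \<in> {1..m}" for i z
    unfolding lam_eq(3)[OF that] by (simp add: funpow_add)
  \<comment> \<open>A string generator exists abstractly; applying \<open>Sinv\<close> and \<open>U\<close> to \<open>x (b i)\<close> recovers it.\<close>
  have top: "\<exists>z. z \<in> D (m + n - a i - 1) \<and> (N ^^ (lam i - 1)) z = x (b i) \<and>
      Sinv (b i) (x (b i)) = (N ^^ (b i - a i - 1)) z" if i: "i \<in> {1..m}" for i
  proof -
    obtain z where z: "z \<in> D (m + n - a i - 1)" "(N ^^ (lam i - 1)) z = x (b i)"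
      using GJ.block_top[OF block[OF i]] unfolding D x by metis
    have "Sinv (b i) (x (b i)) = (N ^^ (b i - a i - 1)) z"
      unfolding z(2)[symmetric] S_R[OF i] by (rule Sinv_S[OF i R_in[OF i z(1)]])
    with z show ?thesis by blast
  qed
  have gen: "y (a i + 1) \<in> D (m + n - a i - 1) \<and> (N ^^ (lam i - 1)) (y (a i + 1)) = x (b i)"
    if i: "i \<in> {1..m}" for i
  proof -
    obtain z where z: "z \<in> D (m + n - a i - 1)" "(N ^^ (lam i - 1)) z = x (b i)"
      "Sinv (b i) (x (b i)) = (N ^^ (b i - a i - 1)) z" using top[OF i] by blast
    have "y (a i + 1) = z"
    proof (cases "a i + 1 = b i")
      case True
      then have "y (b i) = Sinv (b i) (x (b i))" by (rule y1[OF i])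
      \<comment> \<open>here the exponent of the first factor \<open>R\<close> is 0\<close>
      then show ?thesis using z(3) True by (metis add_diff_cancel_left' diff_diff_left funpow_0 cancel_comm_monoid_add_class.diff_cancel)
    next
      case False
      let ?k = "a i + 1"
      have k: "?k \<in> {a i + 1..b i}" "?k \<in> {1..m}" using level(1-3)[OF i] by auto
      have "a ?k + 1 < b ?k" "?k = a ?k + 1" using same[OF i k(1)] False level(1-3)[OF i] by auto
      from y2[OF k(2) this] have "y (a i + 1) = U (a i) (b i) (Sinv (b i) (x (b i)))"
        using same[OF i k(1)] by simp
      also have "\<dots> = z" unfolding z(3) using False level(1-3)[OF i] by (intro U_R[OF i _ z(1)]) auto
      finally show ?thesis .
    qed
    then show ?thesis using z by simp
  qed
  have y3': "y i = (-1) ^ (i - a i - 1) *\<^sub>T (\<Sum>j=m - i + 1..m + a i - i + 1.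
        coef (j + i - a i - 1) (m + n - a i - (j + i - a i - 1)) (y (a i + 1)) *\<^sub>T v j (m + n + 1 - i - j))"
    if i: "i \<in> {1..m}" and ab: "a i + 1 < b i" "a i + 2 \<le> i" for i
    unfolding y3[OF i ab level(2)[OF i]]
  proof (intro arg_cong[where f = "\<lambda>z. _ *\<^sub>T z"] sum.cong refl arg_cong[where f = "\<lambda>c. c *\<^sub>T _"])
    fix j assume j: "j \<in> {m - i + 1..m + a i - i + 1}"
    have "m + n - a i - 1 + 1 - (j + i - a i - 1) = m + n - a i - (j + i - a i - 1)"
      using level(1-3)[OF i] mn by auto
    moreover have "coord (m + n - a i - 1) (y (a i + 1)) (j + i - a i - 1) =
        coef (j + i - a i - 1) (m + n - a i - 1 + 1 - (j + i - a i - 1)) (y (a i + 1))"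
      using gen[OF i] j level(1-3)[OF i] mn by (intro coord) auto
    ultimately show "coord (m + n - a i - 1) (y (a i + 1)) (j + i - a i - 1) =
        coef (j + i - a i - 1) (m + n - a i - (j + i - a i - 1)) (y (a i + 1))" by simp
  qed
  \<comment> \<open>For \<open>i = a i + 1\<close> this is trivial, so it covers all three cases of the theorem.\<close>
  have y_shift: "y i = (-1) ^ (i - a i - 1) *\<^sub>T (GR.shift ^^ (i - a i - 1)) (y (a i + 1))"
    if i: "i \<in> {1..m}" for i
  proof (cases "i = a i + 1")
    case True
    then have "i - a i - 1 = 0" by simp
    then show ?thesis using True by simp
  next
    case False
    then have ab: "a i + 1 < b i" "a i + 2 \<le> i" using level(1-3)[OF i] by auto
    show ?thesis
      unfolding y3'[OF i ab]
      by (subst GR.shift_explicit) (use gen[OF i] level(1-3)[OF i] i in \<open>auto simp: D\<close>)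
  qed
  have y_top: "(N ^^ (lam i - 1)) (y i) = x (a i + b i + 1 - i)" if i: "i \<in> {1..m}" for i
  proof -
    have "y (a i + 1) \<in> GR.total" using gen[OF i] GR.layer_total unfolding D by blast
    moreover have "(N ^^ (lam i - 1)) (y (a i + 1)) = GR.soc (b i)" using gen[OF i] unfolding x by blast
    ultimately have "(N ^^ (lam i - 1)) (y i) = GR.soc (b i - (i - a i - 1))"
      unfolding y_shift[OF i] using level(1-3)[OF i] by (intro GJ.shifted_generator) auto
    moreover have "b i - (i - a i - 1) = a i + b i + 1 - i" using level(1-3)[OF i] by auto
    ultimately show ?thesis unfolding x by (simp only:)
  qed
  have y_layer: "y i \<in> D (m + n - i)" if i: "i \<in> {1..m}" for i
  proof -
    have "(GR.shift ^^ (i - a i - 1)) (y (a i + 1)) \<in> GR.layer (m + n - a i - 1 - (i - a i - 1))"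
      using gen[OF i] unfolding D by (intro GR.shift_funpow_layer) blast
    moreover have "m + n - a i - 1 - (i - a i - 1) = m + n - i" using level(1-3)[OF i] mn by auto
    ultimately show ?thesis
      unfolding y_shift[OF i] D by (simp add: TS.subspace_scale[OF GR.subspace_layer])
  qed
  have jordan: "TL.jordan_basis (vspace T) CT.N {1..m} lam y"
  proof -
    have \<sigma>: "GJ.\<sigma> i = a i + b i + 1 - i" if i: "i \<in> {1..m}" for i
      using GJ.block_facts(4)[OF block[OF i], of i] level(1-3)[OF i] by auto
    have "TL.jordan_basis GR.total N {1..m} lam y"
    proof (rule GJ.strings_jordan[where \<tau> = GJ.\<sigma>])
      show "y i \<in> GR.total" if "i \<in> {1..m}" for i
        using y_layer[OF that] GR.layer_total unfolding D by blast
      show "(N ^^ (lam i - 1)) (y i) = GR.soc (GJ.\<sigma> i)" if "i \<in> {1..m}" for i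
        using y_top[OF that] \<sigma>[OF that] unfolding x by simp
    qed (use GJ.\<sigma>_layered(1) in \<open>auto simp: bij_betw_def\<close>)
    then show ?thesis unfolding total N .
  qed

  have part0: "(\<forall>k\<in>{a i + 1..b i}. lam k = m + n - a i - b i \<and> m + n - a i - b i = lam i) \<and>
      bij_betw (N ^^ (m + n - 2 * b i)) (D (m + n - b i)) (D (b i))" if i: "i \<in> {1..m}" for i
    using lam_eq[OF i] level(4)[OF i] bij[OF i] by auto

  have part1: "i = b i \<and> lam i = m + n - 2 * i + 1 \<and> m + n - 2 * i + 1 = m + n - 2 * b i + 1 \<and>
      (\<exists>(d :: int) (z :: nat \<Rightarrow> nat \<Rightarrow> int).
         of_int d = d_rat (m + n - 2 * b i) (m - b i) (b i) \<and>
         (\<forall>i'\<in>{1..b i}. \<forall>j'\<in>{1..b i}.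
            of_int (z i' j') = z_rat (m + n - 2 * b i) (m - b i) (b i) i' j') \<and>
         (of_int d :: 'f) \<noteq> 0 \<and>
         is_matrix_of tensor_scale (\<B> (b i)) (\<B> (m + n - b i)) (Sinv (b i))
           (inverse (of_int d) \<cdot>\<^sub>m mat (b i) (b i) (\<lambda>(i', j'). of_int (z (i' + 1) (j' + 1)))))"
    if i: "i \<in> {1..m}" and ab: "a i + 1 = b i" for i
  proof -
    have ib: "i = b i" using level(1-3)[OF i] ab by auto
    let ?k = "b i"
    have k: "?k \<in> {1..m}" using level(1-3)[OF i] ab by auto
    have inj: "inj_on (N ^^ (m + n - 2 * ?k)) (GR.layer (m + n - ?k))"
      using bij[OF i] unfolding D by (simp add: bij_betw_def)
    obtain d z where d: "of_int d = d_rat (m + n - 2 * ?k) (m - ?k) ?k"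
      and z: "\<And>i j. i \<in> {1..?k} \<Longrightarrow> j \<in> {1..?k} \<Longrightarrow> of_int (z i j) = z_rat (m + n - 2 * ?k) (m - ?k) ?k i j"
      and d0: "(of_int d :: 'f) \<noteq> 0"
      and inverse: "\<And>j. j < ?k \<Longrightarrow> (N ^^ (m + n - 2 * ?k))
        (\<Sum>i<?k. (inverse (of_int d) * of_int (z (Suc i) (Suc j))) *\<^sub>T v (m - ?k + 1 + i) (n - i)) =
        v (Suc j) (?k - j)"
      by (rule GR.middle_inverse[OF k inj]) (rule that; (assumption | blast))
    have Bk: "\<B> ?k = map (\<lambda>i. v i (?k + 1 - i)) [1..<?k + 1]"
    proof -
      have "filter (\<lambda>i. i \<le> ?k \<and> ?k + 1 - i \<le> n) [1..<Suc m] = [1..<?k + 1]"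
        by (rule filter_upt_interval) (use k mn in auto)
      then show ?thesis by (simp add: \<B>)
    qed
    have Btop: "\<B> (m + n - ?k) = map (\<lambda>i. v i (m + n - ?k + 1 - i)) [m - ?k + 1..<Suc m]"
    proof -
      have "filter (\<lambda>i. i \<le> m + n - ?k \<and> m + n - ?k + 1 - i \<le> n) [1..<Suc m] = [m - ?k + 1..<Suc m]"
        by (rule filter_upt_interval) (use k mn in auto)
      then show ?thesis by (simp add: \<B>)
    qed
    have len: "length (\<B> ?k) = ?k" "length (\<B> (m + n - ?k)) = ?k"
      unfolding Bk Btop using k by auto
    have nth1: "\<B> ?k ! j = v (Suc j) (?k - j)" if "j < ?k" for j
      unfolding Bk using that by (simp add: nth_upt del: upt_Suc)
    have nth2: "\<B> (m + n - ?k) ! j = v (m - ?k + 1 + j) (n - j)" if "j < ?k" for j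
    proof -
      have "m + n - ?k + 1 - (m - ?k + 1 + j) = n - j" using that k by auto
      then show ?thesis unfolding Btop using that k by (simp add: nth_upt del: upt_Suc)
    qed
    let ?A = "inverse (of_int d) \<cdot>\<^sub>m mat ?k ?k (\<lambda>(i', j'). of_int (z (i' + 1) (j' + 1)))"
    have mat: "is_matrix_of tensor_scale (\<B> ?k) (\<B> (m + n - ?k)) (Sinv ?k) ?A"
      unfolding is_matrix_of_def len
    proof (intro conjI allI impI)
      fix j assume j: "j < ?k"
      let ?w = "\<Sum>i<?k. (inverse (of_int d) * of_int (z (Suc i) (Suc j))) *\<^sub>T v (m - ?k + 1 + i) (n - i)"
      have "?w \<in> D (m + n - ?k)" unfolding D by (rule GR.upper_line_layer[OF k])
      then have "Sinv ?k (\<B> ?k ! j) = ?w"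
        unfolding nth1[OF j] inverse[OF j, symmetric] by (rule Sinv_S[OF i])
      also have "\<dots> = (\<Sum>i'<?k. ?A $$ (i', j) *\<^sub>T \<B> (m + n - ?k) ! i')"
        using j by (intro sum.cong refl) (simp add: nth2)
      finally show "Sinv ?k (\<B> ?k ! j) = (\<Sum>i'<?k. ?A $$ (i', j) *\<^sub>T \<B> (m + n - ?k) ! i')" .
    qed simp
    have eqs: "lam i = m + n - 2 * i + 1" "m + n - 2 * i + 1 = m + n - 2 * b i + 1"
      using sum[OF i] ab ib level(1-3)[OF i] mn by auto
    show ?thesis
    proof (intro conjI exI[of _ d] exI[of _ z] ballI)
      show "of_int (z i' j') = z_rat (m + n - 2 * b i) (m - b i) (b i) i' j'"
        if "i' \<in> {1..b i}" "j' \<in> {1..b i}" for i' j'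
        using z that .
    qed (fact ib eqs d d0 mat)+
  qed

  have part2: "N ^^ (lam i - 1) \<in> D (m + n - a i - 1) \<rightarrow> D (b i) \<and>
      R (a i) (b i) \<in> D (m + n - a i - 1) \<rightarrow> D (m + n - b i) \<and>
      inj_on (R (a i) (b i)) (D (m + n - a i - 1)) \<and>
      (\<forall>z\<in>D (m + n - a i - 1). (N ^^ (lam i - 1)) z = S (b i) (R (a i) (b i) z)) \<and>
      Sinv (b i) (x (b i)) \<in> R (a i) (b i) ` D (m + n - a i - 1) \<and>
      (\<forall>\<alpha> :: nat \<Rightarrow> 'f.
         U (a i) (b i) (\<Sum>j=m - b i + 1..m. \<alpha> j *\<^sub>T v j (m + n - b i + 1 - j)) =
         (\<Sum>k=m - a i..m.
            (\<Sum>t=k..m. (-1) ^ (t - k) * of_nat ((t - k + b i - a i - 2) choose (b i - a i - 2)) * \<alpha> t)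
              *\<^sub>T v k (m + n - a i - k))) \<and>
      (\<forall>z\<in>D (m + n - a i - 1). U (a i) (b i) (R (a i) (b i) z) = z) \<and>
      (\<forall>z\<in>R (a i) (b i) ` D (m + n - a i - 1).
         U (a i) (b i) z \<in> D (m + n - a i - 1) \<and> R (a i) (b i) (U (a i) (b i) z) = z) \<and>
      y (a i + 1) \<in> D (m + n - a i - 1)"
    if i: "i \<in> {1..m}" and ab: "a i + 1 < b i" for i
  proof (intro conjI ballI allI)
    have into: "(N ^^ (m + n - 2 * b i)) z \<in> D (b i)" if "z \<in> D (m + n - b i)" for z
      using bij[OF i] that by (auto simp: bij_betw_def)
    show "N ^^ (lam i - 1) \<in> D (m + n - a i - 1) \<rightarrow> D (b i)"
      unfolding Pi_iff S_R[OF i] using into R_in[OF i] by blast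
    show "R (a i) (b i) \<in> D (m + n - a i - 1) \<rightarrow> D (m + n - b i)"
      using R_in[OF i] R_eq by auto
    have "inj_on (N ^^ (b i - a i - 1)) (D (m + n - a i - 1))"
      unfolding D using ab level(1-3)[OF i] by (intro GJ.upper_inj) auto
    then show "inj_on (R (a i) (b i)) (D (m + n - a i - 1))"
      using R_eq by (simp add: inj_on_def)
    show "(N ^^ (lam i - 1)) z = S (b i) (R (a i) (b i) z)" if z: "z \<in> D (m + n - a i - 1)" for z
      unfolding R_eq[OF z] S_R[OF i] S using R_in[OF i z] by simp
    show "Sinv (b i) (x (b i)) \<in> R (a i) (b i) ` D (m + n - a i - 1)"
      using top[OF i] R_eq by (metis imageI)
    show "U (a i) (b i) (R (a i) (b i) z) = z" if "z \<in> D (m + n - a i - 1)" for z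
      unfolding R_eq[OF that] by (rule U_R[OF i ab that])
    show "y (a i + 1) \<in> D (m + n - a i - 1)" using gen[OF i] by blast
    fix z assume "z \<in> R (a i) (b i) ` D (m + n - a i - 1)"
    then obtain z' where z': "z' \<in> D (m + n - a i - 1)" "z = R (a i) (b i) z'" by blast
    have "U (a i) (b i) z = z'" unfolding z'(2) R_eq[OF z'(1)] by (rule U_R[OF i ab z'(1)])
    then show "U (a i) (b i) z \<in> D (m + n - a i - 1)" "R (a i) (b i) (U (a i) (b i) z) = z"
      using z' by simp_all
  next
    fix \<alpha> :: "nat \<Rightarrow> 'f"
    let ?z = "\<Sum>j\<in>{m - b i + 1..m}. \<alpha> j *\<^sub>T v j (m + n - b i + 1 - j)"
    have A: "{m - b i + 1..m} \<subseteq> {1..m}"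
      "\<And>j. j \<in> {m - b i + 1..m} \<Longrightarrow> j \<le> m + n - b i \<and> m + n - b i + 1 \<le> n + j"
      using level(1-3)[OF i] mn by auto
    have z: "?z \<in> D (m + n - b i)" unfolding D by (rule GR.line_layer[OF A])
    show "U (a i) (b i) ?z = (\<Sum>k=m - a i..m.
        (\<Sum>t=k..m. (-1) ^ (t - k) * of_nat ((t - k + b i - a i - 2) choose (b i - a i - 2)) * \<alpha> t)
          *\<^sub>T v k (m + n - a i - k))"
      unfolding U_coef[OF i z]
    proof (intro sum.cong refl arg_cong[where f = "\<lambda>c. c *\<^sub>T _"] arg_cong[where f = "\<lambda>c. _ * c"])
      fix k t assume kt: "k \<in> {m - a i..m}" "t \<in> {k..m}"
      have "coef t (m + n - b i + 1 - t) ?z =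
          (if t \<in> {m - b i + 1..m} \<and> t + (m + n - b i + 1 - t) = m + n - b i + 1 then \<alpha> t else 0)"
        by (rule GR.coef_line[OF A])
      then show "coef t (m + n - b i + 1 - t) ?z = \<alpha> t" using kt ab level(1-3)[OF i] mn by auto
    qed
  qed

  have part3: "(\<exists>\<alpha> :: nat \<Rightarrow> 'f.
      y (a i + 1) = (\<Sum>j=m - a i..m. \<alpha> j *\<^sub>T v j (m + n - a i - j)) \<and>
      y i = (-1) ^ (i - a i - 1) *\<^sub>T
        (\<Sum>j=m - i + 1..m + a i - i + 1. \<alpha> (j + i - a i - 1) *\<^sub>T v j (m + n + 1 - i - j)))"
    if i: "i \<in> {1..m}" and ab: "a i + 1 < b i" "a i + 2 \<le> i" for i
  proof (rule exI[of _ "\<lambda>j. coef j (m + n - a i - j) (y (a i + 1))"], intro conjI)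
    let ?k = "m + n - a i - 1"
    have set: "{t \<in> {1..m}. t \<le> ?k \<and> ?k + 1 \<le> n + t} = {m - a i..m}"
      using level(1-3)[OF i] mn by auto
    have k: "?k + 1 = m + n - a i" using level(1-3)[OF i] mn by auto
    have "GR.proj ?k (y (a i + 1)) = y (a i + 1)" using gen[OF i] unfolding D by (intro GR.proj_id) blast
    then show "y (a i + 1) = (\<Sum>j=m - a i..m. coef j (m + n - a i - j) (y (a i + 1)) *\<^sub>T v j (m + n - a i - j))"
      unfolding GR.proj_def set unfolding k by (rule sym)
  qed (rule y3'[OF i ab])

  have part4: "(N ^^ (lam i - 1)) (y i) = x (m + n - i - lam i + 1) \<and>
      fg_iso G tensor_scale (T\<lparr>vspace := fg_cyclic G tensor_scale T (y i)\<rparr>) s (V (lam i))"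
    if i: "i \<in> {1..m}" for i
  proof
    have "m + n - i - lam i + 1 = a i + b i + 1 - i" using sum[OF i] level(1-3)[OF i] mn by auto
    then show "(N ^^ (lam i - 1)) (y i) = x (m + n - i - lam i + 1)" using y_top[OF i] by simp
    have y: "y i \<in> vspace T" "(CT.N ^^ lam i) (y i) = 0"
      and ind: "TL.fam_indep (TL.strings {1..m} lam) (\<lambda>(i, j). (CT.N ^^ j) (y i))"
      using jordan i by (auto simp: TL.jordan_basis_def)
    have "TL.fam_indep (Pair i ` {..<lam i}) (\<lambda>(i, j). (CT.N ^^ j) (y i))"
      by (rule TL.fam_indep_subset[OF _ _ ind]) (use i in auto)
    from TL.fam_indep_reindex[OF _ this]
    have "TL.fam_indep {..<lam i} (\<lambda>j. (CT.N ^^ j) (y i))" by (simp add: inj_on_def)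
    then have "CT.string_module (fg_cyclic G tensor_scale T (y i)) (lam i) (y i)"
      unfolding CT.string_module_def using y CT.fg_cyclic_string[OF y] by simp
    then show "fg_iso G tensor_scale (T\<lparr>vspace := fg_cyclic G tensor_scale T (y i)\<rparr>) s (V (lam i))"
      by (rule fg_iso_strings[OF CT.cyclic_module_axioms Vmod[OF lamq[OF i]] _ zV[OF i]])
  qed
  have part5: "internal_direct_sum G tensor_scale {1..m} (\<lambda>i. fg_cyclic G tensor_scale T (y i)) T"
    by (rule CT.internal_direct_sum_strings[OF finite_atLeastAtMost jordan])

  show ?thesis
    by (intro conjI; ((rule ballI, rule part0 part4; assumption) | rule part5
      | (rule ballI, rule impI, (elim conjE)?, (rule part1 part2 conjI[OF part3 y_layer]; assumption))))
qed

end
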